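(* For each $n\ge 1$ let $U_n$ be Haar distributed on $U(n)$. For all $z\in\mathbb{R}$, the number of eigenvalues of $U_n$ in the arc of the unit circle between $1$ and $e^{2i\pi z/n}$ tends in law, as $n\to\infty$, to the number of points of a determinantal sine-kernel process in an interval of length $|z|$.
   Context: For $n>|z|$, the arc between $1$ and $e^{2i\pi z/n}$ is $\{e^{2i\pi t/n}: t \text{ between } 0 \text{ and } z\}$. A determinantal sine-kernel process is a point process on $\mathbb{R}$ whose $r$-point correlation functions are $\rho_r(x_1,\dots,x_r)=\det\left(\frac{\sin[\pi(x_j-x_k)]}{\pi(x_j-x_k)}\right)_{1\le j,k\le r}$ for all $r\ge1$ (with value $1$ on the diagonal). *)

theory Defs
  imports
    "HOL-Probability.Probability"
    "Jordan_Normal_Form.Char_Poly"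
    "Jordan_Normal_Form.Schur_Decomposition"
begin

(* HOL-Analysis and Jordan_Normal_Form share some constant names (mat, det);
   matrices and determinants here are always those of Jordan_Normal_Form, since n varies. *)

definition unitary_group :: "nat \<Rightarrow> complex mat set" where
  "unitary_group n = {A \<in> carrier_mat n n. mat_adjoint A * A = 1\<^sub>m n}"

(* The Borel sigma-algebra of U(n): the trace of that of the n * n complex entries. *)
definition unitary_borel :: "nat \<Rightarrow> complex mat measure" where
  "unitary_borel n =
     vimage_algebra (unitary_group n)
       (\<lambda>A. \<lambda>(i, j) \<in> {..<n} \<times> {..<n}. A $$ (i, j))
       (PiM ({..<n} \<times> {..<n}) (\<lambda>_. borel))"

(* U(n) is compact, so the left-invariant probability measure is unique and bi-invariant. *)
definition haar_unitary :: "nat \<Rightarrow> complex mat measure \<Rightarrow> bool" where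
  "haar_unitary n \<mu> \<longleftrightarrow>
     prob_space \<mu> \<and> sets \<mu> = sets (unitary_borel n) \<and>
     (\<forall>V \<in> unitary_group n. \<forall>S \<in> sets \<mu>. emeasure \<mu> ((\<lambda>A. V * A) ` S) = emeasure \<mu> S)"

(* The arc between 1 and exp (2 pi i z / n), meant for n > |z|. *)
definition circle_arc :: "nat \<Rightarrow> real \<Rightarrow> complex set" where
  "circle_arc n z = (\<lambda>t. exp (2 * \<i> * of_real pi * of_real t / of_nat n)) ` closed_segment 0 z"

(* Eigenvalues are counted with algebraic multiplicity. *)
definition eigenvalue_count :: "complex mat \<Rightarrow> complex set \<Rightarrow> nat" where
  "eigenvalue_count A S = (\<Sum>e | eigenvalue A e \<and> e \<in> S. Polynomial.order e (char_poly A))"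

(* A point configuration is given by its multiplicity function c :: real => nat.
   A point of multiplicity m at x is represented by the labelled points (x, 0), ..., (x, m - 1),
   so that tuples of distinct points may repeat a location up to its multiplicity. *)
definition config_points :: "(real \<Rightarrow> nat) \<Rightarrow> (real \<times> nat) set" where
  "config_points c = {(x, k). k < c x}"

definition point_count :: "(real \<Rightarrow> nat) \<Rightarrow> real set \<Rightarrow> nat" where
  "point_count c B = card {p \<in> config_points c. fst p \<in> B}"

definition locally_finite_config :: "(real \<Rightarrow> nat) \<Rightarrow> bool" where
  "locally_finite_config c \<longleftrightarrow> (\<forall>B. bounded B \<longrightarrow> finite {p \<in> config_points c. fst p \<in> B})"

definition point_process :: "'a measure \<Rightarrow> ('a \<Rightarrow> real \<Rightarrow> nat) \<Rightarrow> bool" where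
  "point_process M X \<longleftrightarrow>
     prob_space M \<and>
     (\<forall>\<omega> \<in> space M. locally_finite_config (X \<omega>)) \<and>
     (\<forall>B \<in> sets borel. bounded B \<longrightarrow>
        (\<lambda>\<omega>. point_count (X \<omega>) B) \<in> measurable M (count_space UNIV))"

(* \<rho> is the r-point correlation function: for every Borel F >= 0, the expected sum of
   F (x_1, ..., x_r) over r-tuples of distinct points is the integral of F * \<rho> over R^r.
   Here R^r consists of the (extensional) functions on {..<r}. *)
definition correlation_function ::
    "'a measure \<Rightarrow> ('a \<Rightarrow> real \<Rightarrow> nat) \<Rightarrow> nat \<Rightarrow> ((nat \<Rightarrow> real) \<Rightarrow> real) \<Rightarrow> bool" where
  "correlation_function M X r \<rho> \<longleftrightarrow>
     (\<forall>x. 0 \<le> \<rho> x) \<and>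
     \<rho> \<in> borel_measurable (PiM {..<r} (\<lambda>_. lborel)) \<and>
     (\<forall>F \<in> borel_measurable (PiM {..<r} (\<lambda>_. lborel)).
        (\<integral>\<^sup>+ \<omega>.
           (\<integral>\<^sup>+ p. F (\<lambda>i \<in> {..<r}. fst (p i))
              \<partial>count_space {p \<in> {..<r} \<rightarrow>\<^sub>E config_points (X \<omega>). inj_on p {..<r}})
         \<partial>M)
        = (\<integral>\<^sup>+ x. F x * ennreal (\<rho> x) \<partial>PiM {..<r} (\<lambda>_. lborel)))"

definition sine_kernel :: "real \<Rightarrow> real \<Rightarrow> real" where
  "sine_kernel x y = (if x = y then 1 else sin (pi * (x - y)) / (pi * (x - y)))"

definition sine_kernel_process :: "'a measure \<Rightarrow> ('a \<Rightarrow> real \<Rightarrow> nat) \<Rightarrow> bool" where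
  "sine_kernel_process M X \<longleftrightarrow>
     point_process M X \<and>
     (\<forall>r \<ge> 1. correlation_function M X r
        (\<lambda>x. Determinant.det (Matrix.mat r r (\<lambda>(j, k). sine_kernel (x j) (x k)))))"

end

theory Submission
  imports Defs
begin

text \<open>
  Invariance of Haar measure under left multiplication by one-parameter subgroups gives first-order
  loop equations for the power sums of the eigenvalues. They imply a recursion for the moments of
  the monomial symmetric functions which has a unique solution and is also solved by the moments of
  the Weyl density, so the latter are the moments of the eigenvalues and the Weyl integration formula
  itself is not needed. Approximating indicators of arcs by Laurent polynomials, the \<open>r\<close>-th
  binomial moment of the number of eigenvalues in the arc is \<open>1 / r!\<close> times the integral
  over \<open>I\<^sup>r\<close> of the determinant of a Dirichlet kernel. These determinants are
  correlation matrices, hence bounded by 1, and they converge to the determinants of the sine kernel.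
  By dominated convergence the binomial moments converge to those of the sine process; being at most
  \<open>\<bar>z\<bar>\<^sup>r / r!\<close>, they determine the distributions by inclusion-exclusion.
\<close>

section \<open>Power sums and injective tuples\<close>

text \<open>Left invariance is all that is known of Haar measure, so two things are missing at the
  start: an enumeration of the eigenvalues that is measurable, and the fact that eigenvalues are
  almost surely distinct. The first is why everything is phrased through power sums, which are
  traces of powers of \<open>U\<close>. The second matters because the calculus with the Weyl
  density divides by \<open>z i - z j\<close>; the resulting identity has both sides continuous in
  nonzero \<open>z\<close>, so it is proved for distinct points and extended to coinciding ones by a
  perturbation. Monomials in distinct eigenvalues are obtained from power sums by subtracting
  collisions, and the vector fields behind the recursion arise from the same subtraction with one
  slot pinned to a chosen eigenvalue. On the Weyl side no torus integral is formed: a moment is a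
  finite sum over pairs of permutations, and averages over grids of roots of unity take the place of
  integration.\<close>

definition psum :: "nat \<Rightarrow> int \<Rightarrow> (nat \<Rightarrow> complex) \<Rightarrow> complex" where
  "psum n l z = (\<Sum>i<n. z i powi l)"

definition inj_tuples :: "nat \<Rightarrow> nat \<Rightarrow> (nat \<Rightarrow> nat) set" where
  "inj_tuples r n = {\<phi> \<in> {..<r} \<rightarrow>\<^sub>E {..<n}. inj_on \<phi> {..<r}}"

definition monom_at :: "nat \<Rightarrow> (nat \<Rightarrow> int) \<Rightarrow> (nat \<Rightarrow> complex) \<Rightarrow> (nat \<Rightarrow> nat) \<Rightarrow> complex" where
  "monom_at r k z \<phi> = (\<Prod>a<r. z (\<phi> a) powi k a)"

lemma finite_inj_tuples [simp]: "finite (inj_tuples r n)"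
  unfolding inj_tuples_def by (rule finite_subset[of _ "{..<r} \<rightarrow>\<^sub>E {..<n}"]) (auto intro: finite_PiE)

lemma inj_tuples_less: "\<phi> \<in> inj_tuples r n \<Longrightarrow> a < r \<Longrightarrow> \<phi> a < n"
  by (auto simp: inj_tuples_def PiE_def Pi_def)

lemma inj_tuples_inj: "\<phi> \<in> inj_tuples r n \<Longrightarrow> inj_on \<phi> {..<r}"
  by (auto simp: inj_tuples_def)

lemma sum_inj_tuples_Suc:
  "(\<Sum>\<phi>\<in>inj_tuples (Suc r) n. F \<phi>) =
   (\<Sum>\<phi>\<in>inj_tuples r n. \<Sum>v\<in>{..<n} - \<phi> ` {..<r}. F (\<phi>(r := v)))"
proof -
  have "(\<Sum>\<phi>\<in>inj_tuples r n. \<Sum>v\<in>{..<n} - \<phi> ` {..<r}. F (\<phi>(r := v))) =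
     (\<Sum>(\<phi>, v)\<in>(SIGMA \<phi>:inj_tuples r n. {..<n} - \<phi> ` {..<r}). F (\<phi>(r := v)))"
    by (rule sum.Sigma) auto
  also have "\<dots> = (\<Sum>\<phi>\<in>inj_tuples (Suc r) n. F \<phi>)"
  proof (rule sum.reindex_bij_witness[of _ "\<lambda>\<phi>. (restrict \<phi> {..<r}, \<phi> r)" "\<lambda>(\<phi>, v). \<phi>(r := v)"], goal_cases)
    case (1 a)
    then obtain \<phi> v where a: "a = (\<phi>, v)" "\<phi> \<in> inj_tuples r n" "v < n" "v \<notin> \<phi> ` {..<r}"
      by (cases a) auto
    have "restrict (\<phi>(r := v)) {..<r} = \<phi>"
      using a(2) by (auto simp: inj_tuples_def PiE_def extensional_def restrict_def fun_eq_iff)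
    then show ?case using a by simp
  next
    case (2 a)
    then obtain \<phi> v where a: "a = (\<phi>, v)" "\<phi> \<in> inj_tuples r n" "v < n" "v \<notin> \<phi> ` {..<r}"
      by (cases a) auto
    have "inj_on (\<phi>(r := v)) {..<Suc r}"
      using a(2,4) by (auto simp: inj_tuples_def inj_on_def less_Suc_eq image_iff)
    moreover have "\<phi>(r := v) \<in> {..<Suc r} \<rightarrow>\<^sub>E {..<n}"
      using a(2,3) by (auto simp: inj_tuples_def PiE_def Pi_def extensional_def less_Suc_eq)
    ultimately show ?case using a by (simp add: inj_tuples_def)
  next
    case (3 b)
    then have "b x = undefined" if "x \<ge> Suc r" for x
      using that by (auto simp: inj_tuples_def PiE_def extensional_def)
    then have "((restrict b {..<r})(r := b r)) x = b x" for x
      by (cases "x < r"; cases "x = r") auto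
    then show ?case unfolding prod.case by (rule ext)
  next
    case (4 b)
    have "inj_on (restrict b {..<r}) {..<r}"
      using inj_on_subset[OF inj_tuples_inj[OF 4], of "{..<r}"] by (simp add: inj_on_restrict_eq)
    moreover have "restrict b {..<r} \<in> {..<r} \<rightarrow>\<^sub>E {..<n}"
      using inj_tuples_less[OF 4] by simp
    ultimately have "restrict b {..<r} \<in> inj_tuples r n"
      unfolding inj_tuples_def by simp
    moreover have "b r \<noteq> b x" if "x < r" for x
      using inj_onD[OF inj_tuples_inj[OF 4], of r x] that by auto
    then have "b r \<notin> restrict b {..<r} ` {..<r}" by auto
    ultimately show ?case using inj_tuples_less[OF 4, of r] by auto
  qed auto
  finally show ?thesis by simp
qed

lemma inj_tuples_0: "inj_tuples 0 n = {\<lambda>_. undefined}"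
  by (auto simp: inj_tuples_def)

text \<open>Multiplying by a power sum lets the new slot range over all indices; the tuples in which
  it collides with slot \<open>a\<close> merge the two exponents and are subtracted. The weight
  \<open>g\<close> ignores the last slot: weight 1 expresses symmetric sums by power sums, and the
  indicator of \<open>\<phi> 0 = i\<close> builds the slot fields.\<close>

lemma sum_inj_tuples_mult_psum:
  assumes z: "\<And>i. i < n \<Longrightarrow> z i \<noteq> 0"
    and g: "\<And>\<phi> v. \<phi> \<in> inj_tuples r n \<Longrightarrow> g (\<phi>(r := v)) = g' \<phi>"
  shows "(\<Sum>\<phi>\<in>inj_tuples (Suc r) n. g \<phi> * monom_at (Suc r) k z \<phi>) =
     (\<Sum>\<phi>\<in>inj_tuples r n. g' \<phi> * monom_at r k z \<phi>) * psum n (k r) z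
     - (\<Sum>a<r. \<Sum>\<phi>\<in>inj_tuples r n. g' \<phi> * monom_at r (k(a := k a + k r)) z \<phi>)"
proof -
  have mono: "monom_at (Suc r) k z (\<phi>(r := v)) = monom_at r k z \<phi> * z v powi k r" for \<phi> v
    unfolding monom_at_def by (simp add: lessThan_Suc mult.commute)
  have shift: "monom_at r k z \<phi> * z (\<phi> a) powi k r = monom_at r (k(a := k a + k r)) z \<phi>"
    if "\<phi> \<in> inj_tuples r n" "a < r" for \<phi> a
  proof -
    have nz: "z (\<phi> a) \<noteq> 0" using z inj_tuples_less that by blast
    have "monom_at r (k(a := k a + k r)) z \<phi> =
        z (\<phi> a) powi (k a + k r) * (\<Prod>b\<in>{..<r} - {a}. z (\<phi> b) powi k b)"
      unfolding monom_at_def using that(2) by (subst prod.remove[of _ a]) auto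
    moreover have "monom_at r k z \<phi> = z (\<phi> a) powi k a * (\<Prod>b\<in>{..<r} - {a}. z (\<phi> b) powi k b)"
      unfolding monom_at_def using that(2) by (subst prod.remove[of _ a]) auto
    ultimately show ?thesis using nz by (simp add: power_int_add)
  qed
  have inner: "(\<Sum>v\<in>{..<n} - \<phi> ` {..<r}. g (\<phi>(r := v)) * monom_at (Suc r) k z (\<phi>(r := v)))
     = g' \<phi> * monom_at r k z \<phi> * psum n (k r) z - (\<Sum>a<r. g' \<phi> * monom_at r (k(a := k a + k r)) z \<phi>)"
    if \<phi>: "\<phi> \<in> inj_tuples r n" for \<phi>
  proof -
    have sub: "\<phi> ` {..<r} \<subseteq> {..<n}" using inj_tuples_less[OF \<phi>] by auto
    have "(\<Sum>v\<in>{..<n} - \<phi> ` {..<r}. z v powi k r) = psum n (k r) z - (\<Sum>a<r. z (\<phi> a) powi k r)"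
      using sub sum.reindex[OF inj_tuples_inj[OF \<phi>], of "\<lambda>v. z v powi k r"]
      by (simp add: psum_def sum_diff)
    then have "g' \<phi> * monom_at r k z \<phi> * (\<Sum>v\<in>{..<n} - \<phi> ` {..<r}. z v powi k r) =
        g' \<phi> * monom_at r k z \<phi> * psum n (k r) z - (\<Sum>a<r. g' \<phi> * (monom_at r k z \<phi> * z (\<phi> a) powi k r))"
      by (simp add: right_diff_distrib sum_distrib_left mult.assoc)
    then show ?thesis
      using \<phi> by (simp add: g mono shift sum_distrib_left mult.assoc)
  qed
  show ?thesis
    unfolding sum_inj_tuples_Suc
    by (subst sum.swap[of _ "inj_tuples r n"]) (simp add: inner sum_subtractf sum_distrib_right)
qed

text \<open>Differentiating the \<open>k\<close> factors of a matrix power splits its trace into a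
  product of two traces, and this is their sum. The range \<open>l < k\<close> keeps the term
  \<open>l = 0\<close>, where the power sum is \<open>n\<close>, and omits \<open>l = k\<close>. The
  negative case is fixed by conjugation symmetry on the unit circle.\<close>

definition split_psum :: "nat \<Rightarrow> int \<Rightarrow> (nat \<Rightarrow> complex) \<Rightarrow> complex" where
  "split_psum n k z =
     (if k \<ge> 0 then \<Sum>l<nat k. psum n (int l) z * psum n (k - int l) z
      else - (\<Sum>l<nat (- k). psum n (- int l) z * psum n (k + int l) z))"

text \<open>On distinct points the split sum is the divergence of the field with coordinates
  \<open>z i powi k\<close> against the Weyl density. The diagonal \<open>i = j\<close> gives
  \<open>k\<close> times a power sum. The rest is a geometric sum with denominator
  \<open>z i - z j\<close>; exchanging \<open>i\<close> and \<open>j\<close> in one of its halves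
  makes both carry a power of \<open>z i\<close>.\<close>

lemma split_psum_nonneg_eq:
  assumes d: "inj_on z {..<n}" and k: "k \<ge> 0" and nz: "\<And>i. i < n \<Longrightarrow> z i \<noteq> 0"
  shows "split_psum n k z = of_int k * psum n k z
    + (\<Sum>i<n. \<Sum>j\<in>{..<n} - {i}. z i powi k * ((z i + z j) / (z i - z j)))"
proof -
  define m where "m = nat k"
  have km: "k = int m" using k by (simp add: m_def)
  have pw: "psum n (int m - int l) z = (\<Sum>i<n. z i ^ (m - l))" if "l < m" for l
    unfolding psum_def using that by (intro sum.cong refl) (metis of_nat_diff less_imp_le power_int_of_nat)
  have geo: "(\<Sum>l<m. a ^ l * b ^ (m - l)) = b * (a ^ m - b ^ m) / (a - b)" if "a \<noteq> b" for a b :: complex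
  proof -
    have "(a - b) * (\<Sum>l<m. a ^ l * b ^ (m - l)) = (a - b) * (\<Sum>l<m. b * (b ^ (m - Suc l) * a ^ l))"
      by (intro arg_cong[where f = "\<lambda>x. (a - b) * x"] sum.cong refl)
         (auto simp: Suc_diff_Suc simp flip: power_Suc)
    also have "\<dots> = b * (a ^ m - b ^ m)"
      by (simp add: power_diff_sumr2[of a m b] sum_distrib_left[symmetric] mult_ac)
    finally show ?thesis using that by (simp add: field_simps)
  qed
  have "split_psum n k z = (\<Sum>l<m. (\<Sum>i<n. z i ^ l) * (\<Sum>j<n. z j ^ (m - l)))"
    unfolding split_psum_def km by (simp add: pw) (simp add: psum_def)
  also have "\<dots> = (\<Sum>l<m. \<Sum>i<n. \<Sum>j<n. z i ^ l * z j ^ (m - l))"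
    by (simp add: sum_product)
  also have "\<dots> = (\<Sum>i<n. \<Sum>l<m. \<Sum>j<n. z i ^ l * z j ^ (m - l))" by (rule sum.swap)
  also have "\<dots> = (\<Sum>i<n. \<Sum>j<n. \<Sum>l<m. z i ^ l * z j ^ (m - l))"
    by (intro sum.cong refl sum.swap)
  also have "\<dots> = (\<Sum>i<n. (\<Sum>l<m. z i ^ l * z i ^ (m - l)) + (\<Sum>j\<in>{..<n} - {i}. \<Sum>l<m. z i ^ l * z j ^ (m - l)))"
    by (intro sum.cong refl sum.remove) auto
  also have "\<dots> = (\<Sum>i<n. of_nat m * z i ^ m) + (\<Sum>i<n. \<Sum>j\<in>{..<n} - {i}. z j * (z i ^ m - z j ^ m) / (z i - z j))"
  proof -
    have "(\<Sum>l<m. z i ^ l * z i ^ (m - l)) = of_nat m * z i ^ m" for i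
      by (simp flip: power_add)
    moreover have "(\<Sum>j\<in>{..<n} - {i}. \<Sum>l<m. z i ^ l * z j ^ (m - l))
       = (\<Sum>j\<in>{..<n} - {i}. z j * (z i ^ m - z j ^ m) / (z i - z j))" if "i < n" for i
      using d that by (intro sum.cong refl geo) (auto simp: inj_on_def)
    ultimately show ?thesis by (simp add: sum.distrib)
  qed
  also have "(\<Sum>i<n. \<Sum>j\<in>{..<n} - {i}. z j * (z i ^ m - z j ^ m) / (z i - z j)) =
     (\<Sum>i<n. \<Sum>j\<in>{..<n} - {i}. z j * z i ^ m / (z i - z j)) - (\<Sum>i<n. \<Sum>j\<in>{..<n} - {i}. z j ^ Suc m / (z i - z j))"
    by (simp add: sum_subtractf[symmetric] diff_divide_distrib algebra_simps)
  also have "(\<Sum>i<n. \<Sum>j\<in>{..<n} - {i}. z j ^ Suc m / (z i - z j)) = (\<Sum>j<n. \<Sum>i\<in>{..<n} - {j}. z j ^ Suc m / (z i - z j))"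
  proof -
    have "(\<Sum>i<n. \<Sum>j\<in>{..<n} - {i}. f i j) = (\<Sum>j<n. \<Sum>i\<in>{..<n} - {j}. f i j)" for f :: "nat \<Rightarrow> nat \<Rightarrow> complex"
    proof -
      have "(\<Sum>i<n. \<Sum>j\<in>{..<n} - {i}. f i j) = (\<Sum>i<n. \<Sum>j<n. if i = j then 0 else f i j)"
        by (intro sum.cong refl sum.mono_neutral_cong_left) auto
      also have "\<dots> = (\<Sum>j<n. \<Sum>i<n. if i = j then 0 else f i j)" by (rule sum.swap)
      also have "\<dots> = (\<Sum>j<n. \<Sum>i\<in>{..<n} - {j}. f i j)"
        by (intro sum.cong refl sum.mono_neutral_cong_right) auto
      finally show ?thesis .
    qed
    then show ?thesis .
  qed
  also have "(\<Sum>i<n. \<Sum>j\<in>{..<n} - {i}. z j * z i ^ m / (z i - z j)) - (\<Sum>j<n. \<Sum>i\<in>{..<n} - {j}. z j ^ Suc m / (z i - z j))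
     = (\<Sum>i<n. \<Sum>j\<in>{..<n} - {i}. z i powi k * ((z i + z j) / (z i - z j)))"
    unfolding sum_subtractf[symmetric]
  proof (intro sum.cong refl)
    fix i j assume ij: "i \<in> {..<n}" "j \<in> {..<n} - {i}"
    then have "z i \<noteq> z j" using d by (auto simp: inj_on_def)
    then have "z i - z j \<noteq> 0" "z j - z i \<noteq> 0" by auto
    then show "z j * z i ^ m / (z i - z j) - z i ^ Suc m / (z j - z i) = z i powi k * ((z i + z j) / (z i - z j))"
      by (simp add: km divide_simps) (simp add: algebra_simps)
  qed
  finally show ?thesis
    by (simp add: km psum_def sum_distrib_left)
qed

text \<open>Negative \<open>k\<close> reduce to positive ones by inverting the points, which turns
  \<open>(z i + z j) / (z i - z j)\<close> into its negative.\<close>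

lemma split_psum_eq:
  assumes d: "inj_on z {..<n}" and nz: "\<And>i. i < n \<Longrightarrow> z i \<noteq> 0"
  shows "split_psum n k z = of_int k * psum n k z
    + (\<Sum>i<n. \<Sum>j\<in>{..<n} - {i}. z i powi k * ((z i + z j) / (z i - z j)))"
proof (cases "k \<ge> 0")
  case True
  then show ?thesis using split_psum_nonneg_eq[OF d] nz by blast
next
  case False
  define w where "w = (\<lambda>i. inverse (z i))"
  have w: "w i powi l = z i powi (- l)" for i l
    by (simp add: w_def power_int_minus power_int_inverse)
  have pw: "psum n l w = psum n (- l) z" for l by (simp add: psum_def w)
  have "inj_on w {..<n}" using d by (auto simp: inj_on_def w_def)
  then have *: "split_psum n (- k) w = of_int (- k) * psum n (- k) w
    + (\<Sum>i<n. \<Sum>j\<in>{..<n} - {i}. w i powi (- k) * ((w i + w j) / (w i - w j)))"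
    using False nz by (intro split_psum_nonneg_eq) (auto simp: w_def)
  have "split_psum n k z = - split_psum n (- k) w"
    using False by (simp add: split_psum_def pw algebra_simps)
  also have "\<dots> = of_int k * psum n k z
     + (\<Sum>i<n. \<Sum>j\<in>{..<n} - {i}. - (w i powi (- k) * ((w i + w j) / (w i - w j))))"
    unfolding * by (simp add: pw sum_negf)
  also have "(\<Sum>i<n. \<Sum>j\<in>{..<n} - {i}. - (w i powi (- k) * ((w i + w j) / (w i - w j)))) =
     (\<Sum>i<n. \<Sum>j\<in>{..<n} - {i}. z i powi k * ((z i + z j) / (z i - z j)))"
  proof (intro sum.cong refl)
    fix i j assume ij: "i \<in> {..<n}" "j \<in> {..<n} - {i}"
    then have "z i \<noteq> z j" "z i \<noteq> 0" "z j \<noteq> 0" using d nz by (auto simp: inj_on_def)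
    then have "z i - z j \<noteq> 0" "z j - z i \<noteq> 0" "z i \<noteq> 0" "z j \<noteq> 0" by auto
    then have "(w i + w j) / (w i - w j) = - ((z i + z j) / (z i - z j))"
      by (simp add: w_def divide_simps) (simp add: algebra_simps)
    then show "- (w i powi (- k) * ((w i + w j) / (w i - w j))) = z i powi k * ((z i + z j) / (z i - z j))"
      by (simp add: w)
  qed
  finally show ?thesis .
qed

section \<open>The loop equations for monomial symmetric functions\<close>

definition psum_prod :: "nat \<Rightarrow> int list \<Rightarrow> (nat \<Rightarrow> complex) \<Rightarrow> complex" where
  "psum_prod n ls z = (\<Prod>l\<leftarrow>ls. psum n l z)"

text \<open>The derivative of \<open>psum_prod\<close> along \<open>z i d/dz i\<close>, for which
  powers of \<open>z i\<close> are eigenfunctions.\<close>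

fun psum_prod_deriv :: "nat \<Rightarrow> nat \<Rightarrow> int list \<Rightarrow> (nat \<Rightarrow> complex) \<Rightarrow> complex" where
  "psum_prod_deriv n i [] z = 0"
| "psum_prod_deriv n i (l # ls) z =
     of_int l * z i powi l * psum_prod n ls z + psum n l z * psum_prod_deriv n i ls z"

lemma psum_prod_simps [simp]:
  "psum_prod n [] z = 1" "psum_prod n (l # ls) z = psum n l z * psum_prod n ls z"
  by (simp_all add: psum_prod_def)

text \<open>Abstracts from matrices: \<open>Z\<close> stands for an enumeration of the eigenvalues.
  Measurability is asked of the power sums and not of the points, because the enumeration will be an
  arbitrary choice. The last assumption says that the field with coordinates
  \<open>z i powi k\<close> has a divergence of integral zero when tested against products of power
  sums; conjugation supplies the negative \<open>k\<close>.\<close>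

locale loop_equations = prob_space \<mu> for \<mu> :: "'a measure" +
  fixes n :: nat and Z :: "'a \<Rightarrow> nat \<Rightarrow> complex"
  assumes unit: "\<And>\<omega> i. \<omega> \<in> space \<mu> \<Longrightarrow> i < n \<Longrightarrow> norm (Z \<omega> i) = 1"
    and psum_measurable: "\<And>l. (\<lambda>\<omega>. psum n l (Z \<omega>)) \<in> borel_measurable \<mu>"
    and loop_nonneg: "\<And>k ls. k \<ge> 0 \<Longrightarrow> (\<integral>\<omega>. split_psum n k (Z \<omega>) * psum_prod n ls (Z \<omega>)
         + (\<Sum>i<n. Z \<omega> i powi k * psum_prod_deriv n i ls (Z \<omega>)) \<partial>\<mu>) = 0"
begin

text \<open>Bounded and measurable after substituting the points. A single
  \<open>Z \<omega> i\<close> cannot be expected to qualify; what qualifies is built from power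
  sums.\<close>

definition observable :: "((nat \<Rightarrow> complex) \<Rightarrow> complex) \<Rightarrow> bool" where
  "observable F \<longleftrightarrow> (\<lambda>\<omega>. F (Z \<omega>)) \<in> borel_measurable \<mu> \<and> (\<exists>K. \<forall>\<omega>\<in>space \<mu>. norm (F (Z \<omega>)) \<le> K)"

lemma Z_nonzero: "\<omega> \<in> space \<mu> \<Longrightarrow> i < n \<Longrightarrow> Z \<omega> i \<noteq> 0"
  using unit by fastforce

lemma observable_const [intro]: "observable (\<lambda>_. c)"
  unfolding observable_def by auto

lemma observable_psum [intro]: "observable (psum n l)"
proof -
  have "norm (psum n l (Z \<omega>)) \<le> real n" if "\<omega> \<in> space \<mu>" for \<omega>
    unfolding psum_def using sum_norm_bound[of "{..<n}" "\<lambda>i. Z \<omega> i powi l" 1] unit that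
    by (simp add: norm_power_int)
  then show ?thesis unfolding observable_def using psum_measurable by blast
qed

lemma observable_mult [intro]:
  assumes "observable F" "observable G" shows "observable (\<lambda>z. F z * G z)"
proof -
  obtain K L where "\<And>\<omega>. \<omega> \<in> space \<mu> \<Longrightarrow> norm (F (Z \<omega>)) \<le> K" "\<And>\<omega>. \<omega> \<in> space \<mu> \<Longrightarrow> norm (G (Z \<omega>)) \<le> L"
    using assms unfolding observable_def by blast
  then have "norm (F (Z \<omega>) * G (Z \<omega>)) \<le> K * L" if "\<omega> \<in> space \<mu>" for \<omega>
    using that unfolding norm_mult by (meson mult_mono norm_ge_zero order_trans)
  then show ?thesis using assms unfolding observable_def by (auto intro!: exI[of _ "K * L"])
qed

lemma observable_add [intro]:
  assumes "observable F" "observable G" shows "observable (\<lambda>z. F z + G z)"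
proof -
  obtain K L where "\<And>\<omega>. \<omega> \<in> space \<mu> \<Longrightarrow> norm (F (Z \<omega>)) \<le> K" "\<And>\<omega>. \<omega> \<in> space \<mu> \<Longrightarrow> norm (G (Z \<omega>)) \<le> L"
    using assms unfolding observable_def by blast
  then have "norm (F (Z \<omega>) + G (Z \<omega>)) \<le> K + L" if "\<omega> \<in> space \<mu>" for \<omega>
    using that by (meson add_mono norm_triangle_le)
  then show ?thesis using assms unfolding observable_def by (auto intro!: exI[of _ "K + L"])
qed

lemma observable_diff [intro]:
  assumes "observable F" "observable G" shows "observable (\<lambda>z. F z - G z)"
  using observable_add[OF assms(1) observable_mult[OF observable_const[of "-1"] assms(2)]] by simp

lemma observable_sum [intro]:
  assumes "\<And>a. a \<in> A \<Longrightarrow> observable (F a)" shows "observable (\<lambda>z. \<Sum>a\<in>A. F a z)"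
  using assms
  by (induction A rule: infinite_finite_induct) (auto intro!: observable_add)

lemma observable_cong:
  assumes "\<And>z. (\<And>i. i < n \<Longrightarrow> z i \<noteq> 0) \<Longrightarrow> F z = G z"
  shows "observable F \<longleftrightarrow> observable G"
proof -
  have "F (Z \<omega>) = G (Z \<omega>)" if "\<omega> \<in> space \<mu>" for \<omega>
    using assms Z_nonzero that by blast
  then show ?thesis unfolding observable_def by (auto cong: measurable_cong)
qed

lemma observable_psum_prod [intro]: "observable (psum_prod n ls)"
  by (induction ls) (auto simp: psum_prod_simps[abs_def] fun_eq_iff intro: observable_mult)

lemma observable_integrable: "observable F \<Longrightarrow> integrable \<mu> (\<lambda>\<omega>. F (Z \<omega>))"
  unfolding observable_def by (auto intro: integrable_const_bound)

text \<open>Negative exponents follow from positive ones by complex conjugation.\<close>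

lemma cnj_Z: "\<omega> \<in> space \<mu> \<Longrightarrow> i < n \<Longrightarrow> cnj (Z \<omega> i) powi l = Z \<omega> i powi (- l)"
proof -
  assume *: "\<omega> \<in> space \<mu>" "i < n"
  then have "cnj (Z \<omega> i) = inverse (Z \<omega> i)"
    using unit[OF *] complex_norm_square[of "Z \<omega> i"] by (intro inverse_unique[symmetric]) simp
  then show ?thesis by (simp add: power_int_minus power_int_inverse)
qed

lemma cnj_psum: "\<omega> \<in> space \<mu> \<Longrightarrow> cnj (psum n l (Z \<omega>)) = psum n (- l) (Z \<omega>)"
  by (simp add: psum_def cnj_Z)

lemma cnj_psum_prod: "\<omega> \<in> space \<mu> \<Longrightarrow> cnj (psum_prod n ls (Z \<omega>)) = psum_prod n (map uminus ls) (Z \<omega>)"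
  by (induction ls) (auto simp: cnj_psum)

lemma cnj_psum_prod_deriv: "\<omega> \<in> space \<mu> \<Longrightarrow> i < n \<Longrightarrow>
   cnj (psum_prod_deriv n i ls (Z \<omega>)) = - psum_prod_deriv n i (map uminus ls) (Z \<omega>)"
  by (induction ls) (auto simp: cnj_psum cnj_psum_prod cnj_Z)

lemma loop: "(\<integral>\<omega>. split_psum n k (Z \<omega>) * psum_prod n ls (Z \<omega>)
         + (\<Sum>i<n. Z \<omega> i powi k * psum_prod_deriv n i ls (Z \<omega>)) \<partial>\<mu>) = 0"
proof (cases "k \<ge> 0")
  case False
  let ?F = "\<lambda>k ls \<omega>. split_psum n k (Z \<omega>) * psum_prod n ls (Z \<omega>)
         + (\<Sum>i<n. Z \<omega> i powi k * psum_prod_deriv n i ls (Z \<omega>))"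
  have "?F k ls \<omega> = - cnj (?F (- k) (map uminus ls) \<omega>)" if "\<omega> \<in> space \<mu>" for \<omega>
  proof -
    have "cnj (split_psum n (- k) (Z \<omega>)) = - split_psum n k (Z \<omega>)"
      using False that by (simp add: split_psum_def cnj_psum algebra_simps)
    then show ?thesis using that
      by (simp add: cnj_psum_prod cnj_psum_prod_deriv cnj_Z o_def sum_negf)
  qed
  then have "(\<integral>\<omega>. ?F k ls \<omega> \<partial>\<mu>) = (\<integral>\<omega>. - cnj (?F (- k) (map uminus ls) \<omega>) \<partial>\<mu>)"
    by (rule Bochner_Integration.integral_cong[OF refl])
  also have "\<dots> = - cnj (\<integral>\<omega>. ?F (- k) (map uminus ls) \<omega> \<partial>\<mu>)"
    unfolding Bochner_Integration.integral_minus by (subst Bochner_Integration.integral_cnj) (rule refl)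
  finally show ?thesis using loop_nonneg[of "- k" "map uminus ls"] False by simp
qed (rule loop_nonneg)

text \<open>Continuity at tuples with nonzero entries, in terms of sequences because it serves to
  pass from distinct points to coinciding ones along one perturbing sequence.\<close>

definition seq_cont :: "((nat \<Rightarrow> complex) \<Rightarrow> complex) \<Rightarrow> bool" where
  "seq_cont F \<longleftrightarrow> (\<forall>w z. (\<forall>i<n. z i \<noteq> 0) \<longrightarrow> (\<forall>m. \<forall>i<n. w m i \<noteq> 0) \<longrightarrow> (\<forall>i<n. (\<lambda>m. w m i) \<longlonglongrightarrow> z i)
      \<longrightarrow> (\<lambda>m::nat. F (w m)) \<longlonglongrightarrow> F z)"

lemma seq_cont_const: "seq_cont (\<lambda>_. c)"
  by (simp add: seq_cont_def)

lemma seq_cont_powi: "i < n \<Longrightarrow> seq_cont (\<lambda>z. z i powi l)"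
  unfolding seq_cont_def by (auto intro!: tendsto_power_int)

lemma seq_cont_mult: "seq_cont F \<Longrightarrow> seq_cont G \<Longrightarrow> seq_cont (\<lambda>z. F z * G z)"
  unfolding seq_cont_def by (intro allI impI tendsto_mult) auto

lemma seq_cont_add: "seq_cont F \<Longrightarrow> seq_cont G \<Longrightarrow> seq_cont (\<lambda>z. F z + G z)"
  unfolding seq_cont_def by (intro allI impI tendsto_add) auto

lemma seq_cont_diff: "seq_cont F \<Longrightarrow> seq_cont G \<Longrightarrow> seq_cont (\<lambda>z. F z - G z)"
  unfolding seq_cont_def by (intro allI impI tendsto_diff) auto

lemma seq_cont_sum: "(\<And>a. a \<in> A \<Longrightarrow> seq_cont (F a)) \<Longrightarrow> seq_cont (\<lambda>z. \<Sum>a\<in>A. F a z)"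
  unfolding seq_cont_def by (intro allI impI tendsto_sum) auto

lemma seq_cont_prod: "(\<And>a. a \<in> A \<Longrightarrow> seq_cont (F a)) \<Longrightarrow> seq_cont (\<lambda>z. \<Prod>a\<in>A. F a z)"
  unfolding seq_cont_def by (intro allI impI tendsto_prod) auto

lemma seq_cont_psum: "seq_cont (psum n l)"
  unfolding psum_def[abs_def] by (intro seq_cont_sum seq_cont_powi) auto

lemma seq_cont_split_psum: "seq_cont (split_psum n k)"
proof (cases "k \<ge> 0")
  case True
  then show ?thesis unfolding split_psum_def[abs_def]
    by (simp add: seq_cont_sum seq_cont_mult seq_cont_psum)
next
  case False
  have "seq_cont (\<lambda>z. 0 - (\<Sum>l<nat (- k). psum n (- int l) z * psum n (k + int l) z))"
    by (intro seq_cont_diff seq_cont_const seq_cont_sum seq_cont_mult seq_cont_psum)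
  then show ?thesis using False by (simp add: split_psum_def[abs_def])
qed

text \<open>\<open>divergence y y' d\<close>: \<open>d\<close> is the divergence with respect to the Weyl density of the vector
  field whose \<open>i\<close>-th coordinate in the logarithmic variables is \<open>y i\<close>, where \<open>y' i\<close> is the
  derivative of \<open>y i\<close> along that coordinate.\<close>

definition divergence :: "(nat \<Rightarrow> (nat \<Rightarrow> complex) \<Rightarrow> complex) \<Rightarrow> (nat \<Rightarrow> (nat \<Rightarrow> complex) \<Rightarrow> complex)
    \<Rightarrow> ((nat \<Rightarrow> complex) \<Rightarrow> complex) \<Rightarrow> bool" where
  "divergence y y' d \<longleftrightarrow>
     (\<forall>ls. observable (\<lambda>z. d z * psum_prod n ls z + (\<Sum>i<n. y i z * psum_prod_deriv n i ls z))) \<and>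
     (\<forall>ls. (\<integral>\<omega>. d (Z \<omega>) * psum_prod n ls (Z \<omega>) + (\<Sum>i<n. y i (Z \<omega>) * psum_prod_deriv n i ls (Z \<omega>)) \<partial>\<mu>) = 0) \<and>
     seq_cont d \<and> (\<forall>i<n. seq_cont (y i)) \<and>
     (\<forall>z. inj_on z {..<n} \<longrightarrow> (\<forall>i<n. z i \<noteq> 0) \<longrightarrow>
        d z = (\<Sum>i<n. y' i z + (\<Sum>j\<in>{..<n} - {i}. y i z * ((z i + z j) / (z i - z j)))))"

text \<open>The derivative of a factor \<open>psum n l\<close> contracts with
  \<open>z i powi k\<close> to the power sum of exponent \<open>k + l\<close>, so the sum over
  \<open>i\<close> is again a polynomial in power sums although its terms are not symmetric.\<close>

lemma observable_sum_deriv: "observable (\<lambda>z. \<Sum>i<n. z i powi k * psum_prod_deriv n i ls z)"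
proof (induction ls)
  case Nil
  then show ?case by (simp add: observable_const)
next
  case (Cons l ls)
  have "observable (\<lambda>z. of_int l * (psum n (k + l) z * psum_prod n ls z)
     + psum n l z * (\<Sum>i<n. z i powi k * psum_prod_deriv n i ls z))"
    by (intro observable_add observable_mult observable_const observable_psum observable_psum_prod Cons)
  moreover have "(\<Sum>i<n. z i powi k * psum_prod_deriv n i (l # ls) z) =
      of_int l * (psum n (k + l) z * psum_prod n ls z)
     + psum n l z * (\<Sum>i<n. z i powi k * psum_prod_deriv n i ls z)"
    if "\<And>i. i < n \<Longrightarrow> z i \<noteq> 0" for z
    unfolding psum_def[of n "k + l"] sum_distrib_left sum_distrib_right sum.distrib[symmetric]
    using that by (intro sum.cong refl) (simp add: power_int_add algebra_simps)
  ultimately show ?case by (subst observable_cong) auto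
qed

lemma observable_split_psum: "observable (split_psum n k)"
proof (cases "k \<ge> 0")
  case True
  then show ?thesis unfolding split_psum_def[abs_def]
    by (simp add: observable_sum observable_mult observable_psum)
next
  case False
  have "observable (\<lambda>z. 0 - (\<Sum>l<nat (- k). psum n (- int l) z * psum n (k + int l) z))"
    by (intro observable_diff observable_const observable_sum observable_mult observable_psum)
  then show ?thesis using False by (simp add: split_psum_def[abs_def])
qed

text \<open>The base case of the construction of fields, and the point where the loop equations
  enter.\<close>

lemma divergence_powi:
  "divergence (\<lambda>i z. z i powi k) (\<lambda>i z. of_int k * z i powi k) (split_psum n k)"
  unfolding divergence_def
proof (intro conjI allI impI)
  fix z :: "nat \<Rightarrow> complex" assume "inj_on z {..<n}" "\<forall>i<n. z i \<noteq> 0"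
  then show "split_psum n k z = (\<Sum>i<n. of_int k * z i powi k + (\<Sum>j\<in>{..<n} - {i}. z i powi k * ((z i + z j) / (z i - z j))))"
    by (subst split_psum_eq) (auto simp: sum.distrib psum_def sum_distrib_left)
qed (auto intro!: observable_add observable_mult observable_split_psum observable_psum_prod
      observable_sum_deriv loop seq_cont_split_psum seq_cont_powi)

lemma divergence_zero: "divergence (\<lambda>_ _. 0) (\<lambda>_ _. 0) (\<lambda>_. 0)"
  unfolding divergence_def by (auto simp: observable_const seq_cont_const)

text \<open>Testing the multiplied field against a product is the same as testing the old field
  against that product with one more factor; this is why \<open>divergence\<close> quantifies over
  all lists. The additional term of the new divergence is the derivative of \<open>psum n l\<close>
  along the field.\<close>

lemma divergence_mult_psum:
  assumes "divergence y y' d"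
  shows "divergence (\<lambda>i z. y i z * psum n l z) (\<lambda>i z. y' i z * psum n l z + of_int l * z i powi l * y i z)
           (\<lambda>z. d z * psum n l z + (\<Sum>i<n. of_int l * z i powi l * y i z))"
proof -
  have eq: "(d z * psum n l z + (\<Sum>i<n. of_int l * z i powi l * y i z)) * psum_prod n ls z
       + (\<Sum>i<n. y i z * psum n l z * psum_prod_deriv n i ls z)
     = d z * psum_prod n (l # ls) z + (\<Sum>i<n. y i z * psum_prod_deriv n i (l # ls) z)" for z ls
    by (simp add: sum.distrib sum_distrib_left sum_distrib_right algebra_simps)
  have sc: "seq_cont (\<lambda>z. d z * psum n l z + (\<Sum>i<n. of_int l * z i powi l * y i z))"
    using assms unfolding divergence_def
    by (intro seq_cont_add seq_cont_mult seq_cont_sum seq_cont_psum seq_cont_const seq_cont_powi) auto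
  have dist: "d z * psum n l z + (\<Sum>i<n. of_int l * z i powi l * y i z) =
      (\<Sum>i<n. y' i z * psum n l z + of_int l * z i powi l * y i z +
        (\<Sum>j\<in>{..<n} - {i}. y i z * psum n l z * ((z i + z j) / (z i - z j))))"
    if "inj_on z {..<n}" "\<forall>i<n. z i \<noteq> 0" for z
  proof -
    define q where "q = (\<lambda>i j. (z i + z j) / (z i - z j))"
    have "d z = (\<Sum>i<n. y' i z + (\<Sum>j\<in>{..<n} - {i}. y i z * q i j))"
      using assms that unfolding divergence_def q_def by blast
    then have "d z * psum n l z = (\<Sum>i<n. y' i z * psum n l z + (\<Sum>j\<in>{..<n} - {i}. y i z * psum n l z * q i j))"
      by (simp add: sum.distrib distrib_left sum_distrib_left mult_ac)
    then show ?thesis by (simp add: sum.distrib q_def)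
  qed
  note A = assms[unfolded divergence_def]
  show ?thesis
    unfolding divergence_def eq
  proof (intro conjI allI impI)
    fix ls show "observable (\<lambda>z. d z * psum_prod n (l # ls) z + (\<Sum>i<n. y i z * psum_prod_deriv n i (l # ls) z))"
      using A by blast
    show "(\<integral>\<omega>. d (Z \<omega>) * psum_prod n (l # ls) (Z \<omega>) + (\<Sum>i<n. y i (Z \<omega>) * psum_prod_deriv n i (l # ls) (Z \<omega>)) \<partial>\<mu>) = 0"
      using A by blast
  next
    fix i assume "i < n"
    then show "seq_cont (\<lambda>z. y i z * psum n l z)" using A by (intro seq_cont_mult seq_cont_psum) auto
  qed (fact sc, fact dist)
qed

lemma divergence_diff:
  assumes "divergence y y' d" "divergence x x' e"
  shows "divergence (\<lambda>i z. y i z - x i z) (\<lambda>i z. y' i z - x' i z) (\<lambda>z. d z - e z)"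
proof -
  have eq: "(d z - e z) * psum_prod n ls z + (\<Sum>i<n. (y i z - x i z) * psum_prod_deriv n i ls z)
    = (d z * psum_prod n ls z + (\<Sum>i<n. y i z * psum_prod_deriv n i ls z))
      - (e z * psum_prod n ls z + (\<Sum>i<n. x i z * psum_prod_deriv n i ls z))" for z ls
    by (simp add: sum_subtractf algebra_simps)
  have ob: "observable (\<lambda>z. d z * psum_prod n ls z + (\<Sum>i<n. y i z * psum_prod_deriv n i ls z))"
    "observable (\<lambda>z. e z * psum_prod n ls z + (\<Sum>i<n. x i z * psum_prod_deriv n i ls z))" for ls
    using assms unfolding divergence_def by auto
  show ?thesis unfolding divergence_def eq
  proof (intro conjI allI impI)
    fix ls show "(\<integral>\<omega>. (d (Z \<omega>) * psum_prod n ls (Z \<omega>) + (\<Sum>i<n. y i (Z \<omega>) * psum_prod_deriv n i ls (Z \<omega>)))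
      - (e (Z \<omega>) * psum_prod n ls (Z \<omega>) + (\<Sum>i<n. x i (Z \<omega>) * psum_prod_deriv n i ls (Z \<omega>))) \<partial>\<mu>) = 0"
      using assms ob[THEN observable_integrable] unfolding divergence_def
      by (subst Bochner_Integration.integral_diff) auto
  next
    fix z :: "nat \<Rightarrow> complex" assume z: "inj_on z {..<n}" "\<forall>i<n. z i \<noteq> 0"
    show "d z - e z = (\<Sum>i<n. y' i z - x' i z + (\<Sum>j\<in>{..<n} - {i}. (y i z - x i z) * ((z i + z j) / (z i - z j))))"
    proof -
      define q where "q = (\<lambda>i j. (z i + z j) / (z i - z j))"
      have "d z = (\<Sum>i<n. y' i z + (\<Sum>j\<in>{..<n} - {i}. y i z * q i j))"
        "e z = (\<Sum>i<n. x' i z + (\<Sum>j\<in>{..<n} - {i}. x i z * q i j))"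
        using assms z unfolding divergence_def q_def by blast+
      then have "d z - e z = (\<Sum>i<n. y' i z - x' i z + (\<Sum>j\<in>{..<n} - {i}. (y i z - x i z) * q i j))"
        by (simp add: sum_subtractf sum.distrib left_diff_distrib)
      then show ?thesis unfolding q_def .
    qed
  next
    show "seq_cont (\<lambda>z. d z - e z)" using assms unfolding divergence_def by (intro seq_cont_diff) auto
  next
    fix i assume "i < n"
    then show "seq_cont (\<lambda>z. y i z - x i z)" using assms unfolding divergence_def by (intro seq_cont_diff) auto
  next
    fix ls
    show "observable (\<lambda>z. (d z * psum_prod n ls z + (\<Sum>i<n. y i z * psum_prod_deriv n i ls z))
      - (e z * psum_prod n ls z + (\<Sum>i<n. x i z * psum_prod_deriv n i ls z)))"
      by (rule observable_diff[OF ob])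
  qed
qed

lemma divergence_add:
  assumes "divergence y y' d" "divergence x x' e"
  shows "divergence (\<lambda>i z. y i z + x i z) (\<lambda>i z. y' i z + x' i z) (\<lambda>z. d z + e z)"
  using divergence_diff[OF assms(1) divergence_diff[OF divergence_zero assms(2)]]
  by (simp only: diff_0 diff_minus_eq_add)

lemma divergence_sum:
  assumes "finite A" "\<And>a. a \<in> A \<Longrightarrow> divergence (y a) (y' a) (d a)"
  shows "divergence (\<lambda>i z. \<Sum>a\<in>A. y a i z) (\<lambda>i z. \<Sum>a\<in>A. y' a i z) (\<lambda>z. \<Sum>a\<in>A. d a z)"
  using assms
proof (induction A)
  case empty
  then show ?case using divergence_zero by simp
next
  case (insert a A)
  have "divergence (\<lambda>i z. y a i z + (\<Sum>a\<in>A. y a i z)) (\<lambda>i z. y' a i z + (\<Sum>a\<in>A. y' a i z)) (\<lambda>z. d a z + (\<Sum>a\<in>A. d a z))"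
    using insert by (intro divergence_add) auto
  then show ?case using insert.hyps by simp
qed

lemma divergence_cong:
  assumes "divergence y y' d"
    and y: "\<And>i z. i < n \<Longrightarrow> (\<And>i. i < n \<Longrightarrow> z i \<noteq> 0) \<Longrightarrow> y i z = x i z"
    and y': "\<And>i z. i < n \<Longrightarrow> (\<And>i. i < n \<Longrightarrow> z i \<noteq> 0) \<Longrightarrow> y' i z = x' i z"
  shows "divergence x x' d"
  unfolding divergence_def
proof (intro conjI allI impI)
  fix ls
  have eq: "(\<Sum>i<n. x i z * psum_prod_deriv n i ls z) = (\<Sum>i<n. y i z * psum_prod_deriv n i ls z)"
    if "\<And>i. i < n \<Longrightarrow> z i \<noteq> 0" for z
    using that y by (intro sum.cong refl) auto
  show "observable (\<lambda>z. d z * psum_prod n ls z + (\<Sum>i<n. x i z * psum_prod_deriv n i ls z))"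
    using assms(1) eq by (subst observable_cong) (auto simp: divergence_def)
  have "(\<integral>\<omega>. d (Z \<omega>) * psum_prod n ls (Z \<omega>) + (\<Sum>i<n. x i (Z \<omega>) * psum_prod_deriv n i ls (Z \<omega>)) \<partial>\<mu>)
     = (\<integral>\<omega>. d (Z \<omega>) * psum_prod n ls (Z \<omega>) + (\<Sum>i<n. y i (Z \<omega>) * psum_prod_deriv n i ls (Z \<omega>)) \<partial>\<mu>)"
    using eq Z_nonzero by (intro Bochner_Integration.integral_cong) auto
  then show "(\<integral>\<omega>. d (Z \<omega>) * psum_prod n ls (Z \<omega>) + (\<Sum>i<n. x i (Z \<omega>) * psum_prod_deriv n i ls (Z \<omega>)) \<partial>\<mu>) = 0"
    using assms(1) by (simp add: divergence_def)
next
  show "seq_cont d" using assms(1) by (simp add: divergence_def)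
next
  fix i assume i: "i < n"
  then have "seq_cont (y i)" using assms(1) by (simp add: divergence_def)
  then show "seq_cont (x i)" unfolding seq_cont_def using y[OF i] by fastforce
next
  fix z :: "nat \<Rightarrow> complex" assume z: "inj_on z {..<n}" "\<forall>i<n. z i \<noteq> 0"
  then have "d z = (\<Sum>i<n. y' i z + (\<Sum>j\<in>{..<n} - {i}. y i z * ((z i + z j) / (z i - z j))))"
    using assms(1) by (simp add: divergence_def)
  then show "d z = (\<Sum>i<n. x' i z + (\<Sum>j\<in>{..<n} - {i}. x i z * ((z i + z j) / (z i - z j))))"
    using z y y' by simp
qed

text \<open>Coordinate \<open>i\<close> collects the monomials on injective tuples whose slot 0 sits
  at point \<open>i\<close>. By injectivity no other slot involves \<open>z i\<close>, so the
  logarithmic derivative along coordinate \<open>i\<close> is multiplication by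
  \<open>k 0\<close>.\<close>

definition slot_field :: "nat \<Rightarrow> (nat \<Rightarrow> int) \<Rightarrow> nat \<Rightarrow> (nat \<Rightarrow> complex) \<Rightarrow> complex" where
  "slot_field r k i z = (\<Sum>\<phi>\<in>inj_tuples (Suc r) n. of_bool (\<phi> 0 = i) * monom_at (Suc r) k z \<phi>)"

text \<open>Induction on the number of slots: a new slot comes from multiplying by a power sum and
  subtracting collisions, and both operations preserve fields with a divergence. The derivative
  keeps its form because the collision with slot 0 raises that exponent by \<open>k (Suc r)\<close>,
  which cancels the term from differentiating the power sum.\<close>

lemma divergence_slot_field:
  "\<exists>d. divergence (slot_field r k) (\<lambda>i z. of_int (k 0) * slot_field r k i z) d"
proof (induction r arbitrary: k)
  case 0
  have "slot_field 0 k i z = z i powi k 0" if "i < n" for i z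
  proof -
    have "slot_field 0 k i z = (\<Sum>v<n. of_bool (v = i) * z v powi k 0)"
      by (simp add: slot_field_def sum_inj_tuples_Suc inj_tuples_0 monom_at_def)
    also have "\<dots> = z i powi k 0"
      using that by (subst sum.remove[of _ i]) (auto intro!: sum.neutral)
    finally show ?thesis .
  qed
  then have "divergence (slot_field 0 k) (\<lambda>i z. of_int (k 0) * slot_field 0 k i z) (split_psum n (k 0))"
    by (intro divergence_cong[OF divergence_powi[of "k 0"]]) simp_all
  then show ?case by blast
next
  case (Suc r)
  have eq: "slot_field (Suc r) k i z = slot_field r k i z * psum n (k (Suc r)) z
       - (\<Sum>a<Suc r. slot_field r (k(a := k a + k (Suc r))) i z)"
    if "\<And>i. i < n \<Longrightarrow> z i \<noteq> 0" for i z
    unfolding slot_field_def using that by (intro sum_inj_tuples_mult_psum) auto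
  \<comment> \<open>In a collision with slot 0 the merged exponent sits at the pinned point
    \<open>i\<close>, so a power of \<open>z i\<close> comes out of the sum.\<close>
  have zero: "slot_field r (k(0 := k 0 + k (Suc r))) i z = z i powi k (Suc r) * slot_field r k i z"
    if "i < n" "\<And>i. i < n \<Longrightarrow> z i \<noteq> 0" for i z
    unfolding slot_field_def sum_distrib_left
  proof (intro sum.cong refl)
    fix \<phi> assume "\<phi> \<in> inj_tuples (Suc r) n"
    then show "of_bool (\<phi> 0 = i) * monom_at (Suc r) (k(0 := k 0 + k (Suc r))) z \<phi> =
       z i powi k (Suc r) * (of_bool (\<phi> 0 = i) * monom_at (Suc r) k z \<phi>)"
      using that by (auto simp: monom_at_def prod.lessThan_Suc_shift power_int_add mult_ac
          simp del: prod.lessThan_Suc)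
  qed
  obtain d0 where d0: "divergence (slot_field r k) (\<lambda>i z. of_int (k 0) * slot_field r k i z) d0"
    using Suc.IH by blast
  define P where "P = (\<lambda>a. divergence (slot_field r (k(a := k a + k (Suc r))))
      (\<lambda>i z. of_int ((k(a := k a + k (Suc r))) 0) * slot_field r (k(a := k a + k (Suc r))) i z))"
  have "\<forall>a. \<exists>e. P a e"
    unfolding P_def by (intro allI Suc.IH)
  then obtain d where "\<forall>a. P a (d a)" by metis
  then have d: "\<And>a. divergence (slot_field r (k(a := k a + k (Suc r))))
      (\<lambda>i z. of_int ((k(a := k a + k (Suc r))) 0) * slot_field r (k(a := k a + k (Suc r))) i z) (d a)"
    unfolding P_def by (rule spec)
  define d' where "d' = (\<lambda>z. d0 z * psum n (k (Suc r)) z + (\<Sum>i<n. of_int (k (Suc r)) * z i powi k (Suc r) * slot_field r k i z)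
      - (\<Sum>a<Suc r. d a z))"
  have D: "divergence (\<lambda>i z. slot_field r k i z * psum n (k (Suc r)) z
       - (\<Sum>a<Suc r. slot_field r (k(a := k a + k (Suc r))) i z))
     (\<lambda>i z. of_int (k 0) * slot_field r k i z * psum n (k (Suc r)) z + of_int (k (Suc r)) * z i powi k (Suc r) * slot_field r k i z
       - (\<Sum>a<Suc r. of_int ((k(a := k a + k (Suc r))) 0) * slot_field r (k(a := k a + k (Suc r))) i z)) d'"
    unfolding d'_def by (rule divergence_diff[OF divergence_mult_psum[OF d0] divergence_sum[OF finite_lessThan d]])
  have "divergence (slot_field (Suc r) k) (\<lambda>i z. of_int (k 0) * slot_field (Suc r) k i z) d'"
  proof (rule divergence_cong[OF D], goal_cases)
    case (1 i z)
    show ?case using eq[OF 1(2)] by simp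
  next
    case (2 i z)
    let ?y = "\<lambda>a. slot_field r (k(a := k a + k (Suc r))) i z"
    have "(\<Sum>a<Suc r. of_int ((k(a := k a + k (Suc r))) 0) * ?y a) =
        of_int (k 0 + k (Suc r)) * ?y 0 + (\<Sum>a<r. of_int (k 0) * ?y (Suc a))"
      by (subst sum.lessThan_Suc_shift) simp
    moreover have "(\<Sum>a<Suc r. ?y a) = ?y 0 + (\<Sum>a<r. ?y (Suc a))"
      by (subst sum.lessThan_Suc_shift) simp
    ultimately show ?case
      using 2 by (simp add: eq zero sum_distrib_left algebra_simps del: sum.lessThan_Suc)
  qed
  then show ?case by blast
qed

end

hide_const (open) Finite_Cartesian_Product.transpose List.transpose

section \<open>Uniqueness of the moments\<close>

text \<open>Moves \<open>r\<close> units from slot 0 to slot \<open>b\<close>; for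
  \<open>r = k 0 - k b\<close> the two exponents have changed places.\<close>

definition shift_exponents :: "(nat \<Rightarrow> int) \<Rightarrow> nat \<Rightarrow> nat \<Rightarrow> nat \<Rightarrow> int" where
  "shift_exponents k b r = k(0 := k 0 - int r, b := k b + int r)"

text \<open>The recursion expresses the moment of an exponent vector by moments of vectors with a smaller
  sum of squares, hence determines all moments.\<close>

definition weyl_recursion :: "nat \<Rightarrow> ((nat \<Rightarrow> int) \<Rightarrow> complex) \<Rightarrow> bool" where
  "weyl_recursion n \<epsilon> \<longleftrightarrow>
     (\<forall>k k'. (\<forall>i<n. k i = k' i) \<longrightarrow> \<epsilon> k = \<epsilon> k') \<and>
     (\<forall>k a b. a < n \<longrightarrow> b < n \<longrightarrow> \<epsilon> (k \<circ> transpose a b) = \<epsilon> k) \<and>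
     (\<forall>k. \<epsilon> (\<lambda>i. - k i) = cnj (\<epsilon> k)) \<and>
     \<epsilon> (\<lambda>_. 0) = fact n \<and>
     (\<forall>k. (\<forall>b<n. k b \<le> k 0) \<longrightarrow>
        of_int (k 0) * \<epsilon> k + (\<Sum>b\<in>{1..<n}. \<Sum>r<nat (k 0 - k b).
           (\<epsilon> (shift_exponents k b r) + \<epsilon> (shift_exponents k b (Suc r))) / 2) = 0)"

text \<open>The sum of the two squares drops by \<open>2 * r * (k 0 - k b - r)\<close>, which is
  positive strictly between the endpoints.\<close>

lemma shift_square_less:
  assumes b: "b < n" "b > 0" and r: "0 < r" "int r < k 0 - k b"
  shows "(\<Sum>i<n. nat ((shift_exponents k b r i)\<^sup>2)) < (\<Sum>i<n. nat ((k i)\<^sup>2))"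
proof -
  have split: "(\<Sum>i<n. f i) = f 0 + f b + (\<Sum>i\<in>{..<n} - {0} - {b}. f i)" for f :: "nat \<Rightarrow> nat"
  proof -
    have "(\<Sum>i<n. f i) = f 0 + sum f ({..<n} - {0})" using b by (intro sum.remove) auto
    also have "sum f ({..<n} - {0}) = f b + sum f ({..<n} - {0} - {b})" using b by (intro sum.remove) auto
    finally show ?thesis by simp
  qed
  have "int r * (k 0 - k b - int r) > 0" using r by (intro mult_pos_pos) auto
  then have "(k 0 - int r)\<^sup>2 + (k b + int r)\<^sup>2 < (k 0)\<^sup>2 + (k b)\<^sup>2"
    by (simp add: power2_eq_square algebra_simps)
  then have "nat ((k 0 - int r)\<^sup>2) + nat ((k b + int r)\<^sup>2) < nat ((k 0)\<^sup>2) + nat ((k b)\<^sup>2)"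
    by (simp add: nat_add_distrib[symmetric] nat_less_iff zless_nat_eq_int_zless)
  moreover have "(\<Sum>i\<in>{..<n} - {0} - {b}. nat ((shift_exponents k b r i)\<^sup>2)) = (\<Sum>i\<in>{..<n} - {0} - {b}. nat ((k i)\<^sup>2))"
    by (intro sum.cong) (auto simp: shift_exponents_def)
  ultimately show ?thesis using b by (simp add: split) (simp add: shift_exponents_def)
qed

text \<open>The difference of two solutions satisfies the homogeneous recursion. With a positive
  largest entry moved to slot 0, the shifts strictly between the endpoints have a smaller sum of
  squares, and the endpoint shifts are \<open>k\<close> up to a transposition. What is left is a
  positive integer times the difference at \<open>k\<close>. Conjugation covers vectors without a
  positive entry, and the normalisation covers the zero vector.\<close>

lemma weyl_recursion_unique:
  assumes n: "n > 0" and e: "weyl_recursion n \<epsilon>" and e': "weyl_recursion n \<epsilon>'"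
  shows "\<epsilon> k = \<epsilon>' k"
proof -
  define \<eta> where "\<eta> = (\<lambda>k. \<epsilon> k - \<epsilon>' k)"
  have ext: "\<eta> k = \<eta> k'" if "\<And>i. i < n \<Longrightarrow> k i = k' i" for k k'
    using e e' that unfolding weyl_recursion_def \<eta>_def by metis
  have sym: "\<eta> (k \<circ> transpose a b) = \<eta> k" if "a < n" "b < n" for k a b
    using e e' that unfolding weyl_recursion_def \<eta>_def by simp
  have conj: "\<eta> (\<lambda>i. - k i) = cnj (\<eta> k)" for k
    using e e' unfolding weyl_recursion_def \<eta>_def by simp
  have zero: "\<eta> (\<lambda>_. 0) = 0"
    using e e' unfolding weyl_recursion_def \<eta>_def by simp
  have rec: "of_int (k 0) * \<eta> k + (\<Sum>b\<in>{1..<n}. \<Sum>r<nat (k 0 - k b).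
           (\<eta> (shift_exponents k b r) + \<eta> (shift_exponents k b (Suc r))) / 2) = 0"
    if "\<forall>b<n. k b \<le> k 0" for k
  proof -
    let ?T = "\<lambda>\<epsilon>. of_int (k 0) * \<epsilon> k + (\<Sum>b\<in>{1..<n}. \<Sum>r<nat (k 0 - k b).
           (\<epsilon> (shift_exponents k b r) + \<epsilon> (shift_exponents k b (Suc r))) / 2)"
    have "?T \<epsilon> = 0" "?T \<epsilon>' = 0" using e e' that unfolding weyl_recursion_def by blast+
    moreover have "?T \<eta> = ?T \<epsilon> - ?T \<epsilon>'"
    proof -
      have "(\<eta> k' + \<eta> k'') / 2 = (\<epsilon> k' + \<epsilon> k'') / 2 - (\<epsilon>' k' + \<epsilon>' k'') / 2" for k' k''
        by (simp add: \<eta>_def diff_divide_distrib add_divide_distrib)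
      then show ?thesis
        by (simp only: sum_subtractf) (simp add: \<eta>_def right_diff_distrib)
    qed
    ultimately show ?thesis by (simp only: diff_self)
  qed
  define m where "m = (\<lambda>k :: nat \<Rightarrow> int. \<Sum>i<n. nat ((k i)\<^sup>2))"
  have top: "\<eta> k = 0"
    if IH: "\<And>k'. m k' < m k \<Longrightarrow> \<eta> k' = 0" and max: "\<forall>b<n. k b \<le> k 0" and pos: "k 0 > 0" for k
  proof -
    \<comment> \<open>For \<open>k b < k 0\<close> the endpoints \<open>r = 0\<close> and
      \<open>r = D\<close> each occur once with weight one half, which makes one copy of
      \<open>\<eta> k\<close>; for equal entries the sum is empty.\<close>
    have inner: "(\<Sum>r<nat (k 0 - k b). (\<eta> (shift_exponents k b r) + \<eta> (shift_exponents k b (Suc r))) / 2)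
        = of_bool (k b < k 0) * \<eta> k" if b: "b \<in> {1..<n}" for b
    proof -
      define D where "D = nat (k 0 - k b)"
      have D: "int D = k 0 - k b" using max b by (simp add: D_def)
      have mid: "\<eta> (shift_exponents k b r) = 0" if "0 < r" "r < D" for r
        unfolding m_def using b that D by (intro IH) (auto simp: m_def intro!: shift_square_less)
      have first: "\<eta> (shift_exponents k b 0) = \<eta> k"
        by (intro ext) (auto simp: shift_exponents_def)
      have last: "\<eta> (shift_exponents k b D) = \<eta> k"
      proof -
        have "shift_exponents k b D = k \<circ> transpose 0 b"
          using D b by (auto simp: shift_exponents_def fun_eq_iff transpose_def)
        then show ?thesis using sym[of 0 b k] n b by simp
      qed
      show ?thesis
      proof (cases D)
        case 0
        then show ?thesis using D by (simp add: D_def[symmetric])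
      next
        case (Suc D')
        have "(\<Sum>r<D. \<eta> (shift_exponents k b r)) = \<eta> k"
          unfolding Suc sum.lessThan_Suc_shift using mid Suc by (simp add: first)
        moreover have "(\<Sum>r<D. \<eta> (shift_exponents k b (Suc r))) = \<eta> k"
          using mid last unfolding Suc by simp
        ultimately show ?thesis using D Suc
          by (simp add: D_def[symmetric] sum.distrib sum_divide_distrib[symmetric])
      qed
    qed
    have "0 = of_int (k 0) * \<eta> k + (\<Sum>b\<in>{1..<n}. of_bool (k b < k 0) * \<eta> k)"
      using rec[OF max] inner by simp
    also have "\<dots> = (of_int (k 0) + of_nat (\<Sum>b\<in>{1..<n}. of_bool (k b < k 0))) * \<eta> k"
      by (simp add: distrib_right sum_distrib_right)
    also have "(of_int (k 0) :: complex) + of_nat (\<Sum>b\<in>{1..<n}. of_bool (k b < k 0)) =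
        of_int (k 0 + int (\<Sum>b\<in>{1..<n}. of_bool (k b < k 0)))" by simp
    finally have "of_int (k 0 + int (\<Sum>b\<in>{1..<n}. of_bool (k b < k 0))) = (0 :: complex) \<or> \<eta> k = 0"
      by (metis mult_eq_0_iff)
    moreover have "k 0 + int (\<Sum>b\<in>{1..<n}. of_bool (k b < k 0)) > 0" using pos by linarith
    ultimately show ?thesis by (metis of_int_eq_0_iff less_irrefl)
  qed
  have some_pos: "\<eta> k = 0"
    if IH: "\<And>k'. m k' < m k \<Longrightarrow> \<eta> k' = 0" and pos: "\<exists>i<n. k i > 0" for k
  proof -
    obtain i where i: "i < n" "\<forall>b<n. k b \<le> k i"
    proof -
      have "Max (k ` {..<n}) \<in> k ` {..<n}" using n by (intro Max_in) auto
      then obtain i where "i < n" "k i = Max (k ` {..<n})" by auto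
      then show ?thesis using that[of i] by auto
    qed
    define k' where "k' = k \<circ> transpose 0 i"
    have perm: "transpose 0 i permutes {..<n}" using i n by (intro permutes_swap_id) auto
    have mk: "m k' = m k"
      unfolding m_def k'_def using sum.permute[OF perm, of "\<lambda>i. nat ((k i)\<^sup>2)"] by (simp add: o_def)
    have "\<eta> k' = 0"
    proof (rule top)
      show "\<eta> l = 0" if "m l < m k'" for l using IH[of l] that unfolding mk by blast
      show "\<forall>b<n. k' b \<le> k' 0"
        using i permutes_in_image[OF perm] by (auto simp: k'_def)
      obtain j where "j < n" "k j > 0" using pos by blast
      then have "k i > 0" using i(2) by force
      then show "k' 0 > 0" by (simp add: k'_def)
    qed
    then show ?thesis using sym[of 0 i k] i n by (simp add: k'_def)
  qed
  have "\<eta> k = 0"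
  proof (induction "m k" arbitrary: k rule: less_induct)
    case less
    consider "\<exists>i<n. k i > 0" | "\<exists>i<n. k i < 0" "\<forall>i<n. k i \<le> 0" | "\<forall>i<n. k i = 0"
      by (metis linorder_neqE not_less)
    then show ?case
    proof cases
      case 1
      then show ?thesis using some_pos[of k] less by blast
    next
      case 2
      have mk: "m (\<lambda>i. - k i) = m k" by (simp add: m_def)
      have "\<eta> (\<lambda>i. - k i) = 0"
      proof (rule some_pos)
        show "\<eta> l = 0" if "m l < m (\<lambda>i. - k i)" for l using less[of l] that unfolding mk by blast
        show "\<exists>i<n. - k i > 0" using 2(1) by simp
      qed
      then show ?thesis using conj[of k] by simp
    next
      case 3
      then show ?thesis using ext[of k "\<lambda>_. 0"] zero by simp
    qed
  qed
  then show ?thesis by (simp add: \<eta>_def)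
qed

text \<open>With \<open>K = L + D\<close> the difference is
  \<open>a powi L * b powi L * (a ^ D - b ^ D)\<close>. Division by \<open>a - b\<close> gives a
  geometric sum, and the factor \<open>a + b\<close> turns each of its terms into a pair of
  neighbouring shifts.\<close>

lemma sum_power_shift_pairs:
  fixes a b :: complex
  assumes "a \<noteq> b" "a \<noteq> 0" "b \<noteq> 0" "L \<le> K"
  shows "(a powi K * b powi L - a powi L * b powi K) * ((a + b) / (a - b)) =
     (\<Sum>r<nat (K - L). a powi (K - int r) * b powi (L + int r) + a powi (K - int (Suc r)) * b powi (L + int (Suc r)))"
proof -
  define D where "D = nat (K - L)"
  have K: "K = L + int D" using assms by (simp add: D_def)
  have nz: "a - b \<noteq> 0" using assms by simp
  have "(\<Sum>r<D. a powi (K - int r) * b powi (L + int r) + a powi (K - int (Suc r)) * b powi (L + int (Suc r)))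
     = (\<Sum>r<D. (a powi L * b powi L) * ((a + b) * (b ^ r * a ^ (D - Suc r))))"
  proof (intro sum.cong refl)
    fix r assume "r \<in> {..<D}"
    then have r: "K - int r = L + int (D - Suc r) + 1" "K - int (Suc r) = L + int (D - Suc r)"
      unfolding K by auto
    show "a powi (K - int r) * b powi (L + int r) + a powi (K - int (Suc r)) * b powi (L + int (Suc r)) =
       (a powi L * b powi L) * ((a + b) * (b ^ r * a ^ (D - Suc r)))"
      unfolding r using assms by (simp add: power_int_add algebra_simps)
  qed
  also have "\<dots> = (a powi L * b powi L) * ((a + b) * (\<Sum>r<D. b ^ r * a ^ (D - Suc r)))"
    by (simp only: sum_distrib_left)
  also have "(\<Sum>r<D. b ^ r * a ^ (D - Suc r)) = (a ^ D - b ^ D) / (a - b)"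
    using power_diff_sumr2[of b D a] nz
    by (simp add: field_simps mult.commute)
  also have "(a powi L * b powi L) * ((a + b) * ((a ^ D - b ^ D) / (a - b))) =
     (a powi K * b powi L - a powi L * b powi K) * ((a + b) / (a - b))"
    unfolding K using assms nz by (simp add: power_int_add field_simps)
  finally show ?thesis by (simp add: D_def)
qed

text \<open>The slots other than 0 and \<open>b\<close> contribute a common factor, which reduces
  the claim to two variables.\<close>

lemma monom_at_swap_diff:
  assumes b: "0 < b" "b < n" and nz: "z (\<phi> 0) \<noteq> z (\<phi> b)" "z (\<phi> 0) \<noteq> 0" "z (\<phi> b) \<noteq> 0" and k: "k b \<le> k 0"
  shows "(monom_at n k z \<phi> - monom_at n (k \<circ> transpose 0 b) z \<phi>) * ((z (\<phi> 0) + z (\<phi> b)) / (z (\<phi> 0) - z (\<phi> b)))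
     = (\<Sum>r<nat (k 0 - k b). monom_at n (shift_exponents k b r) z \<phi> + monom_at n (shift_exponents k b (Suc r)) z \<phi>)"
proof -
  define c where "c = (\<Prod>i\<in>{..<n} - {0} - {b}. z (\<phi> i) powi k i)"
  have split: "monom_at n l z \<phi> = c * (z (\<phi> 0) powi l 0 * z (\<phi> b) powi l b)"
    if "\<And>i. i \<noteq> 0 \<Longrightarrow> i \<noteq> b \<Longrightarrow> l i = k i" for l
  proof -
    have "monom_at n l z \<phi> = z (\<phi> 0) powi l 0 * (\<Prod>i\<in>{..<n} - {0}. z (\<phi> i) powi l i)"
      unfolding monom_at_def using b by (intro prod.remove) auto
    also have "(\<Prod>i\<in>{..<n} - {0}. z (\<phi> i) powi l i) = z (\<phi> b) powi l b * (\<Prod>i\<in>{..<n} - {0} - {b}. z (\<phi> i) powi l i)"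
      using b by (intro prod.remove) auto
    also have "(\<Prod>i\<in>{..<n} - {0} - {b}. z (\<phi> i) powi l i) = c"
      unfolding c_def using that by (intro prod.cong) auto
    finally show ?thesis by simp
  qed
  have "monom_at n k z \<phi> - monom_at n (k \<circ> transpose 0 b) z \<phi> =
     c * (z (\<phi> 0) powi k 0 * z (\<phi> b) powi k b - z (\<phi> 0) powi k b * z (\<phi> b) powi k 0)"
    by (subst (1 2) split) (auto simp: right_diff_distrib)
  moreover have "monom_at n (shift_exponents k b r) z \<phi> = c * (z (\<phi> 0) powi (k 0 - int r) * z (\<phi> b) powi (k b + int r))" for r
    using b by (subst split) (auto simp: shift_exponents_def)
  ultimately show ?thesis
    by (simp only: mult.assoc sum_power_shift_pairs[OF nz k] sum_distrib_left distrib_left)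
qed

section \<open>The moments of the Weyl density\<close>

text \<open>The torus integral of the monomial with exponents \<open>k\<close> against the squared
  modulus of the Vandermonde determinant, with both determinants expanded. The factor
  \<open>1 / n!\<close> of the Weyl density is left out because the eigenvalue moments compared with
  it sum over all \<open>n!\<close> orderings.\<close>

definition weyl_moment :: "nat \<Rightarrow> (nat \<Rightarrow> int) \<Rightarrow> complex" where
  "weyl_moment n k = (\<Sum>\<sigma> | \<sigma> permutes {..<n}. \<Sum>\<tau> | \<tau> permutes {..<n}.
     of_int (sign \<sigma> * sign \<tau>) * of_bool (\<forall>i<n. k i = int (\<tau> i) - int (\<sigma> i)))"

definition vandermonde :: "nat \<Rightarrow> (nat \<Rightarrow> complex) \<Rightarrow> complex" where
  "vandermonde n z = (\<Sum>\<sigma> | \<sigma> permutes {..<n}. of_int (sign \<sigma>) * (\<Prod>i<n. z i ^ \<sigma> i))"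

lemma vandermonde_eq_det:
  "vandermonde n z = Determinant.det (Matrix.mat n n (\<lambda>(i, j). z i ^ j))"
proof -
  have "(\<Prod>i = 0..<n. Matrix.mat n n (\<lambda>(i, j). z i ^ j) $$ (i, p i)) = (\<Prod>i = 0..<n. z i ^ p i)"
    if "p permutes {0..<n}" for p
    using permutes_in_image[OF that] by (intro prod.cong) auto
  then show ?thesis
    by (simp add: det_def'[of _ n] vandermonde_def lessThan_atLeast0)
qed

lemma vandermonde_eq_0:
  assumes "i < n" "j < n" "i \<noteq> j" "z i = z j"
  shows "vandermonde n z = 0"
  unfolding vandermonde_eq_det using assms
  by (intro det_identical_rows[of _ n i j]) (auto simp: row_def)

lemma vandermonde_swap:
  assumes "a < n" "b < n" "a \<noteq> b"
  shows "vandermonde n (z \<circ> transpose a b) = - vandermonde n z"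
proof -
  have perm: "transpose a b permutes {..<n}" using assms by (intro permutes_swap_id) auto
  have "vandermonde n (z \<circ> transpose a b) = (\<Sum>\<sigma> | \<sigma> permutes {..<n}. of_int (sign \<sigma>) * (\<Prod>i<n. z i ^ (\<sigma> \<circ> transpose a b) i))"
    unfolding vandermonde_def
  proof (intro sum.cong refl)
    fix \<sigma>
    show "of_int (sign \<sigma>) * (\<Prod>i<n. (z \<circ> transpose a b) i ^ \<sigma> i) = of_int (sign \<sigma>) * (\<Prod>i<n. z i ^ (\<sigma> \<circ> transpose a b) i)"
      using prod.permute[OF perm, of "\<lambda>i. (z \<circ> transpose a b) i ^ \<sigma> i"] by (simp add: o_def)
  qed
  also have "\<dots> = (\<Sum>\<sigma> | \<sigma> permutes {..<n}. of_int (sign (\<sigma> \<circ> transpose a b)) * (\<Prod>i<n. z i ^ (\<sigma> \<circ> transpose a b \<circ> transpose a b) i))"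
    by (rule sum_permutations_compose_right[OF perm])
  also have "\<dots> = (\<Sum>\<sigma> | \<sigma> permutes {..<n}. - (of_int (sign \<sigma>) * (\<Prod>i<n. z i ^ \<sigma> i)))"
  proof (intro sum.cong refl)
    fix \<sigma> assume "\<sigma> \<in> {\<sigma>. \<sigma> permutes {..<n}}"
    then have "permutation \<sigma>" unfolding permutation_permutes by blast
    then have "sign (\<sigma> \<circ> transpose a b) = - sign \<sigma>"
      using assms by (subst sign_compose) (auto simp: sign_swap_id permutation_swap_id)
    then show "of_int (sign (\<sigma> \<circ> transpose a b)) * (\<Prod>i<n. z i ^ (\<sigma> \<circ> transpose a b \<circ> transpose a b) i) =
        - (of_int (sign \<sigma>) * (\<Prod>i<n. z i ^ \<sigma> i))"
      by simp
  qed
  finally show ?thesis by (simp add: vandermonde_def sum_negf)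
qed

text \<open>The operator \<open>z 0 d/dz 0\<close> applied to \<open>vandermonde\<close>.\<close>

definition vandermonde_deriv :: "nat \<Rightarrow> (nat \<Rightarrow> complex) \<Rightarrow> complex" where
  "vandermonde_deriv n z = (\<Sum>\<sigma> | \<sigma> permutes {..<n}. of_int (sign \<sigma>) * of_nat (\<sigma> 0) * (\<Prod>i<n. z i ^ \<sigma> i))"

text \<open>As a polynomial in \<open>z 0\<close> of degree less than \<open>n\<close>, the Vandermonde determinant vanishes at the
  other \<open>z j\<close>, which determines its logarithmic derivative.\<close>

lemma vandermonde_deriv_eq:
  assumes n: "n > 0" and inj: "inj_on z {..<n}"
  shows "vandermonde_deriv n z = vandermonde n z * (\<Sum>j\<in>{1..<n}. z 0 / (z 0 - z j))"
proof -
  define c where "c = (\<lambda>\<sigma>. of_int (sign \<sigma>) * (\<Prod>i\<in>{1..<n}. z i ^ \<sigma> i))"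
  define P where "P = (\<Sum>\<sigma> | \<sigma> permutes {..<n}. Polynomial.monom (c \<sigma>) (\<sigma> 0))"
  have set: "{..<n} = insert 0 {1..<n}" using n by auto
  have fin: "finite {\<sigma>. \<sigma> permutes {..<n}}" by (rule finite_permutations) simp
  have poly: "poly P x = vandermonde n (z(0 := x))" for x
    unfolding P_def vandermonde_def
    by (simp add: poly_sum poly_monom c_def set mult_ac)
  have deriv: "z 0 * poly (pderiv P) (z 0) = vandermonde_deriv n z"
  proof -
    have "z 0 * poly (pderiv P) (z 0) = (\<Sum>\<sigma> | \<sigma> permutes {..<n}. c \<sigma> * (of_nat (\<sigma> 0) * (z 0 * z 0 ^ (\<sigma> 0 - 1))))"
      unfolding P_def
      by (simp add: higher_pderiv_sum[of 1, simplified] pderiv_sum poly_sum pderiv_monom poly_monom sum_distrib_left mult_ac)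
    also have "\<dots> = vandermonde_deriv n z"
      unfolding vandermonde_deriv_def
    proof (intro sum.cong refl)
      fix \<sigma> :: "nat \<Rightarrow> nat"
      have *: "of_nat (\<sigma> 0) * (z 0 * z 0 ^ (\<sigma> 0 - 1)) = of_nat (\<sigma> 0) * z 0 ^ \<sigma> 0"
        by (cases "\<sigma> 0") auto
      show "c \<sigma> * (of_nat (\<sigma> 0) * (z 0 * z 0 ^ (\<sigma> 0 - 1))) = of_int (sign \<sigma>) * of_nat (\<sigma> 0) * (\<Prod>i<n. z i ^ \<sigma> i)"
        unfolding * by (simp add: c_def set mult_ac)
    qed
    finally show ?thesis .
  qed
  define R where "R = (\<Prod>j\<in>{1..<n}. [:- z j, 1:])"
  have degR: "degree R = n - 1"
    unfolding R_def by (subst degree_prod_eq_sum_degree) auto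
  have monR: "lead_coeff R = 1"
    unfolding R_def lead_coeff_prod by simp
  \<comment> \<open>The coefficient for which the difference of \<open>P\<close> and
    \<open>a\<close> times \<open>R\<close> drops below degree \<open>n - 1\<close> while keeping
    the \<open>n - 1\<close> roots \<open>z j\<close>.\<close>
  define a where "a = coeff P (n - 1)"
  have degP: "degree P \<le> n - 1"
    unfolding P_def
  proof (intro degree_sum_le fin)
    fix \<sigma> assume "\<sigma> \<in> {\<sigma>. \<sigma> permutes {..<n}}"
    then have "\<sigma> 0 < n" using permutes_in_image[of \<sigma> "{..<n}" 0] n by auto
    then show "degree (Polynomial.monom (c \<sigma>) (\<sigma> 0)) \<le> n - 1"
      using degree_monom_le[of "c \<sigma>" "\<sigma> 0"] by linarith
  qed
  have PR: "P = Polynomial.smult a R"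
  proof (rule ccontr)
    define Q where "Q = P - Polynomial.smult a R"
    assume "P \<noteq> Polynomial.smult a R"
    then have Q: "Q \<noteq> 0" by (simp add: Q_def)
    have "degree Q \<le> n - 1"
      unfolding Q_def using degP degR by (intro degree_diff_le) (auto intro: order_trans[OF degree_smult_le])
    moreover have "coeff Q (n - 1) = 0"
      using monR degR by (simp add: Q_def a_def)
    ultimately have "degree Q < n - 1 \<or> n - 1 = degree Q \<and> coeff Q (degree Q) = 0" by fastforce
    then have deg: "degree Q < n - 1" using Q by auto
    have "poly Q (z j) = 0" if j: "j \<in> {1..<n}" for j
    proof -
      have "poly P (z j) = 0"
        unfolding poly using j by (intro vandermonde_eq_0[of 0 n j]) auto
      moreover have "poly R (z j) = 0" unfolding R_def poly_prod using j by (intro prod_zero) auto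
      ultimately show ?thesis by (simp add: Q_def)
    qed
    then have "z ` {1..<n} \<subseteq> {x. poly Q x = 0}" by auto
    then have "card (z ` {1..<n}) \<le> degree Q"
      using card_mono[OF poly_roots_finite[OF Q]] card_poly_roots_bound[OF Q] by (meson order_trans)
    moreover have "card (z ` {1..<n}) = n - 1"
      by (subst card_image) (auto intro: inj_on_subset[OF inj])
    ultimately show False using deg by simp
  qed
  have R0: "poly R (z 0) = (\<Prod>j\<in>{1..<n}. z 0 - z j)" by (simp add: R_def poly_prod)
  have "poly (pderiv R) (z 0) = (\<Sum>j\<in>{1..<n}. \<Prod>i\<in>{1..<n} - {j}. z 0 - z i)"
    unfolding R_def pderiv_prod by (simp add: poly_sum poly_prod pderiv_pCons)
  also have "\<dots> = (\<Sum>j\<in>{1..<n}. poly R (z 0) / (z 0 - z j))"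
  proof (intro sum.cong refl)
    fix j assume j: "j \<in> {1..<n}"
    then have "z 0 \<noteq> z j" using inj n by (auto simp: inj_on_def)
    moreover have "poly R (z 0) = (z 0 - z j) * (\<Prod>i\<in>{1..<n} - {j}. z 0 - z i)"
      unfolding R0 using j by (intro prod.remove) auto
    ultimately show "(\<Prod>i\<in>{1..<n} - {j}. z 0 - z i) = poly R (z 0) / (z 0 - z j)" by simp
  qed
  finally have "z 0 * poly (pderiv P) (z 0) = poly P (z 0) * (\<Sum>j\<in>{1..<n}. z 0 / (z 0 - z j))"
    unfolding PR by (simp add: pderiv_smult sum_distrib_left mult_ac)
  then show ?thesis by (simp add: deriv poly)
qed

text \<open>An exponent of modulus below \<open>N\<close> is divisible by \<open>N\<close> only if
  it is 0; otherwise the sum is geometric with a nontrivial \<open>N\<close>-th root of unity as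
  ratio.\<close>

lemma sum_roots_of_unity_powi:
  assumes N: "N > 0" and a: "\<bar>a\<bar> < int N"
  shows "(\<Sum>j<N. (cis (2 * pi / real N) ^ j) powi a) = of_nat N * of_bool (a = 0)"
proof (cases "a = 0")
  case False
  define \<zeta> where "\<zeta> = cis (2 * pi / real N)"
  have pow: "\<zeta> ^ m = exp (2 * of_real pi * \<i> * of_nat m / of_nat N)" for m
    unfolding \<zeta>_def by (simp add: cis_conv_exp flip: exp_of_nat_mult) (simp add: mult_ac)
  have x1: "\<zeta> powi a \<noteq> 1"
  proof
    assume *: "\<zeta> powi a = 1"
    have "\<zeta> ^ nat \<bar>a\<bar> = 1"
      using * by (cases "a \<ge> 0") (auto simp: power_int_def power_inverse inverse_eq_1_iff)
    then have "N dvd nat \<bar>a\<bar>"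
      using complex_root_unity_eq_1[of N "nat \<bar>a\<bar>"] N unfolding pow by simp
    then show False using a False dvd_imp_le_int[of a "int N"] by auto
  qed
  have "\<zeta> ^ N = 1" unfolding pow using N by simp
  then have "(\<zeta> powi a) ^ N = 1"
    by (metis power_int_mult power_int_of_nat mult.commute power_int_1_left)
  moreover have "(\<zeta> ^ j) powi a = (\<zeta> powi a) ^ j" for j
    by (metis power_int_mult power_int_of_nat mult.commute)
  ultimately show ?thesis
    using False x1 geometric_sum[of "\<zeta> powi a" N] unfolding \<zeta>_def[symmetric] by simp
qed simp

text \<open>Indexes the \<open>n\<close>-tuples of \<open>N\<close>-th roots of unity. Averaging
  over them integrates a Laurent polynomial over the torus exactly once all its exponents are below
  \<open>N\<close> in modulus.\<close>

definition roots_grid :: "nat \<Rightarrow> nat \<Rightarrow> (nat \<Rightarrow> nat) set" where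
  "roots_grid n N = {..<n} \<rightarrow>\<^sub>E {..<N}"

definition grid_point :: "nat \<Rightarrow> (nat \<Rightarrow> nat) \<Rightarrow> nat \<Rightarrow> complex" where
  "grid_point N J i = cis (2 * pi / real N) ^ J i"

lemma norm_grid_point [simp]: "norm (grid_point N J i) = 1"
  by (simp add: grid_point_def norm_power)

lemma grid_point_nonzero [simp]: "grid_point N J i \<noteq> 0"
  by (simp add: grid_point_def)

lemma sum_roots_grid_powi:
  assumes "N > 0" "\<And>i. i < n \<Longrightarrow> \<bar>a i\<bar> < int N"
  shows "(\<Sum>J\<in>roots_grid n N. \<Prod>i<n. grid_point N J i powi a i) = of_nat N ^ n * of_bool (\<forall>i<n. a i = 0)"
proof -
  have "(\<Sum>J\<in>roots_grid n N. \<Prod>i<n. grid_point N J i powi a i) = (\<Prod>i<n. \<Sum>j<N. (cis (2 * pi / real N) ^ j) powi a i)"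
    unfolding roots_grid_def grid_point_def by (rule prod_sum_PiE[symmetric]) auto
  also have "\<dots> = (\<Prod>i<n. of_nat N * of_bool (a i = 0))"
    using assms by (intro prod.cong refl sum_roots_of_unity_powi) auto
  also have "\<dots> = of_nat N ^ n * (\<Prod>i<n. of_bool (a i = 0))"
    by (simp add: prod.distrib)
  also have "(\<Prod>i<n. of_bool (a i = 0)) = (of_bool (\<forall>i<n. a i = 0) :: complex)"
    by (induction n) (auto simp: less_Suc_eq)
  finally show ?thesis .
qed

lemma permutes_diff_bound:
  assumes "\<sigma> permutes {..<n}" "\<tau> permutes {..<n}" "i < n"
  shows "\<bar>int (\<sigma> i) - int (\<tau> i)\<bar> < int n"
  using permutes_in_image[OF assms(1), of i] permutes_in_image[OF assms(2), of i] assms(3) by auto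

text \<open>The total exponent of point \<open>i\<close> is
  \<open>k i + \<sigma> i - \<tau> i\<close>; the bound on \<open>N\<close> keeps it below
  \<open>N\<close> in modulus, so the grid detects exactly whether it vanishes. The weights
  \<open>w\<close> serve both the density and its angular derivative.\<close>

lemma sum_roots_grid_pairs:
  assumes N: "\<And>i. i < n \<Longrightarrow> \<bar>k i\<bar> + int n \<le> int N" "N > 0"
  shows "(\<Sum>J\<in>roots_grid n N. monom_at n k (grid_point N J) id *
       (\<Sum>\<sigma> | \<sigma> permutes {..<n}. \<Sum>\<tau> | \<tau> permutes {..<n}. w \<sigma> \<tau> * (\<Prod>i<n. grid_point N J i powi (int (\<sigma> i) - int (\<tau> i)))))
     = of_nat N ^ n * (\<Sum>\<sigma> | \<sigma> permutes {..<n}. \<Sum>\<tau> | \<tau> permutes {..<n}.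
         w \<sigma> \<tau> * of_bool (\<forall>i<n. k i = int (\<tau> i) - int (\<sigma> i)))"
proof -
  have "(\<Sum>J\<in>roots_grid n N. monom_at n k (grid_point N J) id *
       (\<Sum>\<sigma> | \<sigma> permutes {..<n}. \<Sum>\<tau> | \<tau> permutes {..<n}. w \<sigma> \<tau> * (\<Prod>i<n. grid_point N J i powi (int (\<sigma> i) - int (\<tau> i)))))
    = (\<Sum>J\<in>roots_grid n N. \<Sum>\<sigma> | \<sigma> permutes {..<n}. \<Sum>\<tau> | \<tau> permutes {..<n}.
         w \<sigma> \<tau> * (\<Prod>i<n. grid_point N J i powi (k i + int (\<sigma> i) - int (\<tau> i))))"
    unfolding sum_distrib_left
    by (intro sum.cong refl)
       (simp add: monom_at_def power_int_add[symmetric] prod.distrib[symmetric] mult.left_commute add_diff_eq)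
  also have "\<dots> = (\<Sum>\<sigma> | \<sigma> permutes {..<n}. \<Sum>J\<in>roots_grid n N. \<Sum>\<tau> | \<tau> permutes {..<n}.
         w \<sigma> \<tau> * (\<Prod>i<n. grid_point N J i powi (k i + int (\<sigma> i) - int (\<tau> i))))"
    by (rule sum.swap)
  also have "\<dots> = (\<Sum>\<sigma> | \<sigma> permutes {..<n}. \<Sum>\<tau> | \<tau> permutes {..<n}. \<Sum>J\<in>roots_grid n N.
         w \<sigma> \<tau> * (\<Prod>i<n. grid_point N J i powi (k i + int (\<sigma> i) - int (\<tau> i))))"
    by (intro sum.cong refl sum.swap)
  also have "\<dots> = (\<Sum>\<sigma> | \<sigma> permutes {..<n}. \<Sum>\<tau> | \<tau> permutes {..<n}.
         of_nat N ^ n * (w \<sigma> \<tau> * of_bool (\<forall>i<n. k i = int (\<tau> i) - int (\<sigma> i))))"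
  proof (intro sum.cong refl)
    fix \<sigma> \<tau> assume *: "\<sigma> \<in> {\<sigma>. \<sigma> permutes {..<n}}" "\<tau> \<in> {\<sigma>. \<sigma> permutes {..<n}}"
    have "\<bar>k i + int (\<sigma> i) - int (\<tau> i)\<bar> < int N" if "i < n" for i
      using permutes_diff_bound[of \<sigma> n \<tau> i] * N(1)[OF that] that by auto
    then have "(\<Sum>J\<in>roots_grid n N. \<Prod>i<n. grid_point N J i powi (k i + int (\<sigma> i) - int (\<tau> i)))
       = of_nat N ^ n * of_bool (\<forall>i<n. k i + int (\<sigma> i) - int (\<tau> i) = 0)"
      using N(2) by (intro sum_roots_grid_powi) auto
    moreover have "(\<forall>i<n. k i + int (\<sigma> i) - int (\<tau> i) = 0) \<longleftrightarrow> (\<forall>i<n. k i = int (\<tau> i) - int (\<sigma> i))"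
      by (intro all_cong) auto
    ultimately show "(\<Sum>J\<in>roots_grid n N. w \<sigma> \<tau> * (\<Prod>i<n. grid_point N J i powi (k i + int (\<sigma> i) - int (\<tau> i))))
      = of_nat N ^ n * (w \<sigma> \<tau> * of_bool (\<forall>i<n. k i = int (\<tau> i) - int (\<sigma> i)))"
      by (simp add: sum_distrib_left[symmetric])
  qed
  finally show ?thesis by (simp add: sum_distrib_left)
qed

section \<open>The squared modulus of the Vandermonde determinant on the unit circle\<close>

lemma cnj_powi_unit:
  assumes "norm z = 1" shows "cnj z powi l = z powi (- l)"
proof -
  have "cnj z = inverse z"
    using assms complex_norm_square[of z] by (intro inverse_unique[symmetric]) simp
  then show ?thesis by (simp add: power_int_minus power_int_inverse)
qed

lemma unit_prod_pairs:
  assumes "\<And>i. i < n \<Longrightarrow> norm (z i) = 1"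
  shows "(\<Prod>i<n. z i ^ \<sigma> i) * cnj (\<Prod>i<n. z i ^ \<tau> i) = (\<Prod>i<n. z i powi (int (\<sigma> i) - int (\<tau> i)))"
  unfolding cnj_prod prod.distrib[symmetric]
proof (intro prod.cong refl)
  fix i assume "i \<in> {..<n}"
  then have "norm (z i) = 1" using assms by auto
  moreover from this have "z i \<noteq> 0" by auto
  ultimately show "z i ^ \<sigma> i * cnj (z i ^ \<tau> i) = z i powi (int (\<sigma> i) - int (\<tau> i))"
    using cnj_powi_unit[of "z i" "int (\<tau> i)"] by (simp add: power_int_diff power_int_minus divide_inverse)
qed

lemma vandermonde_norm_expand:
  assumes "\<And>i. i < n \<Longrightarrow> norm (z i) = 1"
  shows "vandermonde n z * cnj (vandermonde n z) =
    (\<Sum>\<sigma> | \<sigma> permutes {..<n}. \<Sum>\<tau> | \<tau> permutes {..<n}. of_int (sign \<sigma> * sign \<tau>) * (\<Prod>i<n. z i powi (int (\<sigma> i) - int (\<tau> i))))"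
  unfolding vandermonde_def cnj_sum sum_product
  by (intro sum.cong refl) (simp add: unit_prod_pairs[OF assms, symmetric])

lemma vandermonde_deriv_expand:
  assumes "\<And>i. i < n \<Longrightarrow> norm (z i) = 1"
  shows "vandermonde_deriv n z * cnj (vandermonde n z) - vandermonde n z * cnj (vandermonde_deriv n z) =
    (\<Sum>\<sigma> | \<sigma> permutes {..<n}. \<Sum>\<tau> | \<tau> permutes {..<n}.
      of_int (sign \<sigma> * sign \<tau>) * (of_nat (\<sigma> 0) - of_nat (\<tau> 0)) * (\<Prod>i<n. z i powi (int (\<sigma> i) - int (\<tau> i))))"
  unfolding vandermonde_def vandermonde_deriv_def cnj_sum sum_product sum_subtractf[symmetric]
  by (intro sum.cong refl) (simp add: unit_prod_pairs[OF assms, symmetric] algebra_simps)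

text \<open>Up to the factor \<open>\<i>\<close> the left side is the derivative of the density in
  the angle of \<open>z 0\<close>. Conjugation inverts points of the circle, which makes
  \<open>z 0 / (z 0 - z j)\<close> minus its conjugate equal to the quotient on the right. At
  coinciding points both sides are 0.\<close>

lemma vandermonde_norm_deriv:
  assumes n: "n > 0" and unit: "\<And>i. i < n \<Longrightarrow> norm (z i) = 1"
  shows "vandermonde_deriv n z * cnj (vandermonde n z) - vandermonde n z * cnj (vandermonde_deriv n z) =
     vandermonde n z * cnj (vandermonde n z) * (\<Sum>j\<in>{1..<n}. (z 0 + z j) / (z 0 - z j))"
proof (cases "inj_on z {..<n}")
  case False
  then have "vandermonde n z = 0"
    unfolding inj_on_def using vandermonde_eq_0 by blast
  then show ?thesis by simp
next
  case True
  note eq = vandermonde_deriv_eq[OF n True]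
  have "z 0 / (z 0 - z j) - cnj (z 0 / (z 0 - z j)) = (z 0 + z j) / (z 0 - z j)" if "j \<in> {1..<n}" for j
  proof -
    have nz: "z 0 \<noteq> z j" "z 0 \<noteq> 0" "z j \<noteq> 0"
      using True that n unit[of 0] unit[of j] by (auto simp: inj_on_def)
    have "cnj (z 0) = inverse (z 0)" "cnj (z j) = inverse (z j)"
      using cnj_powi_unit[of "z 0" 1] cnj_powi_unit[of "z j" 1] unit that n by (auto simp: power_int_minus)
    then have "cnj (z 0 / (z 0 - z j)) = inverse (z 0) / (inverse (z 0) - inverse (z j))" by simp
    also have "\<dots> = - (z j / (z 0 - z j))"
      using nz by (simp add: divide_simps) (simp add: algebra_simps)
    finally show ?thesis by (simp add: add_divide_distrib)
  qed
  then have "(\<Sum>j\<in>{1..<n}. z 0 / (z 0 - z j)) - cnj (\<Sum>j\<in>{1..<n}. z 0 / (z 0 - z j)) = (\<Sum>j\<in>{1..<n}. (z 0 + z j) / (z 0 - z j))"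
    unfolding cnj_sum sum_subtractf[symmetric] by (rule sum.cong[OF refl])
  then have "vandermonde n z * cnj (vandermonde n z) * (\<Sum>j\<in>{1..<n}. (z 0 + z j) / (z 0 - z j))
     = vandermonde n z * cnj (vandermonde n z) * ((\<Sum>j\<in>{1..<n}. z 0 / (z 0 - z j)) - cnj (\<Sum>j\<in>{1..<n}. z 0 / (z 0 - z j)))"
    by simp
  then show ?thesis unfolding eq complex_cnj_mult by (simp add: algebra_simps)
qed

lemma monom_at_comp_transpose:
  assumes "a < n" "b < n"
  shows "monom_at n (k \<circ> transpose a b) z \<phi> = monom_at n k z (\<phi> \<circ> transpose a b)"
proof -
  have perm: "transpose a b permutes {..<n}" using assms by (intro permutes_swap_id) auto
  show ?thesis
    unfolding monom_at_def using prod.permute[OF perm, of "\<lambda>i. z (\<phi> i) powi (k \<circ> transpose a b) i"]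
    by (simp add: o_def)
qed

text \<open>Integration by parts in the angle of \<open>z 0\<close>, carried out on a grid. On the
  expanded density the angular derivative multiplies each term by
  \<open>\<sigma> 0 - \<tau> 0\<close>, which is \<open>- k 0\<close> for the terms that survive.
  The other evaluation uses the quotients \<open>(z 0 + z b) / (z 0 - z b)\<close>: they change sign
  when 0 and \<open>b\<close> are exchanged, so only the antisymmetric part of the monomial counts,
  and that part is a sum of shifts.\<close>

lemma weyl_moment_recursion:
  assumes n: "n > 0" and k: "\<forall>b<n. k b \<le> k 0"
  shows "of_int (k 0) * weyl_moment n k + (\<Sum>b\<in>{1..<n}. \<Sum>r<nat (k 0 - k b).
           (weyl_moment n (shift_exponents k b r) + weyl_moment n (shift_exponents k b (Suc r))) / 2) = 0"
proof -
  \<comment> \<open>Large enough for every exponent vector that occurs, since a shift keeps slots 0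
    and \<open>b\<close> between \<open>k b\<close> and \<open>k 0\<close>.\<close>
  define N where "N = nat (\<Sum>i<n. \<bar>k i\<bar>) + n"
  have N0: "N > 0" using n by (simp add: N_def)
  have kN: "\<bar>k i\<bar> + int n \<le> int N" if "i < n" for i
    using member_le_sum[of i "{..<n}" "\<lambda>i. \<bar>k i\<bar>"] that by (simp add: N_def sum_nonneg)
  have shN: "\<bar>shift_exponents k b r i\<bar> + int n \<le> int N" if "b < n" "int r \<le> k 0 - k b" "i < n" for b r i
    using kN[of i] kN[of b] kN[of 0] that n unfolding shift_exponents_def by auto
  define z where "z = grid_point N"
  define V where "V = (\<lambda>J. vandermonde n (z J) * cnj (vandermonde n (z J)))"
  define A where "A = (\<lambda>F :: _ \<Rightarrow> complex. \<Sum>J\<in>roots_grid n N. F J)"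
  have moment: "A (\<lambda>J. monom_at n l (z J) id * V J) = of_nat N ^ n * weyl_moment n l"
    if "\<And>i. i < n \<Longrightarrow> \<bar>l i\<bar> + int n \<le> int N" for l
  proof -
    have "A (\<lambda>J. monom_at n l (z J) id * V J) = (\<Sum>J\<in>roots_grid n N. monom_at n l (grid_point N J) id *
       (\<Sum>\<sigma> | \<sigma> permutes {..<n}. \<Sum>\<tau> | \<tau> permutes {..<n}. of_int (sign \<sigma> * sign \<tau>) * (\<Prod>i<n. grid_point N J i powi (int (\<sigma> i) - int (\<tau> i)))))"
      unfolding A_def V_def z_def by (simp add: vandermonde_norm_expand)
    then show ?thesis using sum_roots_grid_pairs[OF that N0] by (simp add: weyl_moment_def)
  qed
  have "A (\<lambda>J. monom_at n k (z J) id * (V J * (\<Sum>j\<in>{1..<n}. (z J 0 + z J j) / (z J 0 - z J j)))) =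
     (\<Sum>J\<in>roots_grid n N. monom_at n k (grid_point N J) id *
       (\<Sum>\<sigma> | \<sigma> permutes {..<n}. \<Sum>\<tau> | \<tau> permutes {..<n}.
          of_int (sign \<sigma> * sign \<tau>) * (of_nat (\<sigma> 0) - of_nat (\<tau> 0)) * (\<Prod>i<n. grid_point N J i powi (int (\<sigma> i) - int (\<tau> i)))))"
    unfolding A_def V_def z_def
    by (intro sum.cong refl) (subst vandermonde_deriv_expand[symmetric], simp, subst vandermonde_norm_deriv, use n in simp_all)
  also have "\<dots> = of_nat N ^ n * (\<Sum>\<sigma> | \<sigma> permutes {..<n}. \<Sum>\<tau> | \<tau> permutes {..<n}.
         of_int (sign \<sigma> * sign \<tau>) * (of_nat (\<sigma> 0) - of_nat (\<tau> 0)) * of_bool (\<forall>i<n. k i = int (\<tau> i) - int (\<sigma> i)))"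
    by (rule sum_roots_grid_pairs[OF kN N0])
  also have "(\<Sum>\<sigma> | \<sigma> permutes {..<n}. \<Sum>\<tau> | \<tau> permutes {..<n}.
         of_int (sign \<sigma> * sign \<tau>) * (of_nat (\<sigma> 0) - of_nat (\<tau> 0)) * of_bool (\<forall>i<n. k i = int (\<tau> i) - int (\<sigma> i)))
     = - of_int (k 0) * weyl_moment n k"
    unfolding weyl_moment_def sum_distrib_left
  proof (intro sum.cong refl)
    fix \<sigma> \<tau> :: "nat \<Rightarrow> nat"
    have "(of_int (k 0) :: complex) = of_nat (\<tau> 0) - of_nat (\<sigma> 0)" if "\<forall>i<n. k i = int (\<tau> i) - int (\<sigma> i)"
      using that n by simp
    then have e: "(of_nat (\<sigma> 0) - of_nat (\<tau> 0)) * of_bool (\<forall>i<n. k i = int (\<tau> i) - int (\<sigma> i))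
        = (- of_int (k 0) * of_bool (\<forall>i<n. k i = int (\<tau> i) - int (\<sigma> i)) :: complex)"
      by (cases "\<forall>i<n. k i = int (\<tau> i) - int (\<sigma> i)") (simp_all only: of_bool_eq, simp_all)
    show "of_int (sign \<sigma> * sign \<tau>) * (of_nat (\<sigma> 0) - of_nat (\<tau> 0)) * of_bool (\<forall>i<n. k i = int (\<tau> i) - int (\<sigma> i))
      = - of_int (k 0) * (of_int (sign \<sigma> * sign \<tau>) * of_bool (\<forall>i<n. k i = int (\<tau> i) - int (\<sigma> i)) :: complex)"
      unfolding mult.assoc e by (rule mult.left_commute)
  qed
  finally have main: "A (\<lambda>J. monom_at n k (z J) id * (V J * (\<Sum>j\<in>{1..<n}. (z J 0 + z J j) / (z J 0 - z J j))))
     = - (of_nat N ^ n * (of_int (k 0) * weyl_moment n k))" by (simp only: mult_minus_left mult_minus_right)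
  have slot: "A (\<lambda>J. monom_at n k (z J) id * (V J * ((z J 0 + z J b) / (z J 0 - z J b)))) =
     of_nat N ^ n * (\<Sum>r<nat (k 0 - k b). (weyl_moment n (shift_exponents k b r) + weyl_moment n (shift_exponents k b (Suc r))) / 2)"
    if b: "b \<in> {1..<n}" for b
  proof -
    define q where "q = (\<lambda>J. (z J 0 + z J b) / (z J 0 - z J b))"
    have zt: "z (J \<circ> transpose 0 b) = z J \<circ> transpose 0 b" for J
      by (auto simp: z_def grid_point_def fun_eq_iff)
    \<comment> \<open>Exchanging coordinates 0 and \<open>b\<close> maps the grid onto
      itself.\<close>
    have re: "A (\<lambda>J. F (J \<circ> transpose 0 b)) = A F" for F
      unfolding A_def
    proof (rule sum.reindex_bij_witness[of _ "\<lambda>J. J \<circ> transpose 0 b" "\<lambda>J. J \<circ> transpose 0 b"], goal_cases)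
      case (2 J)
      have perm: "transpose 0 b permutes {..<n}" using b n by (intro permutes_swap_id) auto
      show ?case using 2 permutes_in_image[OF perm] permutes_not_in[OF perm]
        by (auto simp: roots_grid_def PiE_iff extensional_def)
    next
      case (4 J)
      have perm: "transpose 0 b permutes {..<n}" using b n by (intro permutes_swap_id) auto
      show ?case using 4 permutes_in_image[OF perm] permutes_not_in[OF perm]
        by (auto simp: roots_grid_def PiE_iff extensional_def)
    qed (auto simp: fun_eq_iff)
    have "A (\<lambda>J. monom_at n k (z J) id * (V J * q J)) = A (\<lambda>J. - (monom_at n (k \<circ> transpose 0 b) (z J) id * (V J * q J)))"
    proof (subst re[symmetric], rule arg_cong[of _ _ A], rule ext)
      fix J
      have "V (J \<circ> transpose 0 b) = V J"
        using b by (simp add: V_def zt vandermonde_swap)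
      moreover have "q (J \<circ> transpose 0 b) = - q J"
        using b unfolding q_def zt by (simp add: divide_simps) (simp add: algebra_simps)
      moreover have "monom_at n k (z J \<circ> transpose 0 b) id = monom_at n (k \<circ> transpose 0 b) (z J) id"
        using b n by (subst monom_at_comp_transpose) (auto simp: monom_at_def)
      ultimately show "monom_at n k (z (J \<circ> transpose 0 b)) id * (V (J \<circ> transpose 0 b) * q (J \<circ> transpose 0 b)) =
         - (monom_at n (k \<circ> transpose 0 b) (z J) id * (V J * q J))"
        by (simp add: zt)
    qed
    then have "2 * A (\<lambda>J. monom_at n k (z J) id * (V J * q J)) = A (\<lambda>J. monom_at n k (z J) id * (V J * q J))
        - A (\<lambda>J. monom_at n (k \<circ> transpose 0 b) (z J) id * (V J * q J))"
      by (simp add: A_def sum_negf)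
    also have "\<dots> = A (\<lambda>J. (monom_at n k (z J) id - monom_at n (k \<circ> transpose 0 b) (z J) id) * q J * V J)"
      unfolding A_def sum_subtractf[symmetric] by (intro sum.cong refl) (simp add: left_diff_distrib right_diff_distrib mult_ac)
    also have "\<dots> = A (\<lambda>J. (\<Sum>r<nat (k 0 - k b). monom_at n (shift_exponents k b r) (z J) id + monom_at n (shift_exponents k b (Suc r)) (z J) id) * V J)"
      unfolding A_def
    proof (intro sum.cong refl)
      fix J
      show "(monom_at n k (z J) id - monom_at n (k \<circ> transpose 0 b) (z J) id) * q J * V J =
        (\<Sum>r<nat (k 0 - k b). monom_at n (shift_exponents k b r) (z J) id + monom_at n (shift_exponents k b (Suc r)) (z J) id) * V J"
      proof (cases "z J 0 = z J b")
        \<comment> \<open>Grid points may coincide. The quotient then has denominator 0, but the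
          density vanishes.\<close>
        case True
        then have "V J = 0" using vandermonde_eq_0[of 0 n b "z J"] b by (simp add: V_def)
        then show ?thesis by simp
      next
        case False
        then show ?thesis
          using monom_at_swap_diff[of b n "z J" id k] b k by (simp add: q_def z_def)
      qed
    qed
    also have "\<dots> = (\<Sum>r<nat (k 0 - k b). A (\<lambda>J. monom_at n (shift_exponents k b r) (z J) id * V J)
        + A (\<lambda>J. monom_at n (shift_exponents k b (Suc r)) (z J) id * V J))"
      unfolding A_def sum_distrib_right sum.distrib[symmetric] distrib_right by (rule sum.swap)
    also have "\<dots> = (\<Sum>r<nat (k 0 - k b). of_nat N ^ n * weyl_moment n (shift_exponents k b r)
        + of_nat N ^ n * weyl_moment n (shift_exponents k b (Suc r)))"
      using b by (intro sum.cong arg_cong2[of _ _ _ _ "(+)"] moment refl shN) auto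
    finally have e: "2 * A (\<lambda>J. monom_at n k (z J) id * (V J * q J)) = (\<Sum>r<nat (k 0 - k b). of_nat N ^ n * weyl_moment n (shift_exponents k b r)
        + of_nat N ^ n * weyl_moment n (shift_exponents k b (Suc r)))" .
    have "of_nat N ^ n * (\<Sum>r<nat (k 0 - k b). (weyl_moment n (shift_exponents k b r) + weyl_moment n (shift_exponents k b (Suc r))) / 2)
       = 2 * A (\<lambda>J. monom_at n k (z J) id * (V J * q J)) / 2"
      unfolding e sum_distrib_left sum_divide_distrib by (intro sum.cong refl) (simp add: distrib_left add_divide_distrib)
    then show ?thesis unfolding q_def by simp
  qed
  have "A (\<lambda>J. monom_at n k (z J) id * (V J * (\<Sum>j\<in>{1..<n}. (z J 0 + z J j) / (z J 0 - z J j))))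
     = (\<Sum>b\<in>{1..<n}. A (\<lambda>J. monom_at n k (z J) id * (V J * ((z J 0 + z J b) / (z J 0 - z J b)))))"
    unfolding A_def sum_distrib_left by (rule sum.swap)
  also have "\<dots> = of_nat N ^ n * (\<Sum>b\<in>{1..<n}. \<Sum>r<nat (k 0 - k b).
      (weyl_moment n (shift_exponents k b r) + weyl_moment n (shift_exponents k b (Suc r))) / 2)"
    unfolding sum_distrib_left[of "of_nat N ^ n" _ "{1..<n}"] using slot by (intro sum.cong refl)
  finally have "of_nat N ^ n * (of_int (k 0) * weyl_moment n k + (\<Sum>b\<in>{1..<n}. \<Sum>r<nat (k 0 - k b).
      (weyl_moment n (shift_exponents k b r) + weyl_moment n (shift_exponents k b (Suc r))) / 2)) = 0"
    using main by (simp only: distrib_left) (metis add.right_inverse)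
  then show ?thesis using N0 by simp
qed

text \<open>Besides the recursion itself: composing both permutations with a transposition permutes
  the exponents and keeps the product of signs, exchanging the two permutations negates the
  exponents, and at exponent 0 only the \<open>n!\<close> equal pairs remain.\<close>

lemma weyl_recursion_weyl_moment:
  assumes n: "n > 0" shows "weyl_recursion n (weyl_moment n)"
  unfolding weyl_recursion_def
proof (intro conjI allI impI)
  fix k k' :: "nat \<Rightarrow> int" assume "\<forall>i<n. k i = k' i"
  then have "(\<forall>i<n. k i = int (\<tau> i) - int (\<sigma> i)) \<longleftrightarrow> (\<forall>i<n. k' i = int (\<tau> i) - int (\<sigma> i))" for \<sigma> \<tau>
    by auto
  then show "weyl_moment n k = weyl_moment n k'" by (simp only: weyl_moment_def)
next
  fix k :: "nat \<Rightarrow> int" and a b assume ab: "a < n" "b < n"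
  have perm: "transpose a b permutes {..<n}" using ab by (intro permutes_swap_id) auto
  have "weyl_moment n k = (\<Sum>\<sigma> | \<sigma> permutes {..<n}. \<Sum>\<tau> | \<tau> permutes {..<n}.
     of_int (sign (\<sigma> \<circ> transpose a b) * sign (\<tau> \<circ> transpose a b)) *
     of_bool (\<forall>i<n. k i = int ((\<tau> \<circ> transpose a b) i) - int ((\<sigma> \<circ> transpose a b) i)))"
    unfolding weyl_moment_def
    by (subst sum_permutations_compose_right[OF perm], subst (2) sum_permutations_compose_right[OF perm]) simp
  also have "\<dots> = weyl_moment n (k \<circ> transpose a b)"
    unfolding weyl_moment_def
  proof (intro sum.cong refl)
    fix \<sigma> \<tau> assume "\<sigma> \<in> {\<sigma>. \<sigma> permutes {..<n}}" "\<tau> \<in> {\<sigma>. \<sigma> permutes {..<n}}"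
    then have "permutation \<sigma>" "permutation \<tau>" unfolding permutation_permutes by blast+
    then have "sign (\<sigma> \<circ> transpose a b) * sign (\<tau> \<circ> transpose a b) = sign \<sigma> * sign \<tau>"
      by (simp add: sign_compose permutation_swap_id sign_swap_id)
    moreover have "(\<forall>i<n. k i = int ((\<tau> \<circ> transpose a b) i) - int ((\<sigma> \<circ> transpose a b) i)) \<longleftrightarrow>
       (\<forall>i<n. (k \<circ> transpose a b) i = int (\<tau> i) - int (\<sigma> i))"
    proof
      assume "\<forall>i<n. k i = int ((\<tau> \<circ> transpose a b) i) - int ((\<sigma> \<circ> transpose a b) i)"
      then show "\<forall>i<n. (k \<circ> transpose a b) i = int (\<tau> i) - int (\<sigma> i)"
        using permutes_in_image[OF perm] by (auto simp: o_def)
    next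
      assume *: "\<forall>i<n. (k \<circ> transpose a b) i = int (\<tau> i) - int (\<sigma> i)"
      show "\<forall>i<n. k i = int ((\<tau> \<circ> transpose a b) i) - int ((\<sigma> \<circ> transpose a b) i)"
      proof (intro allI impI)
        fix i assume "i < n"
        then have "transpose a b i < n" using permutes_in_image[OF perm, of i] by auto
        then show "k i = int ((\<tau> \<circ> transpose a b) i) - int ((\<sigma> \<circ> transpose a b) i)"
          using *[rule_format, of "transpose a b i"] by simp
      qed
    qed
    ultimately show "of_int (sign (\<sigma> \<circ> transpose a b) * sign (\<tau> \<circ> transpose a b)) *
       of_bool (\<forall>i<n. k i = int ((\<tau> \<circ> transpose a b) i) - int ((\<sigma> \<circ> transpose a b) i)) =
      (of_int (sign \<sigma> * sign \<tau>) * of_bool (\<forall>i<n. (k \<circ> transpose a b) i = int (\<tau> i) - int (\<sigma> i)) :: complex)"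
      by (simp only:)
  qed
  finally show "weyl_moment n (k \<circ> transpose a b) = weyl_moment n k" by simp
next
  fix k :: "nat \<Rightarrow> int"
  have "weyl_moment n (\<lambda>i. - k i) = (\<Sum>\<tau> | \<tau> permutes {..<n}. \<Sum>\<sigma> | \<sigma> permutes {..<n}.
     of_int (sign \<sigma> * sign \<tau>) * of_bool (\<forall>i<n. - k i = int (\<tau> i) - int (\<sigma> i)))"
    unfolding weyl_moment_def by (rule sum.swap)
  also have "\<dots> = cnj (weyl_moment n k)"
    unfolding weyl_moment_def cnj_sum
  proof (intro sum.cong refl)
    fix \<sigma> \<tau> :: "nat \<Rightarrow> nat"
    have "(\<forall>i<n. - k i = int (\<tau> i) - int (\<sigma> i)) \<longleftrightarrow> (\<forall>i<n. k i = int (\<sigma> i) - int (\<tau> i))"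
      by (intro all_cong) auto
    then show "of_int (sign \<sigma> * sign \<tau>) * of_bool (\<forall>i<n. - k i = int (\<tau> i) - int (\<sigma> i)) =
       cnj (of_int (sign \<tau> * sign \<sigma>) * of_bool (\<forall>i<n. k i = int (\<sigma> i) - int (\<tau> i)))"
      by (simp add: mult.commute)
  qed
  finally show "weyl_moment n (\<lambda>i. - k i) = cnj (weyl_moment n k)" .
next
  have fin: "finite {\<sigma>. \<sigma> permutes {..<n}}" by (rule finite_permutations) simp
  have eq: "(\<forall>i<n. 0 = int (\<tau> i) - int (\<sigma> i)) \<longleftrightarrow> \<tau> = \<sigma>" if "\<sigma> permutes {..<n}" "\<tau> permutes {..<n}" for \<sigma> \<tau>
  proof
    assume *: "\<forall>i<n. 0 = int (\<tau> i) - int (\<sigma> i)"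
    show "\<tau> = \<sigma>"
    proof
      fix i show "\<tau> i = \<sigma> i"
        using * permutes_not_in[OF that(1), of i] permutes_not_in[OF that(2), of i] by (cases "i < n") auto
    qed
  qed simp
  have "weyl_moment n (\<lambda>_. 0) = (\<Sum>\<sigma> | \<sigma> permutes {..<n}. \<Sum>\<tau> | \<tau> permutes {..<n}. if \<tau> = \<sigma> then 1 else 0)"
    unfolding weyl_moment_def
  proof (intro sum.cong refl)
    fix \<sigma> \<tau> assume "\<sigma> \<in> {\<sigma>. \<sigma> permutes {..<n}}" "\<tau> \<in> {\<sigma>. \<sigma> permutes {..<n}}"
    then have "(\<forall>i<n. 0 = int (\<tau> i) - int (\<sigma> i)) \<longleftrightarrow> \<tau> = \<sigma>" by (intro eq) auto
    then show "of_int (sign \<sigma> * sign \<tau>) * of_bool (\<forall>i<n. 0 = int (\<tau> i) - int (\<sigma> i)) = (if \<tau> = \<sigma> then 1 else 0 :: complex)"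
      by (simp only:) (simp flip: of_int_mult)
  qed
  also have "\<dots> = of_nat (card {\<sigma>. \<sigma> permutes {..<n}})" using fin by simp
  also have "\<dots> = fact n" by (subst card_permutations[of _ n]) auto
  finally show "weyl_moment n (\<lambda>_. 0) = fact n" .
next
  fix k :: "nat \<Rightarrow> int" assume "\<forall>b<n. k b \<le> k 0"
  then show "of_int (k 0) * weyl_moment n k + (\<Sum>b\<in>{1..<n}. \<Sum>r<nat (k 0 - k b).
           (weyl_moment n (shift_exponents k b r) + weyl_moment n (shift_exponents k b (Suc r))) / 2) = 0"
    by (rule weyl_moment_recursion[OF n])
qed

section \<open>Unitary matrices\<close>

lemma mat_adjoint_index:
  assumes "A \<in> carrier_mat m n" "i < n" "j < m"
  shows "mat_adjoint A $$ (i, j) = cnj (A $$ (j, i))"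
  using assms unfolding mat_adjoint_def by (auto simp: mat_of_rows_def)

lemma mat_adjoint_carrier: "A \<in> carrier_mat m n \<Longrightarrow> mat_adjoint A \<in> carrier_mat n m"
  unfolding mat_adjoint_def using mat_of_rows_carrier(1)[of "dim_row A" "map conjugate (cols A)"] by simp

lemma mult_index_sum:
  assumes "A \<in> carrier_mat m n" "B \<in> carrier_mat n p" "i < m" "j < p"
  shows "(A * B) $$ (i, j) = (\<Sum>s<n. A $$ (i, s) * B $$ (s, j))"
  using assms by (auto simp: scalar_prod_def lessThan_atLeast0)

lemma unitary_groupD: "U \<in> unitary_group n \<Longrightarrow> U \<in> carrier_mat n n"
  by (simp add: unitary_group_def)

lemma unitary_group_iff_cols:
  "U \<in> unitary_group n \<longleftrightarrow> U \<in> carrier_mat n n \<and>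
     (\<forall>i<n. \<forall>j<n. (\<Sum>s<n. cnj (U $$ (s, i)) * U $$ (s, j)) = of_bool (i = j))"
proof -
  have "mat_adjoint U * U = 1\<^sub>m n \<longleftrightarrow> (\<forall>i<n. \<forall>j<n. (\<Sum>s<n. cnj (U $$ (s, i)) * U $$ (s, j)) = of_bool (i = j))"
    if U: "U \<in> carrier_mat n n"
  proof -
    have "mat_adjoint U * U = 1\<^sub>m n \<longleftrightarrow> (\<forall>i<n. \<forall>j<n. (mat_adjoint U * U) $$ (i, j) = 1\<^sub>m n $$ (i, j))"
      using U mat_adjoint_carrier[OF U] by (auto simp: mat_eq_iff)
    also have "\<dots> \<longleftrightarrow> (\<forall>i<n. \<forall>j<n. (\<Sum>s<n. cnj (U $$ (s, i)) * U $$ (s, j)) = of_bool (i = j))"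
    proof -
      have "(mat_adjoint U * U) $$ (i, j) = (\<Sum>s<n. cnj (U $$ (s, i)) * U $$ (s, j))" if "i < n" "j < n" for i j
        unfolding mult_index_sum[OF mat_adjoint_carrier[OF U] U that]
        using that by (intro sum.cong refl) (simp add: mat_adjoint_index[OF U])
      then show ?thesis by (simp add: of_bool_def del: index_mult_mat)
    qed
    finally show ?thesis .
  qed
  then show ?thesis by (auto simp: unitary_group_def)
qed

lemma unitary_rows:
  assumes "U \<in> unitary_group n" "i < n" "j < n"
  shows "(\<Sum>s<n. U $$ (i, s) * cnj (U $$ (j, s))) = of_bool (i = j)"
proof -
  have U: "U \<in> carrier_mat n n" and 1: "mat_adjoint U * U = 1\<^sub>m n" using assms(1) by (auto simp: unitary_group_def)
  have "U * mat_adjoint U = 1\<^sub>m n"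
    by (rule mat_mult_left_right_inverse[OF mat_adjoint_carrier[OF U] U 1])
  then have "(U * mat_adjoint U) $$ (i, j) = 1\<^sub>m n $$ (i, j)" by simp
  then show ?thesis
    using assms(2,3) by (simp add: mult_index_sum[OF U mat_adjoint_carrier[OF U]] mat_adjoint_index[OF U] del: index_mult_mat)
qed

lemma mat_adjoint_unitary:
  assumes "U \<in> unitary_group n" shows "mat_adjoint U \<in> unitary_group n"
  unfolding unitary_group_iff_cols[of "mat_adjoint U"]
proof (intro conjI allI impI)
  have U: "U \<in> carrier_mat n n" using assms by (rule unitary_groupD)
  then show "mat_adjoint U \<in> carrier_mat n n" by (rule mat_adjoint_carrier)
  fix i j assume ij: "i < n" "j < n"
  have "(\<Sum>s<n. cnj (mat_adjoint U $$ (s, i)) * mat_adjoint U $$ (s, j)) = (\<Sum>s<n. U $$ (i, s) * cnj (U $$ (j, s)))"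
    using ij by (intro sum.cong refl) (simp add: mat_adjoint_index[OF U])
  also have "\<dots> = of_bool (i = j)" by (rule unitary_rows[OF assms ij])
  finally show "(\<Sum>s<n. cnj (mat_adjoint U $$ (s, i)) * mat_adjoint U $$ (s, j)) = of_bool (i = j)" .
qed

lemma unitary_group_one: "1\<^sub>m n \<in> unitary_group n"
  unfolding unitary_group_iff_cols
proof (intro conjI allI impI)
  fix i j assume ij: "i < n" "j < n"
  have "(\<Sum>s<n. cnj (1\<^sub>m n $$ (s, i)) * 1\<^sub>m n $$ (s, j)) = (\<Sum>s<n. if s = i then of_bool (i = j) else 0 :: complex)"
    using ij by (intro sum.cong refl) auto
  then show "(\<Sum>s<n. cnj (1\<^sub>m n $$ (s, i)) * 1\<^sub>m n $$ (s, j)) = (of_bool (i = j) :: complex)"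
    using ij by simp
qed simp

lemma unitary_group_mult:
  assumes "U \<in> unitary_group n" "V \<in> unitary_group n"
  shows "U * V \<in> unitary_group n"
  unfolding unitary_group_iff_cols
proof (intro conjI allI impI)
  have U: "U \<in> carrier_mat n n" and V: "V \<in> carrier_mat n n" using assms by (auto dest: unitary_groupD)
  then show "U * V \<in> carrier_mat n n" by simp
  fix i j assume ij: "i < n" "j < n"
  have "(\<Sum>s<n. cnj ((U * V) $$ (s, i)) * (U * V) $$ (s, j)) =
     (\<Sum>s<n. \<Sum>a<n. \<Sum>b<n. (cnj (V $$ (a, i)) * V $$ (b, j)) * (cnj (U $$ (s, a)) * U $$ (s, b)))"
  proof (intro sum.cong refl)
    fix s assume "s \<in> {..<n}"
    then have e: "(U * V) $$ (s, i) = (\<Sum>a<n. U $$ (s, a) * V $$ (a, i))" "(U * V) $$ (s, j) = (\<Sum>a<n. U $$ (s, a) * V $$ (a, j))"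
      using ij by (auto intro: mult_index_sum[OF U V])
    show "cnj ((U * V) $$ (s, i)) * (U * V) $$ (s, j) =
        (\<Sum>a<n. \<Sum>b<n. (cnj (V $$ (a, i)) * V $$ (b, j)) * (cnj (U $$ (s, a)) * U $$ (s, b)))"
      unfolding e cnj_sum sum_product by (intro sum.cong refl) (simp add: mult_ac)
  qed
  also have "\<dots> = (\<Sum>a<n. \<Sum>s<n. \<Sum>b<n. (cnj (V $$ (a, i)) * V $$ (b, j)) * (cnj (U $$ (s, a)) * U $$ (s, b)))"
    by (rule sum.swap)
  also have "\<dots> = (\<Sum>a<n. \<Sum>b<n. \<Sum>s<n. (cnj (V $$ (a, i)) * V $$ (b, j)) * (cnj (U $$ (s, a)) * U $$ (s, b)))"
    by (intro sum.cong refl sum.swap)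
  also have "\<dots> = (\<Sum>a<n. \<Sum>b<n. (cnj (V $$ (a, i)) * V $$ (b, j)) * of_bool (a = b))"
    unfolding sum_distrib_left[symmetric] using assms(1) by (intro sum.cong refl) (simp add: unitary_group_iff_cols)
  also have "\<dots> = (\<Sum>a<n. cnj (V $$ (a, i)) * V $$ (a, j))"
    by (intro sum.cong refl) (simp add: of_bool_def if_distrib[of "\<lambda>x. _ * x"] cong: if_cong)
  also have "\<dots> = of_bool (i = j)" using assms(2) ij by (simp add: unitary_group_iff_cols)
  finally show "(\<Sum>s<n. cnj ((U * V) $$ (s, i)) * (U * V) $$ (s, j)) = of_bool (i = j)" .
qed

lemma unitary_group_pow: "U \<in> unitary_group n \<Longrightarrow> U ^\<^sub>m k \<in> unitary_group n"
  by (induction k) (auto simp: unitary_group_one unitary_group_mult dest: unitary_groupD)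

text \<open>The columns have Euclidean norm 1.\<close>

lemma unitary_entry_le:
  assumes "U \<in> unitary_group n" "i < n" "j < n"
  shows "norm (U $$ (i, j)) \<le> 1"
proof -
  have "(\<Sum>s<n. cnj (U $$ (s, j)) * U $$ (s, j)) = 1"
    using assms by (simp add: unitary_group_iff_cols)
  then have "complex_of_real (\<Sum>s<n. (norm (U $$ (s, j)))\<^sup>2) = complex_of_real 1"
    unfolding of_real_sum complex_norm_square by (simp add: mult.commute)
  then have "(\<Sum>s<n. (norm (U $$ (s, j)))\<^sup>2) = 1" by (simp only: of_real_eq_iff)
  moreover have "(norm (U $$ (i, j)))\<^sup>2 \<le> (\<Sum>s<n. (norm (U $$ (s, j)))\<^sup>2)"
    using assms by (intro member_le_sum) auto
  ultimately show ?thesis by (simp add: power_le_one_iff abs_square_le_1)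
qed

section \<open>The Borel structure of the unitary group and left translations\<close>

lemma space_unitary_borel [simp]: "space (unitary_borel n) = unitary_group n"
  by (simp add: unitary_borel_def)

lemma measurable_unitary_entry:
  assumes "i < n" "j < n"
  shows "(\<lambda>U. U $$ (i, j)) \<in> borel_measurable (unitary_borel n)"
proof -
  let ?g = "\<lambda>U :: complex mat. \<lambda>(i, j) \<in> {..<n} \<times> {..<n}. U $$ (i, j)"
  have "?g \<in> measurable (unitary_borel n) (PiM ({..<n} \<times> {..<n}) (\<lambda>_. borel))"
    unfolding unitary_borel_def by (rule measurable_vimage_algebra1) (simp add: space_PiM)
  moreover have "(\<lambda>x. x (i, j)) \<in> borel_measurable (PiM ({..<n} \<times> {..<n}) (\<lambda>_. borel :: complex measure))"
    using assms by (intro measurable_component_singleton) auto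
  ultimately have "(\<lambda>U. ?g U (i, j)) \<in> borel_measurable (unitary_borel n)"
    by (rule measurable_compose)
  then show ?thesis using assms by simp
qed

lemma measurable_into_unitary_borel:
  assumes "\<And>x. x \<in> space M \<Longrightarrow> f x \<in> unitary_group n"
    and "\<And>i j. i < n \<Longrightarrow> j < n \<Longrightarrow> (\<lambda>x. f x $$ (i, j)) \<in> borel_measurable M"
  shows "f \<in> measurable M (unitary_borel n)"
  unfolding unitary_borel_def
proof (rule measurable_vimage_algebra2)
  show "(\<lambda>x. \<lambda>(i, j) \<in> {..<n} \<times> {..<n}. f x $$ (i, j)) \<in> measurable M (PiM ({..<n} \<times> {..<n}) (\<lambda>_. borel))"
    by (rule measurable_restrict) (use assms(2) in auto)
qed (use assms(1) in auto)

lemma haar_translate_measurable: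
  assumes h: "haar_unitary n \<mu>" and V: "V \<in> unitary_group n"
  shows "(\<lambda>U. V * U) \<in> measurable \<mu> \<mu>"
proof -
  have sets: "sets \<mu> = sets (unitary_borel n)" using h by (simp add: haar_unitary_def)
  show ?thesis
    unfolding measurable_cong_sets[OF sets sets]
  proof (rule measurable_into_unitary_borel)
    fix i j assume ij: "i < n" "j < n"
    have "(\<lambda>U. \<Sum>s<n. V $$ (i, s) * U $$ (s, j)) \<in> borel_measurable (unitary_borel n)"
      using ij by (intro borel_measurable_sum borel_measurable_times borel_measurable_const measurable_unitary_entry) auto
    then show "(\<lambda>U. (V * U) $$ (i, j)) \<in> borel_measurable (unitary_borel n)"
      using ij V by (subst measurable_cong[of _ _ "\<lambda>U. \<Sum>s<n. V $$ (i, s) * U $$ (s, j)"])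
        (auto simp: mult_index_sum dest!: unitary_groupD simp del: index_mult_mat)
  qed (use V in \<open>auto intro: unitary_group_mult\<close>)
qed

text \<open>Invariance is given for images of sets, while a push-forward is computed from preimages:
  the preimage under multiplication by \<open>V\<close> is the image under multiplication by its
  adjoint.\<close>

lemma haar_unitary_translate:
  assumes h: "haar_unitary n \<mu>" and V: "V \<in> unitary_group n"
  shows "distr \<mu> \<mu> (\<lambda>U. V * U) = \<mu>"
proof (rule measure_eqI)
  have sets: "sets \<mu> = sets (unitary_borel n)" and inv: "\<And>W S. W \<in> unitary_group n \<Longrightarrow> S \<in> sets \<mu> \<Longrightarrow> emeasure \<mu> ((\<lambda>A. W * A) ` S) = emeasure \<mu> S"
    using h by (auto simp: haar_unitary_def)
  have space: "space \<mu> = unitary_group n" using sets_eq_imp_space_eq[OF sets] by simp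
  have meas: "(\<lambda>U. V * U) \<in> measurable \<mu> \<mu>" by (rule haar_translate_measurable[OF h V])
  fix S assume "S \<in> sets (distr \<mu> \<mu> ((*) V))"
  then have S: "S \<in> sets \<mu>" by simp
  then have Ssub: "S \<subseteq> unitary_group n" using sets.sets_into_space space by blast
  have Vc: "V \<in> carrier_mat n n" "mat_adjoint V \<in> carrier_mat n n" "mat_adjoint V * V = 1\<^sub>m n"
    using V mat_adjoint_carrier by (auto simp: unitary_group_def)
  have VV: "V * mat_adjoint V = 1\<^sub>m n"
    by (rule mat_mult_left_right_inverse[OF Vc(2,1,3)])
  have "(\<lambda>U. V * U) -` S \<inter> space \<mu> = (\<lambda>A. mat_adjoint V * A) ` S"
  proof (intro equalityI subsetI)
    fix U assume U: "U \<in> (\<lambda>U. V * U) -` S \<inter> space \<mu>"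
    then have "U \<in> carrier_mat n n" using space by (auto dest: unitary_groupD)
    then have "U = mat_adjoint V * (V * U)"
      using Vc by (simp flip: assoc_mult_mat[of _ n n _ n _ n])
    then show "U \<in> (\<lambda>A. mat_adjoint V * A) ` S" using U by blast
  next
    fix U assume "U \<in> (\<lambda>A. mat_adjoint V * A) ` S"
    then obtain A where A: "A \<in> S" "U = mat_adjoint V * A" by blast
    then have Au: "A \<in> unitary_group n" using Ssub by blast
    then have "A \<in> carrier_mat n n" by (rule unitary_groupD)
    then have "V * U = A" using Vc VV unfolding A(2) by (simp flip: assoc_mult_mat[of _ n n _ n _ n])
    moreover have "U \<in> unitary_group n"
      unfolding A(2) using V Au by (intro unitary_group_mult mat_adjoint_unitary)
    ultimately show "U \<in> (\<lambda>U. V * U) -` S \<inter> space \<mu>" using A space by simp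
  qed
  then show "emeasure (distr \<mu> \<mu> ((*) V)) S = emeasure \<mu> S"
    using inv[OF mat_adjoint_unitary[OF V] S] meas S by (simp add: emeasure_distr)
qed simp

section \<open>Bounded measurable functions and their Haar integrals\<close>

definition regular :: "nat \<Rightarrow> (complex mat \<Rightarrow> complex) \<Rightarrow> bool" where
  "regular n f \<longleftrightarrow> f \<in> borel_measurable (unitary_borel n) \<and> (\<exists>K. \<forall>U\<in>unitary_group n. norm (f U) \<le> K)"

lemma regular_const: "regular n (\<lambda>_. c)"
  by (auto simp: regular_def)

lemma regular_entry: "i < n \<Longrightarrow> j < n \<Longrightarrow> regular n (\<lambda>U. U $$ (i, j))"
  unfolding regular_def using unitary_entry_le measurable_unitary_entry by blast

lemma regular_mult:
  assumes "regular n f" "regular n g" shows "regular n (\<lambda>U. f U * g U)"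
proof -
  obtain K L where "\<And>U. U \<in> unitary_group n \<Longrightarrow> norm (f U) \<le> K" "\<And>U. U \<in> unitary_group n \<Longrightarrow> norm (g U) \<le> L"
    using assms unfolding regular_def by blast
  then have "norm (f U * g U) \<le> K * L" if "U \<in> unitary_group n" for U
    using that unfolding norm_mult by (meson mult_mono norm_ge_zero order_trans)
  moreover have "(\<lambda>U. f U * g U) \<in> borel_measurable (unitary_borel n)"
    using assms unfolding regular_def by (intro borel_measurable_times) auto
  ultimately show ?thesis unfolding regular_def by blast
qed

lemma regular_add:
  assumes "regular n f" "regular n g" shows "regular n (\<lambda>U. f U + g U)"
proof -
  obtain K L where "\<And>U. U \<in> unitary_group n \<Longrightarrow> norm (f U) \<le> K" "\<And>U. U \<in> unitary_group n \<Longrightarrow> norm (g U) \<le> L"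
    using assms unfolding regular_def by blast
  then have "norm (f U + g U) \<le> K + L" if "U \<in> unitary_group n" for U
    using that by (meson add_mono norm_triangle_le)
  moreover have "(\<lambda>U. f U + g U) \<in> borel_measurable (unitary_borel n)"
    using assms unfolding regular_def by (intro borel_measurable_add) auto
  ultimately show ?thesis unfolding regular_def by blast
qed

lemma regular_sum: "(\<And>a. a \<in> A \<Longrightarrow> regular n (f a)) \<Longrightarrow> regular n (\<lambda>U. \<Sum>a\<in>A. f a U)"
  by (induction A rule: infinite_finite_induct) (auto intro: regular_add regular_const)

lemma regular_cnj: "regular n f \<Longrightarrow> regular n (\<lambda>U. cnj (f U))"
  unfolding regular_def
  using measurable_compose[OF _ borel_measurable_continuous_onI[OF continuous_on_cnj[OF continuous_on_id]], of f]
  by (auto simp: id_def)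

lemma regular_cong:
  assumes "\<And>U. U \<in> unitary_group n \<Longrightarrow> f U = g U" shows "regular n f \<longleftrightarrow> regular n g"
proof -
  have "f \<in> borel_measurable (unitary_borel n) \<longleftrightarrow> g \<in> borel_measurable (unitary_borel n)"
    by (rule measurable_cong) (simp add: assms)
  then show ?thesis unfolding regular_def by (simp add: assms)
qed

lemma regular_integrable:
  assumes "haar_unitary n \<mu>" "regular n f" shows "integrable \<mu> f"
proof -
  interpret prob_space \<mu> using assms by (simp add: haar_unitary_def)
  have sets: "sets \<mu> = sets (unitary_borel n)" using assms by (simp add: haar_unitary_def)
  have "space \<mu> = unitary_group n" using sets_eq_imp_space_eq[OF sets] by simp
  then obtain K where "\<And>U. U \<in> space \<mu> \<Longrightarrow> norm (f U) \<le> K"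
    using assms(2) unfolding regular_def by blast
  moreover have "f \<in> borel_measurable \<mu>"
    using assms(2) unfolding regular_def measurable_cong_sets[OF sets refl] by blast
  ultimately show ?thesis by (intro integrable_const_bound[of _ K]) auto
qed

lemma haar_integral_translate:
  assumes "haar_unitary n \<mu>" "regular n f" "V \<in> unitary_group n"
  shows "(\<integral>U. f (V * U) \<partial>\<mu>) = (\<integral>U. f U \<partial>\<mu>)"
proof -
  have sets: "sets \<mu> = sets (unitary_borel n)" using assms by (simp add: haar_unitary_def)
  have space: "space \<mu> = unitary_group n" using sets_eq_imp_space_eq[OF sets] by simp
  have meas: "(\<lambda>U. V * U) \<in> measurable \<mu> \<mu>" by (rule haar_translate_measurable[OF assms(1,3)])
  have "f \<in> borel_measurable \<mu>"
    using assms(2) unfolding regular_def measurable_cong_sets[OF sets refl] by blast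
  then have "(\<integral>U. f (V * U) \<partial>\<mu>) = (\<integral>U. f U \<partial>distr \<mu> \<mu> (\<lambda>U. V * U))"
    by (rule integral_distr[OF meas, symmetric])
  then show ?thesis by (simp add: haar_unitary_translate[OF assms(1,3)])
qed

lemma sum_of_bool_mult [simp]:
  fixes f :: "nat \<Rightarrow> complex"
  assumes "i < n"
  shows "(\<Sum>s<n. of_bool (s = i) * f s) = f i" "(\<Sum>s<n. of_bool (i = s) * f s) = f i"
    "(\<Sum>s<n. f s * of_bool (s = i)) = f i" "(\<Sum>s<n. f s * of_bool (i = s)) = f i"
proof -
  have *: "(\<Sum>s<n. if s = i then f s else 0) = f i" using assms by simp
  have e: "of_bool (s = i) * f s = (if s = i then f s else 0)" "of_bool (i = s) * f s = (if s = i then f s else 0)"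
    "f s * of_bool (s = i) = (if s = i then f s else 0)" "f s * of_bool (i = s) = (if s = i then f s else 0)" for s
    by auto
  show "(\<Sum>s<n. of_bool (s = i) * f s) = f i" "(\<Sum>s<n. of_bool (i = s) * f s) = f i"
    "(\<Sum>s<n. f s * of_bool (s = i)) = f i" "(\<Sum>s<n. f s * of_bool (i = s)) = f i"
    unfolding e * by (rule refl)+
qed

lemma integral_double_sum:
  fixes g :: "nat \<Rightarrow> nat \<Rightarrow> 'a \<Rightarrow> complex"
  assumes "\<And>x y. x < n \<Longrightarrow> y < n \<Longrightarrow> integrable M (g x y)"
  shows "(\<integral>\<omega>. (\<Sum>x<n. \<Sum>y<n. a x y * g x y \<omega>) \<partial>M) = (\<Sum>x<n. \<Sum>y<n. a x y * (\<integral>\<omega>. g x y \<omega> \<partial>M))"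
proof -
  have 1: "integrable M (\<lambda>\<omega>. a x y * g x y \<omega>)" if "x < n" "y < n" for x y
    using assms[OF that] by (rule integrable_mult_right)
  have "(\<integral>\<omega>. (\<Sum>x<n. \<Sum>y<n. a x y * g x y \<omega>) \<partial>M) = (\<Sum>x<n. \<integral>\<omega>. (\<Sum>y<n. a x y * g x y \<omega>) \<partial>M)"
    by (rule Bochner_Integration.integral_sum) (rule Bochner_Integration.integrable_sum, simp add: 1)
  also have "\<dots> = (\<Sum>x<n. \<Sum>y<n. \<integral>\<omega>. a x y * g x y \<omega> \<partial>M)"
    by (intro sum.cong refl Bochner_Integration.integral_sum) (simp add: 1)
  finally show ?thesis by simp
qed

section \<open>Symmetric sums of monomials over ordered tuples of distinct points\<close>

definition msym :: "nat \<Rightarrow> nat \<Rightarrow> (nat \<Rightarrow> int) \<Rightarrow> (nat \<Rightarrow> complex) \<Rightarrow> complex" where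
  "msym n r k z = (\<Sum>\<phi>\<in>inj_tuples r n. monom_at r k z \<phi>)"

text \<open>An injective tuple of length \<open>i\<close> extends by one slot in
  \<open>n - i\<close> ways.\<close>

lemma sum_inj_tuples_restrict:
  assumes "r \<le> m" "m \<le> n"
  shows "(\<Sum>\<phi>\<in>inj_tuples m n. F (restrict \<phi> {..<r})) =
    of_nat (\<Prod>i\<in>{r..<m}. n - i) * (\<Sum>\<phi>\<in>inj_tuples r n. F \<phi> :: complex)"
  using assms
proof (induction rule: dec_induct)
  case base
  have "restrict \<phi> {..<r} = \<phi>" if "\<phi> \<in> inj_tuples r n" for \<phi>
    using that by (auto simp: inj_tuples_def intro: PiE_restrict)
  then show ?case by simp
next
  case (step m)
  have "(\<Sum>\<phi>\<in>inj_tuples (Suc m) n. F (restrict \<phi> {..<r})) =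
    (\<Sum>\<phi>\<in>inj_tuples m n. \<Sum>v\<in>{..<n} - \<phi> ` {..<m}. F (restrict (\<phi>(m := v)) {..<r}))"
    by (rule sum_inj_tuples_Suc)
  also have "\<dots> = (\<Sum>\<phi>\<in>inj_tuples m n. of_nat (n - m) * F (restrict \<phi> {..<r}))"
  proof (intro sum.cong refl)
    fix \<phi> assume \<phi>: "\<phi> \<in> inj_tuples m n"
    have "restrict (\<phi>(m := v)) {..<r} = restrict \<phi> {..<r}" for v
      using step by (auto simp: restrict_def)
    moreover have "card ({..<n} - \<phi> ` {..<m}) = n - m"
      using inj_tuples_less[OF \<phi>] inj_tuples_inj[OF \<phi>]
      by (subst card_Diff_subset) (auto simp: card_image)
    ultimately show "(\<Sum>v\<in>{..<n} - \<phi> ` {..<m}. F (restrict (\<phi>(m := v)) {..<r})) = of_nat (n - m) * F (restrict \<phi> {..<r})"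
      by simp
  qed
  also have "\<dots> = of_nat (n - m) * (\<Sum>\<phi>\<in>inj_tuples m n. F (restrict \<phi> {..<r}))"
    by (rule sum_distrib_left[symmetric])
  also have "(\<Sum>\<phi>\<in>inj_tuples m n. F (restrict \<phi> {..<r})) = of_nat (\<Prod>i\<in>{r..<m}. n - i) * (\<Sum>\<phi>\<in>inj_tuples r n. F \<phi>)"
    by (rule step.IH) (use step.prems in simp)
  also have "of_nat (n - m) * (of_nat (\<Prod>i\<in>{r..<m}. n - i) * (\<Sum>\<phi>\<in>inj_tuples r n. F \<phi>)) =
      of_nat (\<Prod>i\<in>{r..<Suc m}. n - i) * (\<Sum>\<phi>\<in>inj_tuples r n. F \<phi>)"
    by (simp only: prod.atLeastLessThan_Suc[OF step.hyps(1)] of_nat_mult mult_ac)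
  finally show ?case .
qed

lemma prod_diff_fact: "r \<le> n \<Longrightarrow> (\<Prod>i\<in>{r..<n}. n - i) = (fact (n - r) :: nat)"
proof -
  assume r: "r \<le> n"
  have "(\<Prod>i\<in>{r..<n}. n - i) = (\<Prod>j\<in>{1..n - r}. j)"
    using r by (intro prod.reindex_bij_witness[of _ "\<lambda>j. n - j" "\<lambda>i. n - i"]) auto
  then show ?thesis by (simp add: fact_prod)
qed

lemma sum_inj_tuples_full:
  assumes "r \<le> n"
  shows "(\<Sum>\<phi>\<in>inj_tuples n n. F (restrict \<phi> {..<r})) = fact (n - r) * (\<Sum>\<phi>\<in>inj_tuples r n. F \<phi> :: complex)"
  using sum_inj_tuples_restrict[OF assms order_refl, of F] prod_diff_fact[OF assms] by simp

lemma inj_tuples_full_image: "\<phi> \<in> inj_tuples n n \<Longrightarrow> \<phi> ` {..<n} = {..<n}"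
  using endo_inj_surj[of "{..<n}" \<phi>] inj_tuples_inj[of \<phi> n n] inj_tuples_less[of \<phi> n n] by auto

lemma sum_inj_tuples_comp_transpose:
  assumes "a < n" "b < n"
  shows "(\<Sum>\<phi>\<in>inj_tuples n n. F (\<phi> \<circ> transpose a b)) = (\<Sum>\<phi>\<in>inj_tuples n n. F \<phi>)"
proof -
  have perm: "transpose a b permutes {..<n}" using assms by (intro permutes_swap_id) auto
  have mem: "\<phi> \<circ> transpose a b \<in> inj_tuples n n" if "\<phi> \<in> inj_tuples n n" for \<phi>
  proof -
    have "inj_on (\<phi> \<circ> transpose a b) {..<n}"
      using inj_tuples_inj[OF that] permutes_image[OF perm] permutes_inj_on[OF perm]
      by (intro comp_inj_on) auto
    then show ?thesis
      using that permutes_in_image[OF perm] permutes_not_in[OF perm]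
      by (auto simp: inj_tuples_def PiE_iff extensional_def)
  qed
  show ?thesis
    by (rule sum.reindex_bij_witness[of _ "\<lambda>\<phi>. \<phi> \<circ> transpose a b" "\<lambda>\<phi>. \<phi> \<circ> transpose a b"])
       (auto simp: mem fun_eq_iff)
qed

lemma msym_comp_transpose:
  assumes "a < n" "b < n"
  shows "msym n n (k \<circ> transpose a b) z = msym n n k z"
  using sum_inj_tuples_comp_transpose[OF assms, of "monom_at n k z"] assms
  by (simp add: msym_def monom_at_comp_transpose)

text \<open>The antisymmetrisation used for the Weyl density, now over the orderings of fixed
  points: exchanging slots 0 and \<open>b\<close> permutes the tuples and negates the
  quotient.\<close>

lemma msym_symmetrize:
  assumes inj: "inj_on z {..<n}" and nz: "\<And>i. i < n \<Longrightarrow> z i \<noteq> 0" and b: "0 < b" "b < n" and k: "k b \<le> k 0"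
  shows "(\<Sum>\<phi>\<in>inj_tuples n n. monom_at n k z \<phi> * ((z (\<phi> 0) + z (\<phi> b)) / (z (\<phi> 0) - z (\<phi> b)))) =
     (\<Sum>r<nat (k 0 - k b). (msym n n (shift_exponents k b r) z + msym n n (shift_exponents k b (Suc r)) z) / 2)"
proof -
  define q where "q = (\<lambda>\<phi> :: nat \<Rightarrow> nat. (z (\<phi> 0) + z (\<phi> b)) / (z (\<phi> 0) - z (\<phi> b)))"
  define S where "S = (\<Sum>\<phi>\<in>inj_tuples n n. monom_at n k z \<phi> * q \<phi>)"
  have q: "q (\<phi> \<circ> transpose 0 b) = - q \<phi>" if "\<phi> \<in> inj_tuples n n" for \<phi>
  proof -
    have "z (\<phi> 0) \<noteq> z (\<phi> b)"
      using inj_on_eq_iff[OF inj, of "\<phi> 0" "\<phi> b"] inj_on_eq_iff[OF inj_tuples_inj[OF that], of 0 b]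
        inj_tuples_less[OF that] b by auto
    then have "z (\<phi> 0) - z (\<phi> b) \<noteq> 0" "z (\<phi> b) - z (\<phi> 0) \<noteq> 0" by auto
    then show ?thesis unfolding q_def using b by (simp add: divide_simps) (simp add: algebra_simps)
  qed
  have "S = (\<Sum>\<phi>\<in>inj_tuples n n. monom_at n k z (\<phi> \<circ> transpose 0 b) * q (\<phi> \<circ> transpose 0 b))"
    unfolding S_def using b by (intro sum_inj_tuples_comp_transpose[symmetric]) auto
  also have "\<dots> = (\<Sum>\<phi>\<in>inj_tuples n n. - (monom_at n (k \<circ> transpose 0 b) z \<phi> * q \<phi>))"
    using b by (intro sum.cong refl) (simp add: q monom_at_comp_transpose)
  finally have "S + S = (\<Sum>\<phi>\<in>inj_tuples n n. (monom_at n k z \<phi> - monom_at n (k \<circ> transpose 0 b) z \<phi>) * q \<phi>)"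
    by (simp add: S_def[symmetric] left_diff_distrib sum_subtractf sum_negf)
  also have "\<dots> = (\<Sum>\<phi>\<in>inj_tuples n n. \<Sum>r<nat (k 0 - k b). monom_at n (shift_exponents k b r) z \<phi> + monom_at n (shift_exponents k b (Suc r)) z \<phi>)"
  proof (intro sum.cong refl)
    fix \<phi> assume *: "\<phi> \<in> inj_tuples n n"
    have "z (\<phi> 0) \<noteq> z (\<phi> b)"
      using inj_on_eq_iff[OF inj, of "\<phi> 0" "\<phi> b"] inj_on_eq_iff[OF inj_tuples_inj[OF *], of 0 b]
        inj_tuples_less[OF *] b by auto
    then show "(monom_at n k z \<phi> - monom_at n (k \<circ> transpose 0 b) z \<phi>) * q \<phi> =
      (\<Sum>r<nat (k 0 - k b). monom_at n (shift_exponents k b r) z \<phi> + monom_at n (shift_exponents k b (Suc r)) z \<phi>)"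
      unfolding q_def using b k nz inj_tuples_less[OF *] by (intro monom_at_swap_diff) auto
  qed
  also have "\<dots> = (\<Sum>r<nat (k 0 - k b). msym n n (shift_exponents k b r) z + msym n n (shift_exponents k b (Suc r)) z)"
    unfolding msym_def sum.distrib[symmetric] by (rule sum.swap)
  finally have e: "S + S = (\<Sum>r<nat (k 0 - k b). msym n n (shift_exponents k b r) z + msym n n (shift_exponents k b (Suc r)) z)" .
  have "S = (S + S) / 2" by simp
  also have "\<dots> = (\<Sum>r<nat (k 0 - k b). (msym n n (shift_exponents k b r) z + msym n n (shift_exponents k b (Suc r)) z) / 2)"
    unfolding e by (rule sum_divide_distrib)
  finally show ?thesis unfolding S_def q_def .
qed

section \<open>The eigenvalue moments solve the recursion\<close>

context loop_equations
begin

text \<open>Subtracting collisions slot by slot writes the sum as a polynomial in power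
  sums.\<close>

lemma observable_msym [intro]: "observable (msym n r k)"
proof (induction r arbitrary: k)
  case 0
  have "msym n 0 k = (\<lambda>_. 1)"
    by (simp add: msym_def inj_tuples_0 monom_at_def fun_eq_iff)
  then show ?case by (simp add: observable_const)
next
  case (Suc r)
  have "msym n (Suc r) k z = msym n r k z * psum n (k r) z - (\<Sum>a<r. msym n r (k(a := k a + k r)) z)"
    if "\<And>i. i < n \<Longrightarrow> z i \<noteq> 0" for z
    using sum_inj_tuples_mult_psum[of n z r "\<lambda>_. 1" "\<lambda>_. 1" k] that by (simp add: msym_def)
  moreover have "observable (\<lambda>z. msym n r k z * psum n (k r) z - (\<Sum>a<r. msym n r (k(a := k a + k r)) z))"
    by (intro observable_diff observable_mult observable_sum observable_psum Suc)
  ultimately show ?case by (subst observable_cong) auto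
qed

definition sym_moment :: "(nat \<Rightarrow> int) \<Rightarrow> complex" where
  "sym_moment k = (\<integral>\<omega>. msym n n k (Z \<omega>) \<partial>\<mu>)"

lemma seq_cont_monom_at: "\<phi> \<in> inj_tuples r n \<Longrightarrow> seq_cont (\<lambda>z. monom_at r k z \<phi>)"
  unfolding monom_at_def by (intro seq_cont_prod seq_cont_powi) (auto dest: inj_tuples_less)

lemma seq_cont_msym: "seq_cont (msym n r k)"
  unfolding msym_def[abs_def] by (intro seq_cont_sum seq_cont_monom_at)

lemma sum_slot_field:
  assumes n: "n = Suc r"
  shows "(\<Sum>i<n. slot_field r k i z * h i) = (\<Sum>\<phi>\<in>inj_tuples n n. monom_at n k z \<phi> * h (\<phi> 0))"
proof -
  have "(\<Sum>i<n. slot_field r k i z * h i) = (\<Sum>i<n. \<Sum>\<phi>\<in>inj_tuples n n. of_bool (\<phi> 0 = i) * monom_at n k z \<phi> * h i)"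
    unfolding slot_field_def n[symmetric] sum_distrib_right ..
  also have "\<dots> = (\<Sum>\<phi>\<in>inj_tuples n n. \<Sum>i<n. of_bool (\<phi> 0 = i) * monom_at n k z \<phi> * h i)"
    by (rule sum.swap)
  also have "\<dots> = (\<Sum>\<phi>\<in>inj_tuples n n. monom_at n k z \<phi> * h (\<phi> 0))"
  proof (intro sum.cong refl)
    fix \<phi> assume "\<phi> \<in> inj_tuples n n"
    then have "\<phi> 0 < n" by (rule inj_tuples_less) (simp add: n)
    then show "(\<Sum>i<n. of_bool (\<phi> 0 = i) * monom_at n k z \<phi> * h i) = monom_at n k z \<phi> * h (\<phi> 0)"
      unfolding mult.assoc by (rule sum_of_bool_mult)
  qed
  finally show ?thesis .
qed

text \<open>The slot field with all \<open>n\<close> slots has a divergence of integral 0. A full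
  tuple exhausts the points, so on distinct points this divergence is \<open>k 0\<close> times the
  symmetric sum plus the quotients between slot 0 and each other slot; symmetrising turns these
  quotients into the shifts of the recursion.\<close>

lemma sym_moment_recursion:
  assumes n: "n > 0" and k: "\<forall>b<n. k b \<le> k 0"
  shows "of_int (k 0) * sym_moment k + (\<Sum>b\<in>{1..<n}. \<Sum>r<nat (k 0 - k b).
           (sym_moment (shift_exponents k b r) + sym_moment (shift_exponents k b (Suc r))) / 2) = 0"
proof -
  obtain r where r: "n = Suc r" using n by (cases n) auto
  obtain d where d: "divergence (slot_field r k) (\<lambda>i z. of_int (k 0) * slot_field r k i z) d"
    using divergence_slot_field by blast
  define R where "R = (\<lambda>z. of_int (k 0) * msym n n k z + (\<Sum>b\<in>{1..<n}. \<Sum>r<nat (k 0 - k b).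
     (msym n n (shift_exponents k b r) z + msym n n (shift_exponents k b (Suc r)) z) * (1 / 2)))"
  \<comment> \<open>Testing against the empty product, whose derivatives are 0, leaves the integral
    of \<open>d\<close> alone.\<close>
  have int_d: "(\<integral>\<omega>. d (Z \<omega>) \<partial>\<mu>) = 0"
  proof -
    have "(\<integral>\<omega>. d (Z \<omega>) * psum_prod n [] (Z \<omega>) + (\<Sum>i<n. slot_field r k i (Z \<omega>) * psum_prod_deriv n i [] (Z \<omega>)) \<partial>\<mu>) = 0"
      using d unfolding divergence_def by blast
    then show ?thesis by simp
  qed
  have distinct: "d z = R z" if inj: "inj_on z {..<n}" and nz: "\<forall>i<n. z i \<noteq> 0" for z
  proof -
    define q where "q = (\<lambda>i j. (z i + z j) / (z i - z j))"
    have "d z = (\<Sum>i<n. of_int (k 0) * slot_field r k i z + (\<Sum>j\<in>{..<n} - {i}. slot_field r k i z * q i j))"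
      using d inj nz unfolding divergence_def q_def by blast
    also have "\<dots> = (\<Sum>i<n. slot_field r k i z * (of_int (k 0) + (\<Sum>j\<in>{..<n} - {i}. q i j)))"
      by (simp add: distrib_left sum_distrib_left mult.commute)
    also have "\<dots> = (\<Sum>\<phi>\<in>inj_tuples n n. monom_at n k z \<phi> * (of_int (k 0) + (\<Sum>j\<in>{..<n} - {\<phi> 0}. q (\<phi> 0) j)))"
      by (rule sum_slot_field[OF r])
    also have "\<dots> = (\<Sum>\<phi>\<in>inj_tuples n n. of_int (k 0) * monom_at n k z \<phi> + (\<Sum>b\<in>{1..<n}. monom_at n k z \<phi> * q (\<phi> 0) (\<phi> b)))"
    proof (intro sum.cong refl)
      fix \<phi> assume \<phi>: "\<phi> \<in> inj_tuples n n"
      have eq: "{..<n} - {\<phi> 0} = \<phi> ` {1..<n}"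
      proof -
        have "{..<n} - {\<phi> 0} = \<phi> ` {..<n} - \<phi> ` {0}" by (simp add: inj_tuples_full_image[OF \<phi>])
        also have "\<dots> = \<phi> ` ({..<n} - {0})"
          using n by (intro inj_on_image_set_diff[symmetric, OF inj_tuples_inj[OF \<phi>]]) auto
        also have "{..<n} - {0} = {1..<n}" by auto
        finally show ?thesis .
      qed
      have "inj_on \<phi> {1..<n}" by (rule inj_on_subset[OF inj_tuples_inj[OF \<phi>]]) auto
      then show "monom_at n k z \<phi> * (of_int (k 0) + (\<Sum>j\<in>{..<n} - {\<phi> 0}. q (\<phi> 0) j)) =
         of_int (k 0) * monom_at n k z \<phi> + (\<Sum>b\<in>{1..<n}. monom_at n k z \<phi> * q (\<phi> 0) (\<phi> b))"
        unfolding eq by (simp add: sum.reindex distrib_left sum_distrib_left mult.commute)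
    qed
    also have "\<dots> = of_int (k 0) * msym n n k z + (\<Sum>b\<in>{1..<n}. \<Sum>\<phi>\<in>inj_tuples n n. monom_at n k z \<phi> * q (\<phi> 0) (\<phi> b))"
      unfolding sum.distrib msym_def sum_distrib_left by (subst sum.swap) (rule refl)
    also have "\<dots> = R z"
      unfolding R_def q_def
      using msym_symmetrize[OF inj, of _ k] nz k
      by (intro arg_cong2[of _ _ _ _ "(+)"] refl sum.cong) simp
    finally show ?thesis .
  qed
  have sc: "seq_cont R"
    unfolding R_def
    by (intro seq_cont_add seq_cont_mult seq_cont_const seq_cont_sum seq_cont_msym)
  have unit_eq: "d z = R z" if z: "\<And>i. i < n \<Longrightarrow> norm (z i) = 1" for z
  proof -
    \<comment> \<open>Pushing point \<open>i\<close> out to radius \<open>1 + Suc i / Suc m\<close>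
      separates the points whatever coincidences \<open>z\<close> has, and the radii tend to 1. This
      takes the place of almost sure distinctness of the eigenvalues.\<close>
    define w where "w = (\<lambda>m i. z i * of_real (1 + real (Suc i) / real (Suc m)))"
    have norm_w: "norm (w m i) = 1 + real (Suc i) / real (Suc m)" if "i < n" for m i
      using z[OF that] unfolding w_def norm_mult norm_of_real by simp
    have "inj_on (w m) {..<n}" for m
    proof (rule inj_onI)
      fix i j assume "i \<in> {..<n}" "j \<in> {..<n}" "w m i = w m j"
      then have "1 + real (Suc i) / real (Suc m) = 1 + real (Suc j) / real (Suc m)"
        using norm_w by (metis lessThan_iff)
      then show "i = j" by simp
    qed
    moreover have wnz: "w m i \<noteq> 0" if "i < n" for m i
      using norm_w[OF that, of m] by (auto simp: add_pos_nonneg add_nonneg_eq_0_iff)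
    ultimately have eq: "d (w m) = R (w m)" for m by (intro distinct) auto
    have lim: "(\<lambda>m. w m i) \<longlonglongrightarrow> z i" for i
    proof -
      have "(\<lambda>m. real (Suc i) / real (Suc m)) \<longlonglongrightarrow> 0"
        using LIMSEQ_Suc[OF lim_const_over_n[of "real (Suc i)"]] by simp
      then have "(\<lambda>m. w m i) \<longlonglongrightarrow> z i * of_real (1 + 0)"
        unfolding w_def by (intro tendsto_intros)
      then show ?thesis by simp
    qed
    have znz: "\<forall>i<n. z i \<noteq> 0" using z by fastforce
    have conv: "(\<lambda>m. F (w m)) \<longlonglongrightarrow> F z" if "seq_cont F" for F
      by (rule that[unfolded seq_cont_def, rule_format]) (simp_all add: znz wnz lim)
    have "(\<lambda>m. R (w m)) \<longlonglongrightarrow> d z"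
      using conv[of d] d unfolding divergence_def eq by blast
    then show ?thesis using conv[OF sc] by (rule LIMSEQ_unique)
  qed
  have ob: "integrable \<mu> (\<lambda>\<omega>. msym n n l (Z \<omega>))" for l
    by (intro observable_integrable observable_msym)
  have R: "integrable \<mu> (\<lambda>\<omega>. of_int (k 0) * msym n n k (Z \<omega>))"
    "integrable \<mu> (\<lambda>\<omega>. (msym n n l (Z \<omega>) + msym n n l' (Z \<omega>)) * (1 / 2))" for l l'
    by (intro integrable_mult_right integrable_mult_left Bochner_Integration.integrable_add ob)+
  have "0 = (\<integral>\<omega>. R (Z \<omega>) \<partial>\<mu>)"
    unfolding int_d[symmetric] using unit unit_eq by (intro Bochner_Integration.integral_cong refl) simp
  also have "\<dots> = (\<integral>\<omega>. of_int (k 0) * msym n n k (Z \<omega>) \<partial>\<mu>) + (\<integral>\<omega>. (\<Sum>b\<in>{1..<n}. \<Sum>r<nat (k 0 - k b).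
     (msym n n (shift_exponents k b r) (Z \<omega>) + msym n n (shift_exponents k b (Suc r)) (Z \<omega>)) * (1 / 2)) \<partial>\<mu>)"
    unfolding R_def by (intro Bochner_Integration.integral_add Bochner_Integration.integrable_sum R)
  also have "(\<integral>\<omega>. (\<Sum>b\<in>{1..<n}. \<Sum>r<nat (k 0 - k b).
     (msym n n (shift_exponents k b r) (Z \<omega>) + msym n n (shift_exponents k b (Suc r)) (Z \<omega>)) * (1 / 2)) \<partial>\<mu>)
    = (\<Sum>b\<in>{1..<n}. \<integral>\<omega>. (\<Sum>r<nat (k 0 - k b).
     (msym n n (shift_exponents k b r) (Z \<omega>) + msym n n (shift_exponents k b (Suc r)) (Z \<omega>)) * (1 / 2)) \<partial>\<mu>)"
    by (intro Bochner_Integration.integral_sum Bochner_Integration.integrable_sum R)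
  also have "\<dots> = (\<Sum>b\<in>{1..<n}. \<Sum>r<nat (k 0 - k b). \<integral>\<omega>.
     (msym n n (shift_exponents k b r) (Z \<omega>) + msym n n (shift_exponents k b (Suc r)) (Z \<omega>)) * (1 / 2) \<partial>\<mu>)"
    by (intro sum.cong refl Bochner_Integration.integral_sum R)
  finally show ?thesis
    by (simp add: sym_moment_def Bochner_Integration.integral_add[OF ob ob])
qed

lemma weyl_recursion_sym_moment:
  assumes n: "n > 0" shows "weyl_recursion n sym_moment"
  unfolding weyl_recursion_def
proof (intro conjI allI impI)
  fix k k' :: "nat \<Rightarrow> int" assume "\<forall>i<n. k i = k' i"
  then show "sym_moment k = sym_moment k'" by (simp add: sym_moment_def msym_def monom_at_def)
next
  fix k :: "nat \<Rightarrow> int" and a b assume "a < n" "b < n"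
  then show "sym_moment (k \<circ> transpose a b) = sym_moment k"
    by (simp add: sym_moment_def msym_comp_transpose)
next
  fix k :: "nat \<Rightarrow> int"
  have "msym n n (\<lambda>i. - k i) (Z \<omega>) = cnj (msym n n k (Z \<omega>))" if "\<omega> \<in> space \<mu>" for \<omega>
    unfolding msym_def cnj_sum monom_at_def cnj_prod
    using that cnj_Z inj_tuples_less by (intro sum.cong prod.cong refl) (simp add: complex_cnj_power_int)
  then have "sym_moment (\<lambda>i. - k i) = (\<integral>\<omega>. cnj (msym n n k (Z \<omega>)) \<partial>\<mu>)"
    unfolding sym_moment_def by (intro Bochner_Integration.integral_cong) auto
  then show "sym_moment (\<lambda>i. - k i) = cnj (sym_moment k)"
    by (simp add: sym_moment_def)
next
  have "msym n n (\<lambda>_. 0) z = fact n" for z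
    using sum_inj_tuples_full[of 0 n "\<lambda>_. 1"] by (simp add: msym_def monom_at_def inj_tuples_0)
  then show "sym_moment (\<lambda>_. 0) = fact n" by (simp add: sym_moment_def prob_space)
next
  fix k :: "nat \<Rightarrow> int" assume "\<forall>b<n. k b \<le> k 0"
  then show "of_int (k 0) * sym_moment k + (\<Sum>b\<in>{1..<n}. \<Sum>r<nat (k 0 - k b).
           (sym_moment (shift_exponents k b r) + sym_moment (shift_exponents k b (Suc r))) / 2) = 0"
    by (rule sym_moment_recursion[OF n])
qed

theorem sym_moment_eq_weyl_moment: "n > 0 \<Longrightarrow> sym_moment k = weyl_moment n k"
  by (rule weyl_recursion_unique[OF _ weyl_recursion_sym_moment weyl_recursion_weyl_moment])

end

section \<open>First-order expansion along one-parameter subgroups\<close>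

definition unit_vector :: "nat \<Rightarrow> (nat \<Rightarrow> complex) \<Rightarrow> bool" where
  "unit_vector n v \<longleftrightarrow> (\<Sum>i<n. v i * cnj (v i)) = 1"

text \<open>For a unit vector \<open>v\<close> this is the exponential of \<open>i t\<close> times
  the orthogonal projection onto \<open>v\<close>: a one-parameter group of unitary matrices in
  closed form.\<close>

definition phase_rotation :: "nat \<Rightarrow> (nat \<Rightarrow> complex) \<Rightarrow> real \<Rightarrow> complex mat" where
  "phase_rotation n v t = Matrix.mat n n (\<lambda>(i, j). of_bool (i = j) + (cis t - 1) * v i * cnj (v j))"

lemma phase_rotation_unitary:
  assumes "unit_vector n v" shows "phase_rotation n v t \<in> unitary_group n"
  unfolding unitary_group_iff_cols
proof (intro conjI allI impI)
  fix i j assume ij: "i < n" "j < n"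
  define w where "w = cis t - 1"
  have w: "w + cnj w + w * cnj w = 0"
    by (simp add: w_def algebra_simps cis_cnj cis_mult)
  have "(\<Sum>s<n. cnj (phase_rotation n v t $$ (s, i)) * phase_rotation n v t $$ (s, j)) =
     (\<Sum>s<n. (of_bool (s = i) + cnj w * cnj (v s) * v i) * (of_bool (s = j) + w * v s * cnj (v j)))"
    using ij by (intro sum.cong refl) (simp add: phase_rotation_def w_def)
  also have "\<dots> = (\<Sum>s<n. of_bool (s = i) * of_bool (s = j)) + (\<Sum>s<n. of_bool (s = i) * (w * v s * cnj (v j)))
      + (\<Sum>s<n. of_bool (s = j) * (cnj w * cnj (v s) * v i)) + cnj w * w * v i * cnj (v j) * (\<Sum>s<n. v s * cnj (v s))"
    unfolding sum_distrib_left sum.distrib[symmetric] by (intro sum.cong refl) (simp add: algebra_simps)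
  also have "\<dots> = of_bool (i = j) + (w + cnj w + w * cnj w) * (v i * cnj (v j))"
    using assms unfolding unit_vector_def sum_of_bool_mult(1)[OF ij(1)] sum_of_bool_mult(1)[OF ij(2)]
    by (simp add: algebra_simps)
  finally show "(\<Sum>s<n. cnj (phase_rotation n v t $$ (s, i)) * phase_rotation n v t $$ (s, j)) = of_bool (i = j)"
    by (simp add: w)
qed (simp add: phase_rotation_def)

text \<open>\<open>c x y\<close> is the derivative of \<open>f\<close> along the right-invariant vector field of the elementary
  matrix with entry 1 at \<open>(x, y)\<close>.\<close>

definition smooth :: "nat \<Rightarrow> (complex mat \<Rightarrow> complex) \<Rightarrow> (nat \<Rightarrow> nat \<Rightarrow> complex mat \<Rightarrow> complex) \<Rightarrow> bool" where
  "smooth n f c \<longleftrightarrow> regular n f \<and> (\<forall>x<n. \<forall>y<n. regular n (c x y)) \<and>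
     (\<forall>v. unit_vector n v \<longrightarrow> (\<exists>K. \<forall>U\<in>unitary_group n. \<forall>t. \<bar>t\<bar> \<le> 1 \<longrightarrow>
        norm (f (phase_rotation n v t * U) - f U - \<i> * of_real t * (\<Sum>x<n. \<Sum>y<n. v x * cnj (v y) * c x y U)) \<le> K * t\<^sup>2))"

lemma smooth_const: "smooth n (\<lambda>_. a) (\<lambda>_ _ _. 0)"
  unfolding smooth_def by (auto simp: regular_const intro!: exI[of _ 0])

lemma norm_cis_expansion: "norm (cis t - 1 - \<i> * of_real t) \<le> t\<^sup>2"
proof -
  have "norm (cis t - (\<Sum>k\<le>1. (\<i> * of_real t) ^ k / fact k)) \<le> \<bar>t\<bar> ^ Suc 1 / fact (Suc 1)"
    using iexp_approx1[of t 1] by (simp add: cis_conv_exp)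
  then have "norm (cis t - 1 - \<i> * of_real t) \<le> t\<^sup>2 / 2"
    by (simp add: diff_diff_eq power2_eq_square numeral_2_eq_2[symmetric] flip: numeral_2_eq_2)
  then show ?thesis by (rule order_trans) simp
qed

text \<open>The rotation changes an entry by exactly \<open>(cis t - 1) * v i\<close> times a sum
  over column \<open>j\<close>, so the remainder is that of \<open>cis t\<close> at first
  order.\<close>

lemma smooth_entry:
  assumes "i < n" "j < n"
  shows "smooth n (\<lambda>U. U $$ (i, j)) (\<lambda>x y U. of_bool (x = i) * U $$ (y, j))"
  unfolding smooth_def
proof (intro conjI allI impI)
  fix v assume v: "unit_vector n v"
  define K where "K = norm (v i) * (\<Sum>s<n. norm (v s))"
  show "\<exists>K. \<forall>U\<in>unitary_group n. \<forall>t. \<bar>t\<bar> \<le> 1 \<longrightarrow>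
        norm ((phase_rotation n v t * U) $$ (i, j) - U $$ (i, j) - \<i> * of_real t * (\<Sum>x<n. \<Sum>y<n. v x * cnj (v y) * (of_bool (x = i) * U $$ (y, j)))) \<le> K * t\<^sup>2"
  proof (intro exI ballI allI impI)
    fix U and t :: real assume U: "U \<in> unitary_group n" and t: "\<bar>t\<bar> \<le> 1"
    define S where "S = (\<Sum>s<n. cnj (v s) * U $$ (s, j))"
    have car: "phase_rotation n v t \<in> carrier_mat n n" by (simp add: phase_rotation_def)
    have "(phase_rotation n v t * U) $$ (i, j) = (\<Sum>s<n. of_bool (i = s) * U $$ (s, j) + (cis t - 1) * v i * (cnj (v s) * U $$ (s, j)))"
      unfolding mult_index_sum[OF car unitary_groupD[OF U] assms]
      using assms by (intro sum.cong refl) (simp add: phase_rotation_def algebra_simps)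
    also have "\<dots> = U $$ (i, j) + (cis t - 1) * v i * S"
      unfolding sum.distrib S_def sum_distrib_left sum_of_bool_mult(2)[OF assms(1)] by simp
    finally have 1: "(phase_rotation n v t * U) $$ (i, j) = U $$ (i, j) + (cis t - 1) * v i * S" .
    have "(\<Sum>x<n. \<Sum>y<n. v x * cnj (v y) * (of_bool (x = i) * U $$ (y, j))) = (\<Sum>x<n. of_bool (x = i) * (v x * S))"
      unfolding S_def sum_distrib_left by (intro sum.cong refl) (simp add: mult_ac)
    also have "\<dots> = v i * S"
      by (rule sum_of_bool_mult(1)[OF assms(1)])
    finally have 2: "(\<Sum>x<n. \<Sum>y<n. v x * cnj (v y) * (of_bool (x = i) * U $$ (y, j))) = v i * S" .
    have "norm S \<le> (\<Sum>s<n. norm (v s))"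
      unfolding S_def using unitary_entry_le[OF U] assms
      by (intro sum_norm_le) (auto simp: norm_mult intro: mult_left_le)
    then have "norm (v i * S) \<le> K" unfolding K_def norm_mult by (intro mult_left_mono) auto
    then have "norm (cis t - 1 - \<i> * of_real t) * norm (v i * S) \<le> t\<^sup>2 * K"
      by (intro mult_mono norm_cis_expansion) auto
    moreover have "(phase_rotation n v t * U) $$ (i, j) - U $$ (i, j) - \<i> * of_real t * (v i * S)
       = (cis t - 1 - \<i> * of_real t) * (v i * S)"
      unfolding 1 by (simp add: algebra_simps)
    ultimately show "norm ((phase_rotation n v t * U) $$ (i, j) - U $$ (i, j) - \<i> * of_real t * (\<Sum>x<n. \<Sum>y<n. v x * cnj (v y) * (of_bool (x = i) * U $$ (y, j)))) \<le> K * t\<^sup>2"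
      unfolding 2 by (simp only: norm_mult mult.commute)
  qed
qed (use assms in \<open>auto intro!: regular_entry regular_mult regular_const\<close>)

lemma smooth_regular: "smooth n f c \<Longrightarrow> regular n f"
  by (simp add: smooth_def)

text \<open>The product rule with explicit remainders; boundedness of both functions and both
  derivatives makes the quadratic estimate uniform in \<open>U\<close>.\<close>

lemma smooth_mult:
  assumes f: "smooth n f c" and g: "smooth n g d"
  shows "smooth n (\<lambda>U. f U * g U) (\<lambda>x y U. f U * d x y U + c x y U * g U)"
  unfolding smooth_def
proof (intro conjI allI impI)
  fix v assume v: "unit_vector n v"
  define Df where "Df = (\<lambda>U. \<Sum>x<n. \<Sum>y<n. v x * cnj (v y) * c x y U)"
  define Dg where "Dg = (\<lambda>U. \<Sum>x<n. \<Sum>y<n. v x * cnj (v y) * d x y U)"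
  have reg: "regular n f" "regular n g" "regular n Df" "regular n Dg"
    using f g unfolding smooth_def Df_def Dg_def by (auto intro!: regular_sum regular_mult regular_const)
  obtain A where A: "\<And>U. U \<in> unitary_group n \<Longrightarrow> norm (f U) \<le> A" using reg(1) unfolding regular_def by blast
  obtain B where B: "\<And>U. U \<in> unitary_group n \<Longrightarrow> norm (g U) \<le> B" using reg(2) unfolding regular_def by blast
  obtain C where C: "\<And>U. U \<in> unitary_group n \<Longrightarrow> norm (Df U) \<le> C" using reg(3) unfolding regular_def by blast
  obtain D where D: "\<And>U. U \<in> unitary_group n \<Longrightarrow> norm (Dg U) \<le> D" using reg(4) unfolding regular_def by blast
  obtain K where K: "\<And>U t. U \<in> unitary_group n \<Longrightarrow> \<bar>t\<bar> \<le> 1 \<Longrightarrow> norm (f (phase_rotation n v t * U) - f U - \<i> * of_real t * Df U) \<le> K * t\<^sup>2"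
    using f v unfolding smooth_def Df_def by blast
  obtain L where L: "\<And>U t. U \<in> unitary_group n \<Longrightarrow> \<bar>t\<bar> \<le> 1 \<Longrightarrow> norm (g (phase_rotation n v t * U) - g U - \<i> * of_real t * Dg U) \<le> L * t\<^sup>2"
    using g v unfolding smooth_def Dg_def by blast
  show "\<exists>K. \<forall>U\<in>unitary_group n. \<forall>t. \<bar>t\<bar> \<le> 1 \<longrightarrow>
      norm (f (phase_rotation n v t * U) * g (phase_rotation n v t * U) - f U * g U -
        \<i> * of_real t * (\<Sum>x<n. \<Sum>y<n. v x * cnj (v y) * (f U * d x y U + c x y U * g U))) \<le> K * t\<^sup>2"
  proof (intro exI ballI allI impI)
    fix U and t :: real assume U: "U \<in> unitary_group n" and t: "\<bar>t\<bar> \<le> 1"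
    define V where "V = phase_rotation n v t * U"
    have V: "V \<in> unitary_group n" unfolding V_def by (intro unitary_group_mult phase_rotation_unitary v U)
    define r where "r = f V - f U - \<i> * of_real t * Df U"
    define s where "s = g V - g U - \<i> * of_real t * Dg U"
    have r: "norm r \<le> K * t\<^sup>2" and s: "norm s \<le> L * t\<^sup>2"
      unfolding r_def s_def V_def using K[OF U t] L[OF U t] by auto
    have sum: "(\<Sum>x<n. \<Sum>y<n. v x * cnj (v y) * (f U * d x y U + c x y U * g U)) = f U * Dg U + Df U * g U"
      unfolding Df_def Dg_def sum_distrib_left sum_distrib_right sum.distrib[symmetric]
      by (intro sum.cong refl) (simp add: algebra_simps)
    have fV: "f V = f U + \<i> * of_real t * Df U + r" and gV: "g V = g U + \<i> * of_real t * Dg U + s"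
      by (simp_all add: r_def s_def)
    have ii: "(\<i> * of_real t * Df U) * (\<i> * of_real t * Dg U) = - (of_real (t\<^sup>2) * (Df U * Dg U))"
      by (simp add: power2_eq_square algebra_simps)
    have "f V * g V - f U * g U - \<i> * of_real t * (f U * Dg U + Df U * g U) =
        r * g V + (f U + \<i> * of_real t * Df U) * s + (\<i> * of_real t * Df U) * (\<i> * of_real t * Dg U)"
      unfolding fV gV by (simp add: algebra_simps)
    also have "\<dots> = r * g V + (f U + \<i> * of_real t * Df U) * s - of_real (t\<^sup>2) * (Df U * Dg U)"
      unfolding ii by simp
    also have "norm \<dots> \<le> norm (r * g V) + norm ((f U + \<i> * of_real t * Df U) * s) + norm (of_real (t\<^sup>2) * (Df U * Dg U))"
      by (intro norm_triangle_le_diff add_mono norm_triangle_ineq order_refl)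
    also have "norm (r * g V) \<le> (K * t\<^sup>2) * B"
      unfolding norm_mult by (intro mult_mono r B V order_trans[OF norm_ge_zero r] norm_ge_zero)
    also have "norm ((f U + \<i> * of_real t * Df U) * s) \<le> (A + C) * (L * t\<^sup>2)"
    proof -
      have "norm (\<i> * of_real t * Df U) \<le> norm (Df U)"
        using t by (simp add: norm_mult mult_left_le_one_le)
      then have "norm (f U + \<i> * of_real t * Df U) \<le> A + C"
        using A[OF U] C[OF U] by (intro norm_triangle_le) linarith
      then show ?thesis unfolding norm_mult
        by (intro mult_mono s order_trans[OF norm_ge_zero \<open>norm (f U + _) \<le> A + C\<close>] norm_ge_zero)
    qed
    also have "norm (of_real (t\<^sup>2) * (Df U * Dg U)) \<le> t\<^sup>2 * (C * D)"
      unfolding norm_mult norm_of_real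
      using mult_mono[OF C[OF U] D[OF U] order_trans[OF norm_ge_zero C[OF U]] norm_ge_zero]
      by (simp add: mult_left_mono)
    finally show "norm (f (phase_rotation n v t * U) * g (phase_rotation n v t * U) - f U * g U -
        \<i> * of_real t * (\<Sum>x<n. \<Sum>y<n. v x * cnj (v y) * (f U * d x y U + c x y U * g U))) \<le> (K * B + (A + C) * L + C * D) * t\<^sup>2"
      unfolding sum V_def[symmetric] by (simp add: algebra_simps)
  qed
qed (use f g in \<open>auto simp: smooth_def intro!: regular_mult regular_add\<close>)

lemma smooth_add:
  assumes f: "smooth n f c" and g: "smooth n g d"
  shows "smooth n (\<lambda>U. f U + g U) (\<lambda>x y U. c x y U + d x y U)"
  unfolding smooth_def
proof (intro conjI allI impI)
  fix v assume v: "unit_vector n v"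
  define Df where "Df = (\<lambda>U. \<Sum>x<n. \<Sum>y<n. v x * cnj (v y) * c x y U)"
  define Dg where "Dg = (\<lambda>U. \<Sum>x<n. \<Sum>y<n. v x * cnj (v y) * d x y U)"
  obtain K where K: "\<And>U t. U \<in> unitary_group n \<Longrightarrow> \<bar>t\<bar> \<le> 1 \<Longrightarrow> norm (f (phase_rotation n v t * U) - f U - \<i> * of_real t * Df U) \<le> K * t\<^sup>2"
    using f v unfolding smooth_def Df_def by blast
  obtain L where L: "\<And>U t. U \<in> unitary_group n \<Longrightarrow> \<bar>t\<bar> \<le> 1 \<Longrightarrow> norm (g (phase_rotation n v t * U) - g U - \<i> * of_real t * Dg U) \<le> L * t\<^sup>2"
    using g v unfolding smooth_def Dg_def by blast
  show "\<exists>K. \<forall>U\<in>unitary_group n. \<forall>t. \<bar>t\<bar> \<le> 1 \<longrightarrow>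
      norm (f (phase_rotation n v t * U) + g (phase_rotation n v t * U) - (f U + g U) -
        \<i> * of_real t * (\<Sum>x<n. \<Sum>y<n. v x * cnj (v y) * (c x y U + d x y U))) \<le> K * t\<^sup>2"
  proof (intro exI ballI allI impI)
    fix U and t :: real assume U: "U \<in> unitary_group n" and t: "\<bar>t\<bar> \<le> 1"
    have sum: "(\<Sum>x<n. \<Sum>y<n. v x * cnj (v y) * (c x y U + d x y U)) = Df U + Dg U"
      unfolding Df_def Dg_def sum.distrib[symmetric] by (intro sum.cong refl) (simp add: algebra_simps)
    have "f (phase_rotation n v t * U) + g (phase_rotation n v t * U) - (f U + g U) - \<i> * of_real t * (Df U + Dg U)
      = (f (phase_rotation n v t * U) - f U - \<i> * of_real t * Df U) + (g (phase_rotation n v t * U) - g U - \<i> * of_real t * Dg U)"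
      by (simp add: algebra_simps)
    also have "norm \<dots> \<le> K * t\<^sup>2 + L * t\<^sup>2"
      by (intro norm_triangle_mono K L U t)
    finally show "norm (f (phase_rotation n v t * U) + g (phase_rotation n v t * U) - (f U + g U) -
        \<i> * of_real t * (\<Sum>x<n. \<Sum>y<n. v x * cnj (v y) * (c x y U + d x y U))) \<le> (K + L) * t\<^sup>2"
      unfolding sum by (simp add: distrib_right)
  qed
qed (use f g in \<open>auto simp: smooth_def intro!: regular_add\<close>)

lemma smooth_sum:
  assumes "finite A" "\<And>a. a \<in> A \<Longrightarrow> smooth n (f a) (c a)"
  shows "smooth n (\<lambda>U. \<Sum>a\<in>A. f a U) (\<lambda>x y U. \<Sum>a\<in>A. c a x y U)"
  using assms
proof (induction A)
  case empty
  then show ?case using smooth_const[of n 0] by simp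
next
  case (insert a A)
  have "smooth n (\<lambda>U. f a U + (\<Sum>a\<in>A. f a U)) (\<lambda>x y U. c a x y U + (\<Sum>a\<in>A. c a x y U))"
    using insert by (intro smooth_add) auto
  then show ?case using insert.hyps by simp
qed

text \<open>Conjugation changes the sign of \<open>\<i>\<close> and exchanges the roles of
  \<open>x\<close> and \<open>y\<close> in \<open>v x * cnj (v y)\<close>, hence the minus sign and
  the transposed index.\<close>

lemma smooth_cnj:
  assumes f: "smooth n f c"
  shows "smooth n (\<lambda>U. cnj (f U)) (\<lambda>x y U. - cnj (c y x U))"
  unfolding smooth_def
proof (intro conjI allI impI)
  fix v assume v: "unit_vector n v"
  obtain K where K: "\<And>U t. U \<in> unitary_group n \<Longrightarrow> \<bar>t\<bar> \<le> 1 \<Longrightarrow>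
     norm (f (phase_rotation n v t * U) - f U - \<i> * of_real t * (\<Sum>x<n. \<Sum>y<n. v x * cnj (v y) * c x y U)) \<le> K * t\<^sup>2"
    using f v unfolding smooth_def by blast
  show "\<exists>K. \<forall>U\<in>unitary_group n. \<forall>t. \<bar>t\<bar> \<le> 1 \<longrightarrow> norm (cnj (f (phase_rotation n v t * U)) - cnj (f U) -
        \<i> * of_real t * (\<Sum>x<n. \<Sum>y<n. v x * cnj (v y) * - cnj (c y x U))) \<le> K * t\<^sup>2"
  proof (intro exI ballI allI impI)
    fix U and t :: real assume U: "U \<in> unitary_group n" and t: "\<bar>t\<bar> \<le> 1"
    have "(\<Sum>x<n. \<Sum>y<n. v x * cnj (v y) * - cnj (c y x U)) = (\<Sum>y<n. \<Sum>x<n. v x * cnj (v y) * - cnj (c y x U))"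
      by (rule sum.swap)
    also have "\<dots> = - cnj (\<Sum>x<n. \<Sum>y<n. v x * cnj (v y) * c x y U)"
      by (simp add: sum_negf mult_ac)
    finally have "cnj (f (phase_rotation n v t * U)) - cnj (f U) - \<i> * of_real t * (\<Sum>x<n. \<Sum>y<n. v x * cnj (v y) * - cnj (c y x U))
      = cnj (f (phase_rotation n v t * U) - f U - \<i> * of_real t * (\<Sum>x<n. \<Sum>y<n. v x * cnj (v y) * c x y U))"
      by simp
    then show "norm (cnj (f (phase_rotation n v t * U)) - cnj (f U) -
        \<i> * of_real t * (\<Sum>x<n. \<Sum>y<n. v x * cnj (v y) * - cnj (c y x U))) \<le> K * t\<^sup>2"
      using K[OF U t] by (simp only: complex_mod_cnj)
  qed
next
  show "regular n (\<lambda>U. cnj (f U))" using f by (simp add: smooth_def regular_cnj)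
next
  fix x y assume "x < n" "y < n"
  then have "regular n (\<lambda>U. (-1) * cnj (c y x U))"
    using f by (intro regular_mult regular_const regular_cnj) (simp add: smooth_def)
  then show "regular n (\<lambda>U. - cnj (c y x U))" by simp
qed

lemma smooth_cong:
  assumes "smooth n f c" "\<And>U. U \<in> unitary_group n \<Longrightarrow> f U = g U"
    "\<And>U x y. U \<in> unitary_group n \<Longrightarrow> x < n \<Longrightarrow> y < n \<Longrightarrow> c x y U = d x y U"
  shows "smooth n g d"
  unfolding smooth_def
proof (intro conjI allI impI)
  show "regular n g" using assms regular_cong[of n f g] by (simp add: smooth_def)
next
  fix x y assume "x < n" "y < n"
  then show "regular n (d x y)" using assms regular_cong[of n "c x y" "d x y"] by (simp add: smooth_def)
next
  fix v assume v: "unit_vector n v"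
  then obtain K where K: "\<And>U t. U \<in> unitary_group n \<Longrightarrow> \<bar>t\<bar> \<le> 1 \<Longrightarrow>
     norm (f (phase_rotation n v t * U) - f U - \<i> * of_real t * (\<Sum>x<n. \<Sum>y<n. v x * cnj (v y) * c x y U)) \<le> K * t\<^sup>2"
    using assms(1) unfolding smooth_def by blast
  show "\<exists>K. \<forall>U\<in>unitary_group n. \<forall>t. \<bar>t\<bar> \<le> 1 \<longrightarrow> norm (g (phase_rotation n v t * U) - g U -
        \<i> * of_real t * (\<Sum>x<n. \<Sum>y<n. v x * cnj (v y) * d x y U)) \<le> K * t\<^sup>2"
  proof (intro exI ballI allI impI)
    fix U and t :: real assume U: "U \<in> unitary_group n" and t: "\<bar>t\<bar> \<le> 1"
    have "phase_rotation n v t * U \<in> unitary_group n" by (intro unitary_group_mult phase_rotation_unitary v U)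
    moreover have "(\<Sum>x<n. \<Sum>y<n. v x * cnj (v y) * d x y U) = (\<Sum>x<n. \<Sum>y<n. v x * cnj (v y) * c x y U)"
      using assms(3)[OF U] by (intro sum.cong refl) auto
    ultimately show "norm (g (phase_rotation n v t * U) - g U - \<i> * of_real t * (\<Sum>x<n. \<Sum>y<n. v x * cnj (v y) * d x y U)) \<le> K * t\<^sup>2"
      using K[OF U t] assms(2) U by simp
  qed
qed

text \<open>By invariance the derivative of a smooth function along every one-parameter subgroup integrates
  to zero; rank-one projections span all matrices.\<close>

lemma haar_integral_deriv_eq_0:
  assumes h: "haar_unitary n \<mu>" and f: "smooth n f c" and pq: "p < n" "q < n"
  shows "(\<integral>U. c p q U \<partial>\<mu>) = 0"
proof -
  interpret prob_space \<mu> using h by (simp add: haar_unitary_def)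
  have space: "space \<mu> = unitary_group n"
    using h sets_eq_imp_space_eq[of \<mu> "unitary_borel n"] by (simp add: haar_unitary_def)
  have int_c: "integrable \<mu> (c x y)" if "x < n" "y < n" for x y
    using f that by (intro regular_integrable[OF h]) (simp add: smooth_def)
  define e where "e = (\<lambda>x y. \<integral>U. c x y U \<partial>\<mu>)"
  have quad: "(\<Sum>x<n. \<Sum>y<n. v x * cnj (v y) * e x y) = 0" if v: "unit_vector n v" for v
  proof -
    define D where "D = (\<lambda>U. \<Sum>x<n. \<Sum>y<n. v x * cnj (v y) * c x y U)"
    obtain K where K: "\<And>U t. U \<in> unitary_group n \<Longrightarrow> \<bar>t\<bar> \<le> 1 \<Longrightarrow> norm (f (phase_rotation n v t * U) - f U - \<i> * of_real t * D U) \<le> K * t\<^sup>2"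
      using f v unfolding smooth_def D_def by blast
    have int_D: "integrable \<mu> D"
      unfolding D_def by (intro Bochner_Integration.integrable_sum integrable_mult_right int_c) auto
    have int_f: "integrable \<mu> f" using f by (intro regular_integrable[OF h]) (simp add: smooth_def)
    \<comment> \<open>By invariance \<open>f\<close> and its translate have the same integral, so
      \<open>t\<close> times the integral of \<open>D\<close> is bounded by a remainder quadratic in
      \<open>t\<close>. Dividing by \<open>t\<close> leaves a bound that vanishes as
      \<open>t\<close> tends to 0.\<close>
    have bound: "norm (\<integral>U. D U \<partial>\<mu>) \<le> K * t" if t: "0 < t" "t \<le> 1" for t
    proof -
      let ?V = "phase_rotation n v t"
      have V: "?V \<in> unitary_group n" by (intro phase_rotation_unitary v)
      have "(\<integral>U. f (?V * U) \<partial>\<mu>) = (\<integral>U. f U \<partial>\<mu>)"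
        using f by (intro haar_integral_translate[OF h _ V]) (simp add: smooth_def)
      moreover have int_Vf: "integrable \<mu> (\<lambda>U. f (?V * U))"
      proof -
        have "distr \<mu> \<mu> ((*) ?V) = \<mu>" by (rule haar_unitary_translate[OF h V])
        then have "integrable (distr \<mu> \<mu> ((*) ?V)) f" using int_f by simp
        moreover have "(*) ?V \<in> measurable \<mu> \<mu>"
          using h V haar_translate_measurable by blast
        ultimately show ?thesis using int_f by (subst (asm) integrable_distr_eq) auto
      qed
      ultimately have "(\<integral>U. f (?V * U) - f U - \<i> * of_real t * D U \<partial>\<mu>) = - (\<i> * of_real t * (\<integral>U. D U \<partial>\<mu>))"
        using int_f int_D by (simp add: Bochner_Integration.integral_diff)
      moreover have "norm (\<integral>U. f (?V * U) - f U - \<i> * of_real t * D U \<partial>\<mu>) \<le> (\<integral>U. K * t\<^sup>2 \<partial>\<mu>)"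
      proof (rule order_trans[OF Bochner_Integration.integral_norm_bound integral_mono])
        show "integrable \<mu> (\<lambda>U. norm (f (?V * U) - f U - \<i> * of_real t * D U))"
          using int_f int_D int_Vf by (intro integrable_norm Bochner_Integration.integrable_diff integrable_mult_right)
        show "norm (f (?V * U) - f U - \<i> * of_real t * D U) \<le> K * t\<^sup>2" if "U \<in> space \<mu>" for U
          using K[of U t] that t space by simp
      qed simp
      ultimately have "t * norm (\<integral>U. D U \<partial>\<mu>) \<le> K * t\<^sup>2"
        using t by (simp add: norm_mult prob_space)
      then show ?thesis using t by (simp add: power2_eq_square)
    qed
    have "norm (\<integral>U. D U \<partial>\<mu>) \<le> 0"
    proof (rule tendsto_lowerbound)
      show "((\<lambda>t. K * t) \<longlongrightarrow> 0) (at_right 0)" by (auto intro!: tendsto_eq_intros)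
      show "\<forall>\<^sub>F t in at_right 0. norm (\<integral>U. D U \<partial>\<mu>) \<le> K * t"
        unfolding eventually_at_right_field using bound by (intro exI[of _ 1]) auto
    qed simp
    moreover have "(\<integral>U. D U \<partial>\<mu>) = (\<Sum>x<n. \<Sum>y<n. v x * cnj (v y) * e x y)"
      unfolding D_def e_def by (rule integral_double_sum) (rule int_c)
    ultimately show ?thesis by simp
  qed
  have diag: "e x x = 0" if "x < n" for x
  proof -
    define v where "v = (\<lambda>i. of_bool (i = x) :: complex)"
    have "unit_vector n v"
      using sum_of_bool_mult(1)[OF that, of "\<lambda>_. 1"] by (simp add: unit_vector_def v_def flip: of_bool_conj)
    then have "(\<Sum>i<n. \<Sum>j<n. v i * cnj (v j) * e i j) = 0" by (rule quad)
    moreover have "(\<Sum>i<n. \<Sum>j<n. v i * cnj (v j) * e i j) = (\<Sum>i<n. of_bool (i = x) * (\<Sum>j<n. of_bool (j = x) * e i j))"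
      unfolding v_def sum_distrib_left by (intro sum.cong refl) (auto simp: of_bool_def)
    ultimately show ?thesis by (simp only: sum_of_bool_mult(1)[OF that])
  qed
  show ?thesis
  proof (cases "p = q")
    case True
    then show ?thesis using diag[OF pq(1)] by (simp add: e_def)
  next
    case False
    have two: "cnj w * e p q + w * e q p = 0" if w: "w * cnj w = 1" for w
    proof -
      \<comment> \<open>Polarisation: the vector \<open>(e_p + w e_q) / sqrt 2\<close> isolates the
        two off-diagonal coefficients, the diagonal ones being known to vanish. The choices
        \<open>w = 1\<close> and \<open>w = \<i>\<close> give two independent equations.\<close>
      define v where "v = (\<lambda>i. (of_bool (i = p) + w * of_bool (i = q)) / of_real (sqrt 2))"
      have s2: "complex_of_real (sqrt 2) * complex_of_real (sqrt 2) = 2"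
        by (simp flip: of_real_mult)
      have sum_v: "(\<Sum>i<n. v i * g i) = (g p + w * g q) / of_real (sqrt 2)" for g
      proof -
        have "(\<Sum>i<n. v i * g i) = (\<Sum>i<n. of_bool (i = p) * (g i / of_real (sqrt 2))) + (\<Sum>i<n. of_bool (i = q) * (w * g i / of_real (sqrt 2)))"
          unfolding sum.distrib[symmetric] by (intro sum.cong refl) (simp add: v_def add_divide_distrib distrib_right)
        then show ?thesis by (simp only: sum_of_bool_mult(1)[OF pq(1)] sum_of_bool_mult(1)[OF pq(2)] add_divide_distrib)
      qed
      have sum_cv: "(\<Sum>i<n. cnj (v i) * g i) = (g p + cnj w * g q) / of_real (sqrt 2)" for g
      proof -
        have "(\<Sum>i<n. cnj (v i) * g i) = (\<Sum>i<n. of_bool (i = p) * (g i / of_real (sqrt 2))) + (\<Sum>i<n. of_bool (i = q) * (cnj w * g i / of_real (sqrt 2)))"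
          unfolding sum.distrib[symmetric] by (intro sum.cong refl) (simp add: v_def add_divide_distrib distrib_right)
        then show ?thesis by (simp only: sum_of_bool_mult(1)[OF pq(1)] sum_of_bool_mult(1)[OF pq(2)] add_divide_distrib)
      qed
      have "unit_vector n v"
        unfolding unit_vector_def sum_v using False s2 w by (simp add: v_def field_simps)
      then have "0 = (\<Sum>x<n. v x * (\<Sum>y<n. cnj (v y) * e x y))"
        using quad by (simp add: sum_distrib_left mult.assoc)
      also have "\<dots> = (e p p + cnj w * e p q + w * (e q p + cnj w * e q q)) / 2"
        unfolding sum_cv sum_v using s2 by (simp add: field_simps)
      finally show ?thesis using diag pq by simp
    qed
    have "e p q + e q p = 0" using two[of 1] by simp
    moreover have "- e p q + e q p = 0"
    proof -
      have "\<i> * (- e p q + e q p) = 0" using two[of \<i>] by (simp add: algebra_simps)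
      then show ?thesis by simp
    qed
    ultimately have "2 * e p q = 0" by (simp add: algebra_simps add_eq_0_iff)
    then show ?thesis by (simp add: e_def)
  qed
qed

section \<open>Derivatives of powers and traces, and the loop equations for matrices\<close>

lemma pow_mat_add:
  fixes A :: "'a :: semiring_1 mat"
  assumes "A \<in> carrier_mat n n"
  shows "A ^\<^sub>m (a + b) = A ^\<^sub>m a * A ^\<^sub>m b"
proof (induction b)
  case 0
  then show ?case using assms by simp
next
  case (Suc b)
  then show ?case using assms by (simp add: assoc_mult_mat[of _ n n _ n _ n])
qed

text \<open>Left multiplication inserts the elementary matrix in front of each of the
  \<open>k\<close> factors in turn, leaving the power \<open>l\<close> before it and the power
  \<open>k - l\<close> after it.\<close>

lemma smooth_pow_entry:
  assumes "i < n" "j < n"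
  shows "smooth n (\<lambda>U. (U ^\<^sub>m k) $$ (i, j)) (\<lambda>x y U. \<Sum>l<k. (U ^\<^sub>m l) $$ (i, x) * (U ^\<^sub>m (k - l)) $$ (y, j))"
  using assms
proof (induction k arbitrary: j)
  case 0
  show ?case
    by (rule smooth_cong[OF smooth_const[of n "of_bool (i = j)"]]) (use 0 in \<open>auto dest!: unitary_groupD\<close>)
next
  case (Suc k)
  let ?c = "\<lambda>s x y U. (U ^\<^sub>m k) $$ (i, s) * (of_bool (x = s) * U $$ (y, j))
     + (\<Sum>l<k. (U ^\<^sub>m l) $$ (i, x) * (U ^\<^sub>m (k - l)) $$ (y, s)) * U $$ (s, j)"
  have "smooth n (\<lambda>U. \<Sum>s<n. (U ^\<^sub>m k) $$ (i, s) * U $$ (s, j)) (\<lambda>x y U. \<Sum>s<n. ?c s x y U)"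
    using Suc by (intro smooth_sum smooth_mult smooth_entry) auto
  then show ?case
  proof (rule smooth_cong, goal_cases)
    case (1 U)
    then have "U \<in> carrier_mat n n" by (rule unitary_groupD)
    then show ?case using Suc.prems by (simp add: mult_index_sum[OF pow_carrier_mat] del: index_mult_mat)
  next
    case (2 U x y)
    then have U: "U \<in> carrier_mat n n" by (intro unitary_groupD)
    have "(\<Sum>s<n. ?c s x y U) = (\<Sum>s<n. of_bool (x = s) * ((U ^\<^sub>m k) $$ (i, s) * U $$ (y, j)))
       + (\<Sum>s<n. \<Sum>l<k. (U ^\<^sub>m l) $$ (i, x) * ((U ^\<^sub>m (k - l)) $$ (y, s) * U $$ (s, j)))"
      unfolding sum.distrib sum_distrib_right
      by (intro arg_cong2[of _ _ _ _ "(+)"] sum.cong refl) (simp_all add: mult_ac)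
    also have "(\<Sum>s<n. of_bool (x = s) * ((U ^\<^sub>m k) $$ (i, s) * U $$ (y, j))) = (U ^\<^sub>m k) $$ (i, x) * U $$ (y, j)"
      using 2 by (intro sum_of_bool_mult)
    also have "(\<Sum>s<n. \<Sum>l<k. (U ^\<^sub>m l) $$ (i, x) * ((U ^\<^sub>m (k - l)) $$ (y, s) * U $$ (s, j)))
       = (\<Sum>l<k. \<Sum>s<n. (U ^\<^sub>m l) $$ (i, x) * ((U ^\<^sub>m (k - l)) $$ (y, s) * U $$ (s, j)))"
      by (rule sum.swap)
    also have "\<dots> = (\<Sum>l<k. (U ^\<^sub>m l) $$ (i, x) * (U ^\<^sub>m (Suc k - l)) $$ (y, j))"
    proof (intro sum.cong refl)
      fix l assume "l \<in> {..<k}"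
      then have "U ^\<^sub>m (Suc k - l) = U ^\<^sub>m (k - l) * U" by (simp add: Suc_diff_le)
      then show "(\<Sum>s<n. (U ^\<^sub>m l) $$ (i, x) * ((U ^\<^sub>m (k - l)) $$ (y, s) * U $$ (s, j))) = (U ^\<^sub>m l) $$ (i, x) * (U ^\<^sub>m (Suc k - l)) $$ (y, j)"
        using U 2 Suc.prems
        by (simp add: mult_index_sum[OF pow_carrier_mat[OF U] U] sum_distrib_left del: index_mult_mat pow_mat.simps)
    qed
    finally show ?case using U by (simp add: add.commute)
  qed
qed

definition mtrace :: "nat \<Rightarrow> complex mat \<Rightarrow> complex" where
  "mtrace n A = (\<Sum>i<n. A $$ (i, i))"

text \<open>For unitary \<open>U\<close> the trace of an inverse power is the conjugate of the trace
  of the power; the definition uses this and stays within nonnegative powers.\<close>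

definition powtrace :: "nat \<Rightarrow> int \<Rightarrow> complex mat \<Rightarrow> complex" where
  "powtrace n l U = (if l \<ge> 0 then mtrace n (U ^\<^sub>m nat l) else cnj (mtrace n (U ^\<^sub>m nat (- l))))"

text \<open>For negative \<open>l\<close> this is an entry of the inverse power, since \<open>U\<close> is unitary.\<close>

definition powentry :: "int \<Rightarrow> nat \<Rightarrow> nat \<Rightarrow> complex mat \<Rightarrow> complex" where
  "powentry l y x U = (if l \<ge> 0 then (U ^\<^sub>m nat l) $$ (y, x) else cnj ((U ^\<^sub>m nat (- l)) $$ (x, y)))"

text \<open>By cyclicity of the trace the \<open>k\<close> terms of the product rule all give the
  same entry.\<close>

lemma smooth_mtrace:
  "smooth n (\<lambda>U. mtrace n (U ^\<^sub>m k)) (\<lambda>x y U. of_nat k * (U ^\<^sub>m k) $$ (y, x))"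
proof -
  have "smooth n (\<lambda>U. \<Sum>i<n. (U ^\<^sub>m k) $$ (i, i)) (\<lambda>x y U. \<Sum>i<n. \<Sum>l<k. (U ^\<^sub>m l) $$ (i, x) * (U ^\<^sub>m (k - l)) $$ (y, i))"
    by (intro smooth_sum smooth_pow_entry) auto
  then show ?thesis
  proof (rule smooth_cong, goal_cases)
    case (2 U x y)
    then have U: "U \<in> carrier_mat n n" by (intro unitary_groupD)
    have "(\<Sum>i<n. \<Sum>l<k. (U ^\<^sub>m l) $$ (i, x) * (U ^\<^sub>m (k - l)) $$ (y, i)) = (\<Sum>l<k. \<Sum>i<n. (U ^\<^sub>m l) $$ (i, x) * (U ^\<^sub>m (k - l)) $$ (y, i))"
      by (rule sum.swap)
    also have "\<dots> = (\<Sum>l<k. (U ^\<^sub>m k) $$ (y, x))"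
    proof (intro sum.cong refl)
      fix l assume "l \<in> {..<k}"
      then have "U ^\<^sub>m k = U ^\<^sub>m (k - l) * U ^\<^sub>m l" using pow_mat_add[OF U, of "k - l" l] by simp
      then show "(\<Sum>i<n. (U ^\<^sub>m l) $$ (i, x) * (U ^\<^sub>m (k - l)) $$ (y, i)) = (U ^\<^sub>m k) $$ (y, x)"
        using 2 by (simp add: mult_index_sum[OF pow_carrier_mat[OF U] pow_carrier_mat[OF U]] mult.commute del: index_mult_mat)
    qed
    finally show ?case by simp
  qed (simp add: mtrace_def)
qed

lemma smooth_powtrace: "smooth n (powtrace n l) (\<lambda>x y U. of_int l * powentry l y x U)"
proof (cases "l \<ge> 0")
  case True
  then show ?thesis using smooth_mtrace[of n "nat l"] by (simp add: powtrace_def[abs_def] powentry_def)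
next
  case False
  then show ?thesis using smooth_cnj[OF smooth_mtrace[of n "nat (- l)"]] by (simp add: powtrace_def[abs_def] powentry_def)
qed

definition powtrace_prod :: "nat \<Rightarrow> int list \<Rightarrow> complex mat \<Rightarrow> complex" where
  "powtrace_prod n ls U = (\<Prod>l\<leftarrow>ls. powtrace n l U)"

fun powtrace_prod_deriv :: "nat \<Rightarrow> int list \<Rightarrow> nat \<Rightarrow> nat \<Rightarrow> complex mat \<Rightarrow> complex" where
  "powtrace_prod_deriv n [] x y U = 0"
| "powtrace_prod_deriv n (l # ls) x y U =
     powtrace n l U * powtrace_prod_deriv n ls x y U + of_int l * powentry l y x U * powtrace_prod n ls U"

lemma smooth_powtrace_prod: "smooth n (powtrace_prod n ls) (powtrace_prod_deriv n ls)"
proof (induction ls)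
  case Nil
  have "smooth n (\<lambda>_. 1) (\<lambda>_ _ _. 0)" by (rule smooth_const)
  then show ?case by (rule smooth_cong) (auto simp: powtrace_prod_def)
next
  case (Cons l ls)
  show ?case
    by (rule smooth_cong[OF smooth_mult[OF smooth_powtrace[of n l] Cons]]) (auto simp: powtrace_prod_def)
qed

text \<open>What remains of the derivative of a product of traces after contraction with the entries
  of the \<open>k\<close>-th power: the differentiated trace changes its exponent from
  \<open>l\<close> to \<open>k + l\<close>.\<close>

fun loop_sum :: "nat \<Rightarrow> nat \<Rightarrow> int list \<Rightarrow> complex mat \<Rightarrow> complex" where
  "loop_sum n k [] U = 0"
| "loop_sum n k (l # ls) U = of_int l * powtrace n (int k + l) U * powtrace_prod n ls U + powtrace n l U * loop_sum n k ls U"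

text \<open>The double sum is the trace of a product of two powers. For negative \<open>l\<close>
  the orthonormality of the rows of a power of \<open>U\<close> cancels the smaller of the two
  powers.\<close>

lemma sum_powentry:
  assumes U: "U \<in> unitary_group n"
  shows "(\<Sum>p<n. \<Sum>q<n. (U ^\<^sub>m k) $$ (p, q) * powentry l q p U) = powtrace n (int k + l) U"
proof -
  have Uc: "U \<in> carrier_mat n n" using U by (rule unitary_groupD)
  have unit: "(\<Sum>q<n. (U ^\<^sub>m m) $$ (s, q) * cnj ((U ^\<^sub>m m) $$ (p, q))) = of_bool (s = p)" if "s < n" "p < n" for m s p
    using unitary_rows[OF unitary_group_pow[OF U] that] .
  have orth: "(\<Sum>p<n. \<Sum>q<n. (U ^\<^sub>m (a + m)) $$ (p, q) * cnj ((U ^\<^sub>m m) $$ (p, q))) = mtrace n (U ^\<^sub>m a)" for a m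
  proof -
    have "(\<Sum>q<n. (U ^\<^sub>m (a + m)) $$ (p, q) * cnj ((U ^\<^sub>m m) $$ (p, q))) = (U ^\<^sub>m a) $$ (p, p)" if p: "p < n" for p
    proof -
      have "(\<Sum>q<n. (U ^\<^sub>m (a + m)) $$ (p, q) * cnj ((U ^\<^sub>m m) $$ (p, q))) =
        (\<Sum>q<n. \<Sum>s<n. (U ^\<^sub>m a) $$ (p, s) * ((U ^\<^sub>m m) $$ (s, q) * cnj ((U ^\<^sub>m m) $$ (p, q))))"
        unfolding pow_mat_add[OF Uc]
        by (intro sum.cong refl) (simp add: mult_index_sum[OF pow_carrier_mat[OF Uc] pow_carrier_mat[OF Uc]] p sum_distrib_right mult.assoc del: index_mult_mat)
      also have "\<dots> = (\<Sum>s<n. \<Sum>q<n. (U ^\<^sub>m a) $$ (p, s) * ((U ^\<^sub>m m) $$ (s, q) * cnj ((U ^\<^sub>m m) $$ (p, q))))"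
        by (rule sum.swap)
      also have "\<dots> = (\<Sum>s<n. (U ^\<^sub>m a) $$ (p, s) * of_bool (s = p))"
        unfolding sum_distrib_left[symmetric] using p by (intro sum.cong refl) (simp add: unit)
      also have "\<dots> = (U ^\<^sub>m a) $$ (p, p)"
        using p by (rule sum_of_bool_mult)
      finally show ?thesis .
    qed
    then show ?thesis by (simp add: mtrace_def)
  qed
  consider "l \<ge> 0" | "l < 0" "k \<ge> nat (- l)" | "l < 0" "k < nat (- l)" by linarith
  then show ?thesis
  proof cases
    case 1
    then have "nat (int k + l) = k + nat l" by simp
    moreover have "(\<Sum>q<n. (U ^\<^sub>m k) $$ (p, q) * (U ^\<^sub>m nat l) $$ (q, p)) = (U ^\<^sub>m (k + nat l)) $$ (p, p)" if "p < n" for p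
      unfolding pow_mat_add[OF Uc] mult_index_sum[OF pow_carrier_mat[OF Uc] pow_carrier_mat[OF Uc] that that] ..
    ultimately show ?thesis using 1 by (simp add: powentry_def powtrace_def mtrace_def)
  next
    case 2
    define a where "a = k - nat (- l)"
    have k: "k = a + nat (- l)" and a: "nat (int k + l) = a" "int k + l \<ge> 0" using 2 by (auto simp: a_def)
    show ?thesis using orth[of a "nat (- l)"] 2 a by (simp add: powentry_def powtrace_def flip: k)
  next
    case 3
    define a where "a = nat (- l) - k"
    have k: "nat (- l) = a + k" and a: "nat (- (int k + l)) = a" "\<not> int k + l \<ge> 0" using 3 by (auto simp: a_def)
    have "(\<Sum>p<n. \<Sum>q<n. (U ^\<^sub>m k) $$ (p, q) * cnj ((U ^\<^sub>m (a + k)) $$ (p, q))) = cnj (mtrace n (U ^\<^sub>m a))"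
      unfolding orth[of a k, symmetric] by (simp add: mult.commute)
    then show ?thesis using 3 a k by (simp add: powentry_def powtrace_def)
  qed
qed

text \<open>The entry \<open>(p, q)\<close> of the \<open>k\<close>-th power times the product of
  traces, differentiated in direction \<open>(p, q)\<close>, integrates to 0. Summing over
  \<open>p\<close> and \<open>q\<close> splits the differentiated entry into products of two traces
  and contracts the remaining terms to \<open>loop_sum\<close>.\<close>

lemma haar_loop:
  assumes h: "haar_unitary n \<mu>"
  shows "(\<integral>U. (\<Sum>l<k. powtrace n (int l) U * powtrace n (int k - int l) U) * powtrace_prod n ls U + loop_sum n k ls U \<partial>\<mu>) = 0"
proof -
  have space: "space \<mu> = unitary_group n"
    using h sets_eq_imp_space_eq[of \<mu> "unitary_borel n"] by (simp add: haar_unitary_def)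
  define c where "c = (\<lambda>p q U. (U ^\<^sub>m k) $$ (p, q) * powtrace_prod_deriv n ls p q U
     + (\<Sum>l<k. (U ^\<^sub>m l) $$ (p, p) * (U ^\<^sub>m (k - l)) $$ (q, q)) * powtrace_prod n ls U)"
  have zero: "(\<integral>U. c p q U \<partial>\<mu>) = 0" and int: "integrable \<mu> (c p q)" if pq: "p < n" "q < n" for p q
  proof -
    have s: "smooth n (\<lambda>U. (U ^\<^sub>m k) $$ (p, q) * powtrace_prod n ls U)
       (\<lambda>x y U. (U ^\<^sub>m k) $$ (p, q) * powtrace_prod_deriv n ls x y U
         + (\<Sum>l<k. (U ^\<^sub>m l) $$ (p, x) * (U ^\<^sub>m (k - l)) $$ (y, q)) * powtrace_prod n ls U)"
      using pq by (intro smooth_mult smooth_pow_entry smooth_powtrace_prod)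
    show "(\<integral>U. c p q U \<partial>\<mu>) = 0"
      using haar_integral_deriv_eq_0[OF h s pq] by (simp add: c_def)
    have "regular n (c p q)" using s pq unfolding smooth_def c_def by blast
    then show "integrable \<mu> (c p q)" by (rule regular_integrable[OF h])
  qed
  have deriv: "(\<Sum>p<n. \<Sum>q<n. (U ^\<^sub>m k) $$ (p, q) * powtrace_prod_deriv n ls p q U) = loop_sum n k ls U"
    if "U \<in> unitary_group n" for U
  proof (induction ls)
    case (Cons l ls)
    have "(\<Sum>p<n. \<Sum>q<n. (U ^\<^sub>m k) $$ (p, q) * powtrace_prod_deriv n (l # ls) p q U) =
      powtrace n l U * (\<Sum>p<n. \<Sum>q<n. (U ^\<^sub>m k) $$ (p, q) * powtrace_prod_deriv n ls p q U)
      + of_int l * (\<Sum>p<n. \<Sum>q<n. (U ^\<^sub>m k) $$ (p, q) * powentry l q p U) * powtrace_prod n ls U"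
      unfolding sum_distrib_left sum_distrib_right sum.distrib[symmetric]
      by (intro sum.cong refl) (simp add: algebra_simps)
    then show ?case unfolding Cons sum_powentry[OF that] by simp
  qed simp
  have "(\<Sum>p<n. \<Sum>q<n. c p q U) = (\<Sum>l<k. powtrace n (int l) U * powtrace n (int k - int l) U) * powtrace_prod n ls U + loop_sum n k ls U"
    if U: "U \<in> unitary_group n" for U
  proof -
    have "(\<Sum>p<n. \<Sum>q<n. \<Sum>l<k. (U ^\<^sub>m l) $$ (p, p) * (U ^\<^sub>m (k - l)) $$ (q, q)) =
      (\<Sum>p<n. \<Sum>l<k. \<Sum>q<n. (U ^\<^sub>m l) $$ (p, p) * (U ^\<^sub>m (k - l)) $$ (q, q))"
      by (intro sum.cong refl sum.swap)
    also have "\<dots> = (\<Sum>l<k. \<Sum>p<n. \<Sum>q<n. (U ^\<^sub>m l) $$ (p, p) * (U ^\<^sub>m (k - l)) $$ (q, q))"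
      by (rule sum.swap)
    also have "\<dots> = (\<Sum>l<k. powtrace n (int l) U * powtrace n (int k - int l) U)"
    proof (intro sum.cong refl)
      fix l assume "l \<in> {..<k}"
      then have "powtrace n (int k - int l) U = mtrace n (U ^\<^sub>m (k - l))"
        by (simp add: powtrace_def nat_diff_distrib)
      then show "(\<Sum>p<n. \<Sum>q<n. (U ^\<^sub>m l) $$ (p, p) * (U ^\<^sub>m (k - l)) $$ (q, q)) = powtrace n (int l) U * powtrace n (int k - int l) U"
        by (simp add: powtrace_def mtrace_def sum_product)
    qed
    finally have e: "(\<Sum>p<n. \<Sum>q<n. \<Sum>l<k. (U ^\<^sub>m l) $$ (p, p) * (U ^\<^sub>m (k - l)) $$ (q, q))
      = (\<Sum>l<k. powtrace n (int l) U * powtrace n (int k - int l) U)" .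
    have "(\<Sum>l<k. powtrace n (int l) U * powtrace n (int k - int l) U) * powtrace_prod n ls U =
       (\<Sum>p<n. \<Sum>q<n. (\<Sum>l<k. (U ^\<^sub>m l) $$ (p, p) * (U ^\<^sub>m (k - l)) $$ (q, q)) * powtrace_prod n ls U)"
      unfolding e[symmetric] sum_distrib_right ..
    then show ?thesis unfolding c_def sum.distrib deriv[OF U] by (simp add: add.commute)
  qed
  then have "(\<integral>U. (\<Sum>l<k. powtrace n (int l) U * powtrace n (int k - int l) U) * powtrace_prod n ls U + loop_sum n k ls U \<partial>\<mu>)
     = (\<integral>U. (\<Sum>p<n. \<Sum>q<n. c p q U) \<partial>\<mu>)"
    using space by (intro Bochner_Integration.integral_cong) auto
  also have "\<dots> = 0" using integral_double_sum[of n \<mu> c "\<lambda>_ _. 1"] zero int by simp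
  finally show ?thesis .
qed

section \<open>The eigenvalues of a Haar distributed unitary matrix\<close>

lemma mtrace_mult_commute:
  assumes "A \<in> carrier_mat n n" "B \<in> carrier_mat n n"
  shows "mtrace n (A * B) = mtrace n (B * A)"
proof -
  have "mtrace n (A * B) = (\<Sum>i<n. \<Sum>s<n. A $$ (i, s) * B $$ (s, i))"
    unfolding mtrace_def by (intro sum.cong refl mult_index_sum[OF assms]) auto
  also have "\<dots> = (\<Sum>s<n. \<Sum>i<n. A $$ (i, s) * B $$ (s, i))" by (rule sum.swap)
  also have "\<dots> = (\<Sum>s<n. \<Sum>i<n. B $$ (s, i) * A $$ (i, s))" by (simp add: mult.commute)
  also have "\<dots> = mtrace n (B * A)"
    unfolding mtrace_def by (intro sum.cong refl mult_index_sum[OF assms(2,1), symmetric]) auto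
  finally show ?thesis .
qed

lemma upper_triangular_pow:
  fixes B :: "complex mat"
  assumes B: "B \<in> carrier_mat n n" "upper_triangular B"
  shows "(\<forall>i<n. \<forall>j<i. (B ^\<^sub>m k) $$ (i, j) = 0) \<and> (\<forall>i<n. (B ^\<^sub>m k) $$ (i, i) = (B $$ (i, i)) ^ k)"
proof (induction k)
  case 0
  then show ?case using B by auto
next
  case (Suc k)
  have zero: "B $$ (s, j) = 0" if "j < s" "s < n" for s j using upper_triangularD[OF B(2) that(1)] that B by simp
  have trm: "(B ^\<^sub>m k) $$ (i, s) * B $$ (s, j) = (if s = i \<and> i = j then (B $$ (i, i)) ^ Suc k else 0)"
    if ij: "i < n" "j \<le> i" "s < n" for i j s
  proof -
    consider "s < i" | "s > i" | "s = i" "j < i" | "s = i" "j = i" using ij by linarith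
    then show ?thesis
    proof cases
      case 1 then show ?thesis using Suc ij by auto
    next
      case 2 then show ?thesis using zero[of j s] ij by auto
    next
      case 3 then show ?thesis using zero[of j s] ij by auto
    next
      case 4 then show ?thesis using Suc ij by (simp add: mult.commute)
    qed
  qed
  have "(B ^\<^sub>m Suc k) $$ (i, j) = (if i = j then (B $$ (i, i)) ^ Suc k else 0)" if "i < n" "j \<le> i" for i j
  proof -
    have "(B ^\<^sub>m Suc k) $$ (i, j) = (\<Sum>s<n. (B ^\<^sub>m k) $$ (i, s) * B $$ (s, j))"
      using that mult_index_sum[OF pow_carrier_mat[OF B(1)] B(1), of i j k] by simp
    also have "\<dots> = (\<Sum>s<n. if s = i then (if i = j then (B $$ (i, i)) ^ Suc k else 0) else 0)"
      using that by (intro sum.cong refl) (auto simp: trm)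
    finally show ?thesis using that by simp
  qed
  then show ?case by auto
qed

text \<open>Schur triangularisation: the trace is invariant under similarity, and the diagonal of a
  power of a triangular matrix consists of the powers of its diagonal.\<close>

lemma mtrace_pow:
  assumes A: "A \<in> carrier_mat n n" and as: "char_poly A = (\<Prod>a\<leftarrow>as. [:- a, 1:])" "length as = n"
  shows "mtrace n (A ^\<^sub>m k) = (\<Sum>i<n. (as ! i) ^ k)"
proof -
  obtain B P Q where schur: "schur_decomposition A as = (B, P, Q)" by (cases "schur_decomposition A as")
  from schur_decomposition[OF A as(1) schur]
  have sim: "similar_mat_wit A B P Q" and ut: "upper_triangular B" and diag: "diag_mat B = as" by auto
  from similar_mat_witD2[OF A sim] have carr: "B \<in> carrier_mat n n" "P \<in> carrier_mat n n" "Q \<in> carrier_mat n n"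
    and QP: "Q * P = 1\<^sub>m n" by auto
  have pow: "A ^\<^sub>m k = P * B ^\<^sub>m k * Q" by (rule similar_mat_wit_pow_id[OF sim])
  have Bk: "B ^\<^sub>m k \<in> carrier_mat n n" using carr by simp
  have "mtrace n (A ^\<^sub>m k) = mtrace n (Q * (P * B ^\<^sub>m k))"
    unfolding pow using carr Bk by (intro mtrace_mult_commute) auto
  also have "Q * (P * B ^\<^sub>m k) = Q * P * B ^\<^sub>m k"
    using assoc_mult_mat[OF carr(3) carr(2) Bk] by simp
  also have "\<dots> = B ^\<^sub>m k" unfolding QP by (rule left_mult_one_mat[OF Bk])
  also have "mtrace n (B ^\<^sub>m k) = (\<Sum>i<n. (as ! i) ^ k)"
    unfolding mtrace_def using upper_triangular_pow[OF carr(1) ut, of k] carr(1) diag[symmetric]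
    by (intro sum.cong refl) (auto simp: diag_mat_def)
  finally show ?thesis .
qed

text \<open>Some list of the roots of the characteristic polynomial with multiplicity; its order is
  arbitrary and carries no measurability in \<open>A\<close>.\<close>

definition eigs :: "complex mat \<Rightarrow> complex list" where
  "eigs A = (SOME as. char_poly A = (\<Prod>a\<leftarrow>as. [:- a, 1:]) \<and> length as = dim_row A)"

lemma eigs:
  assumes "A \<in> carrier_mat n n"
  shows "char_poly A = (\<Prod>a\<leftarrow>eigs A. [:- a, 1:])" "length (eigs A) = n"
proof -
  have "\<exists>as. char_poly A = (\<Prod>a\<leftarrow>as. [:- a, 1:]) \<and> length as = dim_row A"
    using char_poly_factorized[OF assms] assms by auto
  from someI_ex[OF this] have "char_poly A = (\<Prod>a\<leftarrow>eigs A. [:- a, 1:]) \<and> length (eigs A) = dim_row A"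
    unfolding eigs_def .
  then show "char_poly A = (\<Prod>a\<leftarrow>eigs A. [:- a, 1:])" "length (eigs A) = n" using assms by auto
qed

lemma poly_prod_list_linear: "poly (\<Prod>a\<leftarrow>as. [:- a, 1:]) (x :: complex) = 0 \<longleftrightarrow> x \<in> set as"
  by (induction as) auto

lemma eigenvalue_iff_eigs: "A \<in> carrier_mat n n \<Longrightarrow> eigenvalue A e \<longleftrightarrow> e \<in> set (eigs A)"
  using eigenvalue_root_char_poly[of A n e] eigs(1)[of A n] poly_prod_list_linear[of "eigs A" e] by simp

lemma order_prod_list_linear: "Polynomial.order e (\<Prod>a\<leftarrow>as. [:- a, 1:]) = count_list as (e :: complex)"
proof (induction as)
  case (Cons a as)
  have nz: "(\<Prod>a\<leftarrow>as. [:- a, 1:]) \<noteq> (0 :: complex poly)"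
    by (induction as) (auto simp del: mult_pCons_left)
  have "Polynomial.order e [:- a, 1:] = of_bool (a = e)"
    using order_power_n_n[of e 1] by (cases "a = e") (auto intro!: order_0I)
  moreover have "[:- a, 1:] * (\<Prod>a\<leftarrow>as. [:- a, 1:]) \<noteq> 0" using nz by (simp del: mult_pCons_left)
  ultimately show ?case
    using Cons order_mult[of "[:- a, 1:]" "\<Prod>a\<leftarrow>as. [:- a, 1:]" e] by (simp del: mult_pCons_left)
qed simp

lemma eigenvalue_count_eq:
  assumes A: "A \<in> carrier_mat n n"
  shows "eigenvalue_count A S = (\<Sum>i<n. of_bool (eigs A ! i \<in> S))"
proof -
  have "eigenvalue_count A S = (\<Sum>e | e \<in> set (eigs A) \<and> e \<in> S. count_list (eigs A) e)"
    unfolding eigenvalue_count_def eigs(1)[OF A] order_prod_list_linear eigenvalue_iff_eigs[OF A] ..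
  also have "\<dots> = (\<Sum>a\<leftarrow>eigs A. of_bool (a \<in> S))"
  proof -
    have "(\<Sum>e | e \<in> set as \<and> e \<in> S. count_list as e) = (\<Sum>a\<leftarrow>as. of_bool (a \<in> S))" for as :: "complex list"
    proof -
      have "(\<Sum>a\<leftarrow>as. of_bool (a \<in> S)) = (\<Sum>e\<in>set as. count_list as e * of_bool (e \<in> S))"
        by (rule sum_list_map_eq_sum_count)
      also have "\<dots> = (\<Sum>e\<in>set as. if e \<in> S then count_list as e else 0)"
        by (intro sum.cong) auto
      also have "\<dots> = (\<Sum>e | e \<in> set as \<and> e \<in> S. count_list as e)"
        by (simp add: sum.inter_filter)
      finally show ?thesis by simp
    qed
    then show ?thesis .
  qed
  also have "\<dots> = (\<Sum>i<n. of_bool (eigs A ! i \<in> S))"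
    using eigs(2)[OF A] by (simp add: sum_list_sum_nth lessThan_atLeast0)
  finally show ?thesis .
qed

text \<open>A unitary matrix preserves the norm of an eigenvector, and the eigenvector is not
  0.\<close>

lemma norm_eigs_unitary:
  assumes U: "U \<in> unitary_group n" and i: "i < n"
  shows "norm (eigs U ! i) = 1"
proof -
  have Uc: "U \<in> carrier_mat n n" using U by (rule unitary_groupD)
  define a where "a = eigs U ! i"
  have "eigenvalue U a" unfolding a_def eigenvalue_iff_eigs[OF Uc] using eigs(2)[OF Uc] i by simp
  then obtain v where v: "v \<in> carrier_vec n" "v \<noteq> 0\<^sub>v n" "U *\<^sub>v v = a \<cdot>\<^sub>v v"
    unfolding eigenvalue_def eigenvector_def using Uc by auto
  have entry: "(\<Sum>s<n. U $$ (r, s) * v $ s) = a * v $ r" if "r < n" for r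
  proof -
    have "(U *\<^sub>v v) $ r = (\<Sum>s<n. U $$ (r, s) * v $ s)"
      using Uc v(1) that by (auto simp: scalar_prod_def lessThan_atLeast0)
    then show ?thesis using v that by simp
  qed
  have "(\<Sum>r<n. cnj (a * v $ r) * (a * v $ r)) = (\<Sum>r<n. \<Sum>s<n. \<Sum>t<n. (cnj (v $ s) * v $ t) * (cnj (U $$ (r, s)) * U $$ (r, t)))"
  proof (intro sum.cong refl)
    fix r assume "r \<in> {..<n}"
    then have e: "a * v $ r = (\<Sum>s<n. U $$ (r, s) * v $ s)" using entry by simp
    show "cnj (a * v $ r) * (a * v $ r) = (\<Sum>s<n. \<Sum>t<n. (cnj (v $ s) * v $ t) * (cnj (U $$ (r, s)) * U $$ (r, t)))"
      unfolding e cnj_sum sum_product by (intro sum.cong refl) (simp add: mult_ac)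
  qed
  also have "\<dots> = (\<Sum>s<n. \<Sum>r<n. \<Sum>t<n. (cnj (v $ s) * v $ t) * (cnj (U $$ (r, s)) * U $$ (r, t)))"
    by (rule sum.swap)
  also have "\<dots> = (\<Sum>s<n. \<Sum>t<n. \<Sum>r<n. (cnj (v $ s) * v $ t) * (cnj (U $$ (r, s)) * U $$ (r, t)))"
    by (intro sum.cong refl sum.swap)
  also have "\<dots> = (\<Sum>s<n. \<Sum>t<n. (cnj (v $ s) * v $ t) * of_bool (s = t))"
    unfolding sum_distrib_left[symmetric] using U by (intro sum.cong refl) (simp add: unitary_group_iff_cols)
  also have "\<dots> = (\<Sum>s<n. cnj (v $ s) * v $ s)"
    by (intro sum.cong refl) simp
  finally have *: "(cnj a * a) * (\<Sum>r<n. cnj (v $ r) * v $ r) = (\<Sum>r<n. cnj (v $ r) * v $ r)"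
    by (simp add: sum_distrib_left mult_ac)
  have "(\<Sum>r<n. cnj (v $ r) * v $ r) = of_real (\<Sum>r<n. (norm (v $ r))\<^sup>2)"
    unfolding of_real_sum complex_norm_square by (simp add: mult.commute)
  moreover have "(\<Sum>r<n. (norm (v $ r))\<^sup>2) \<noteq> 0"
  proof
    assume "(\<Sum>r<n. (norm (v $ r))\<^sup>2) = 0"
    then have "\<forall>r<n. v $ r = 0" by (subst (asm) sum_nonneg_eq_0_iff) auto
    then have "v = 0\<^sub>v n" using v(1) by (intro eq_vecI) auto
    then show False using v(2) by simp
  qed
  ultimately have "(\<Sum>r<n. cnj (v $ r) * v $ r) \<noteq> 0" by (simp only: of_real_eq_0_iff not_False_eq_True)
  then have "cnj a * a = 1" using * unfolding mult_cancel_right2 by blast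
  then have "complex_of_real ((norm a)\<^sup>2) = of_real 1"
    unfolding complex_norm_square by (simp add: mult.commute)
  then have "(norm a)\<^sup>2 = 1" by (simp only: of_real_eq_iff)
  then have "norm a = 1 \<or> norm a = - 1" by (simp only: power2_eq_1_iff)
  then show ?thesis using norm_ge_zero[of a] unfolding a_def by linarith
qed

lemma psum_eigs:
  assumes U: "U \<in> unitary_group n"
  shows "psum n l (\<lambda>i. eigs U ! i) = powtrace n l U"
proof (cases "l \<ge> 0")
  case True
  then show ?thesis
    using mtrace_pow[OF unitary_groupD[OF U] eigs[OF unitary_groupD[OF U]], of "nat l"]
    by (simp add: psum_def powtrace_def power_int_def)
next
  case False
  have "eigs U ! i powi l = cnj ((eigs U ! i) ^ nat (- l))" if "i < n" for i
    using cnj_powi_unit[OF norm_eigs_unitary[OF U that], of "- l"] False by (simp add: power_int_def)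
  then show ?thesis
    using False mtrace_pow[OF unitary_groupD[OF U] eigs[OF unitary_groupD[OF U]], of "nat (- l)"]
    by (simp add: psum_def powtrace_def)
qed

text \<open>Power sums of the eigenvalues are traces of powers, so the identities for traces become
  the loop equations for the eigenvalues.\<close>

lemma haar_loop_equations:
  assumes h: "haar_unitary n \<mu>"
  shows "loop_equations \<mu> n (\<lambda>U i. eigs U ! i)"
proof -
  interpret prob_space \<mu> using h by (simp add: haar_unitary_def)
  have sets: "sets \<mu> = sets (unitary_borel n)" using h by (simp add: haar_unitary_def)
  have space: "space \<mu> = unitary_group n" using sets_eq_imp_space_eq[OF sets] by simp
  have prod: "psum_prod n ls (\<lambda>i. eigs U ! i) = powtrace_prod n ls U" if "U \<in> unitary_group n" for U ls
    using that by (induction ls) (auto simp: powtrace_prod_def psum_eigs)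
  have deriv: "(\<Sum>i<n. (eigs U ! i) powi (int k) * psum_prod_deriv n i ls (\<lambda>i. eigs U ! i)) = loop_sum n k ls U"
    if U: "U \<in> unitary_group n" for U k ls
  proof (induction ls)
    case (Cons l ls)
    have nz: "eigs U ! i \<noteq> 0" if "i < n" for i using norm_eigs_unitary[OF U that] by auto
    have "(\<Sum>i<n. (eigs U ! i) powi (int k) * psum_prod_deriv n i (l # ls) (\<lambda>i. eigs U ! i)) =
      of_int l * (\<Sum>i<n. (eigs U ! i) powi (int k + l)) * psum_prod n ls (\<lambda>i. eigs U ! i)
      + psum n l (\<lambda>i. eigs U ! i) * (\<Sum>i<n. (eigs U ! i) powi (int k) * psum_prod_deriv n i ls (\<lambda>i. eigs U ! i))"
      unfolding sum_distrib_left sum_distrib_right sum.distrib[symmetric]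
      using nz by (intro sum.cong refl) (simp add: power_int_add algebra_simps)
    also have "(\<Sum>i<n. (eigs U ! i) powi (int k + l)) = powtrace n (int k + l) U"
      using psum_eigs[OF U, of "int k + l"] by (simp add: psum_def)
    finally show ?case unfolding Cons prod[OF U] psum_eigs[OF U] by simp
  qed simp
  show ?thesis
  proof
    fix U i assume "U \<in> space \<mu>" "i < n"
    then show "norm (eigs U ! i) = 1" using norm_eigs_unitary space by simp
  next
    fix l
    have "powtrace n l \<in> borel_measurable \<mu>"
      using smooth_regular[OF smooth_powtrace[of n l]] unfolding regular_def measurable_cong_sets[OF sets refl] by blast
    then show "(\<lambda>U. psum n l (\<lambda>i. eigs U ! i)) \<in> borel_measurable \<mu>"
      by (subst measurable_cong[of _ _ "powtrace n l"]) (auto simp: space psum_eigs)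
  next
    fix k :: int and ls assume k: "k \<ge> 0"
    have "(\<integral>U. split_psum n k (\<lambda>i. eigs U ! i) * psum_prod n ls (\<lambda>i. eigs U ! i)
        + (\<Sum>i<n. (eigs U ! i) powi k * psum_prod_deriv n i ls (\<lambda>i. eigs U ! i)) \<partial>\<mu>)
      = (\<integral>U. (\<Sum>l<nat k. powtrace n (int l) U * powtrace n (int (nat k) - int l) U) * powtrace_prod n ls U + loop_sum n (nat k) ls U \<partial>\<mu>)"
    proof (rule Bochner_Integration.integral_cong[OF refl])
      fix U assume "U \<in> space \<mu>"
      then have U: "U \<in> unitary_group n" using space by simp
      show "split_psum n k (\<lambda>i. eigs U ! i) * psum_prod n ls (\<lambda>i. eigs U ! i)
        + (\<Sum>i<n. (eigs U ! i) powi k * psum_prod_deriv n i ls (\<lambda>i. eigs U ! i))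
        = (\<Sum>l<nat k. powtrace n (int l) U * powtrace n (int (nat k) - int l) U) * powtrace_prod n ls U + loop_sum n (nat k) ls U"
        using k deriv[OF U, of "nat k" ls] by (simp add: split_psum_def psum_eigs[OF U] prod[OF U])
    qed
    also have "\<dots> = 0" by (rule haar_loop[OF h])
    finally show "(\<integral>U. split_psum n k (\<lambda>i. eigs U ! i) * psum_prod n ls (\<lambda>i. eigs U ! i)
        + (\<Sum>i<n. (eigs U ! i) powi k * psum_prod_deriv n i ls (\<lambda>i. eigs U ! i)) \<partial>\<mu>) = 0" .
  qed
qed

section \<open>Moments of products over distinct points\<close>

lemma sum_permutes_inj_tuples:
  assumes "r \<le> n"
  shows "(\<Sum>\<sigma> | \<sigma> permutes {..<n}. h (restrict \<sigma> {..<r})) = fact (n - r) * (\<Sum>j\<in>inj_tuples r n. h j :: complex)"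
proof -
  have "(\<Sum>\<sigma> | \<sigma> permutes {..<n}. h (restrict \<sigma> {..<r})) = (\<Sum>\<phi>\<in>inj_tuples n n. h (restrict \<phi> {..<r}))"
  proof (rule sum.reindex_bij_witness[of _ "\<lambda>\<phi> x. if x < n then \<phi> x else x" "\<lambda>\<sigma>. restrict \<sigma> {..<n}"], goal_cases)
    case (1 \<sigma>)
    then have "\<sigma> x = x" if "\<not> x < n" for x using permutes_not_in[of \<sigma> "{..<n}" x] that by auto
    then show ?case by (auto simp: fun_eq_iff)
  next
    case (2 \<sigma>)
    then have s: "\<sigma> permutes {..<n}" by simp
    have "restrict \<sigma> {..<n} \<in> {..<n} \<rightarrow>\<^sub>E {..<n}"
      using permutes_in_image[OF s] by (intro restrict_PiE_iff[THEN iffD2]) auto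
    moreover have "inj_on (restrict \<sigma> {..<n}) {..<n}"
      using permutes_inj_on[OF s] by (simp add: inj_on_restrict_eq)
    ultimately show ?case unfolding inj_tuples_def by blast
  next
    case (3 \<phi>)
    have "\<phi> x = undefined" if "\<not> x < n" for x
      using 3 that by (auto simp: inj_tuples_def PiE_iff extensional_def)
    then show ?case by (auto simp: fun_eq_iff restrict_def)
  next
    case (4 \<phi>)
    have "bij_betw (\<lambda>x. if x < n then \<phi> x else x) {..<n} {..<n}"
      using inj_tuples_inj[OF 4] inj_tuples_full_image[OF 4]
      by (subst bij_betw_cong[of _ _ \<phi>]) (auto simp: bij_betw_def)
    then have "(\<lambda>x. if x < n then \<phi> x else x) permutes {..<n}"
      by (rule bij_imp_permutes) simp
    then show ?case by simp
  next
    case (5 \<sigma>)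
    have "restrict (restrict \<sigma> {..<n}) {..<r} = restrict \<sigma> {..<r}"
      using assms by (auto simp: restrict_def fun_eq_iff)
    then show ?case by simp
  qed
  then show ?thesis using sum_inj_tuples_full[OF assms] by simp
qed

text \<open>With the second permutation written as \<open>\<sigma> \<circ> \<pi>\<close>, a zero
  exponent at \<open>i\<close> forces \<open>\<pi> i = i\<close>. Hence \<open>\<pi>\<close> moves
  only the first \<open>r\<close> slots, the signs combine to that of \<open>\<pi>\<close>, and
  \<open>\<sigma>\<close> enters through its restriction. This is the integration over the last
  \<open>n - r\<close> variables.\<close>

lemma weyl_moment_padded:
  assumes r: "r \<le> n"
  shows "weyl_moment n (\<lambda>a. if a < r then k a else 0) = fact (n - r) *
     (\<Sum>j\<in>inj_tuples r n. \<Sum>\<pi> | \<pi> permutes {..<r}. of_int (sign \<pi>) * of_bool (\<forall>a<r. k a = int (j (\<pi> a)) - int (j a)))"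
proof -
  define k0 where "k0 = (\<lambda>a. if a < r then k a else (0 :: int))"
  define h where "h = (\<lambda>j :: nat \<Rightarrow> nat. \<Sum>\<pi> | \<pi> permutes {..<r}. of_int (sign \<pi>) * (of_bool (\<forall>a<r. k a = int (j (\<pi> a)) - int (j a)) :: complex))"
  have fin: "finite {\<pi>. \<pi> permutes {..<m}}" for m :: nat by (rule finite_permutations) simp
  have "(\<Sum>\<tau> | \<tau> permutes {..<n}. of_int (sign \<sigma> * sign \<tau>) * of_bool (\<forall>i<n. k0 i = int (\<tau> i) - int (\<sigma> i)))
      = h (restrict \<sigma> {..<r})" if \<sigma>: "\<sigma> permutes {..<n}" for \<sigma>
  proof -
    have "(\<Sum>\<tau> | \<tau> permutes {..<n}. of_int (sign \<sigma> * sign \<tau>) * (of_bool (\<forall>i<n. k0 i = int (\<tau> i) - int (\<sigma> i)) :: complex))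
      = (\<Sum>\<pi> | \<pi> permutes {..<n}. of_int (sign \<sigma> * sign (\<sigma> \<circ> \<pi>)) * of_bool (\<forall>i<n. k0 i = int ((\<sigma> \<circ> \<pi>) i) - int (\<sigma> i)))"
      by (rule setum_permutations_compose_left[OF \<sigma>])
    also have "\<dots> = (\<Sum>\<pi> | \<pi> permutes {..<r}. of_int (sign \<sigma> * sign (\<sigma> \<circ> \<pi>)) * of_bool (\<forall>i<n. k0 i = int ((\<sigma> \<circ> \<pi>) i) - int (\<sigma> i)))"
    proof (rule sum.mono_neutral_right[OF fin])
      show "{\<pi>. \<pi> permutes {..<r}} \<subseteq> {\<pi>. \<pi> permutes {..<n}}"
        using r by (auto intro: permutes_subset)
      show "\<forall>\<pi>\<in>{\<pi>. \<pi> permutes {..<n}} - {\<pi>. \<pi> permutes {..<r}}.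
          of_int (sign \<sigma> * sign (\<sigma> \<circ> \<pi>)) * of_bool (\<forall>i<n. k0 i = int ((\<sigma> \<circ> \<pi>) i) - int (\<sigma> i)) = (0 :: complex)"
      proof
        fix \<pi> assume *: "\<pi> \<in> {\<pi>. \<pi> permutes {..<n}} - {\<pi>. \<pi> permutes {..<r}}"
        have "\<not> (\<forall>i<n. k0 i = int ((\<sigma> \<circ> \<pi>) i) - int (\<sigma> i))"
        proof
          assume eq: "\<forall>i<n. k0 i = int ((\<sigma> \<circ> \<pi>) i) - int (\<sigma> i)"
          have "\<pi> i = i" if "i \<in> {..<n} - {..<r}" for i
          proof -
            have "k0 i = int ((\<sigma> \<circ> \<pi>) i) - int (\<sigma> i)" using eq that by simp
            then have "\<sigma> (\<pi> i) = \<sigma> i" using that by (simp add: k0_def)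
            then show ?thesis using permutes_inj[OF \<sigma>] by (auto dest: injD)
          qed
          moreover have "\<pi> permutes {..<n}" using * by simp
          ultimately have "\<pi> permutes {..<r}" by (intro permutes_superset[of \<pi> "{..<n}" "{..<r}"]) blast+
          then show False using * by simp
        qed
        then show "of_int (sign \<sigma> * sign (\<sigma> \<circ> \<pi>)) * of_bool (\<forall>i<n. k0 i = int ((\<sigma> \<circ> \<pi>) i) - int (\<sigma> i)) = (0 :: complex)"
          by (simp only: of_bool_eq mult_zero_right)
      qed
    qed
    also have "\<dots> = h (restrict \<sigma> {..<r})"
      unfolding h_def
    proof (intro sum.cong refl)
      fix \<pi> assume "\<pi> \<in> {\<pi>. \<pi> permutes {..<r}}"
      then have \<pi>: "\<pi> permutes {..<r}" by simp
      have "permutation \<sigma>" "permutation \<pi>" using \<sigma> \<pi> unfolding permutation_permutes by blast+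
      then have "sign \<sigma> * sign (\<sigma> \<circ> \<pi>) = sign \<pi>" by (simp add: sign_compose mult.assoc[symmetric])
      moreover have "(\<forall>i<n. k0 i = int ((\<sigma> \<circ> \<pi>) i) - int (\<sigma> i)) \<longleftrightarrow>
        (\<forall>a<r. k a = int (restrict \<sigma> {..<r} (\<pi> a)) - int (restrict \<sigma> {..<r} a))"
      proof
        assume "\<forall>i<n. k0 i = int ((\<sigma> \<circ> \<pi>) i) - int (\<sigma> i)"
        then show "\<forall>a<r. k a = int (restrict \<sigma> {..<r} (\<pi> a)) - int (restrict \<sigma> {..<r} a)"
          using r permutes_in_image[OF \<pi>] by (auto simp: k0_def split: if_splits)
      next
        assume *: "\<forall>a<r. k a = int (restrict \<sigma> {..<r} (\<pi> a)) - int (restrict \<sigma> {..<r} a)"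
        show "\<forall>i<n. k0 i = int ((\<sigma> \<circ> \<pi>) i) - int (\<sigma> i)"
        proof (intro allI impI)
          fix i assume "i < n"
          show "k0 i = int ((\<sigma> \<circ> \<pi>) i) - int (\<sigma> i)"
          proof (cases "i < r")
            case True
            then have "\<pi> i < r" using permutes_in_image[OF \<pi>, of i] by simp
            then show ?thesis using * True by (simp add: k0_def)
          next
            case False
            then show ?thesis using permutes_not_in[OF \<pi>, of i] by (simp add: k0_def)
          qed
        qed
      qed
      ultimately show "of_int (sign \<sigma> * sign (\<sigma> \<circ> \<pi>)) * of_bool (\<forall>i<n. k0 i = int ((\<sigma> \<circ> \<pi>) i) - int (\<sigma> i))
        = (of_int (sign \<pi>) * of_bool (\<forall>a<r. k a = int (restrict \<sigma> {..<r} (\<pi> a)) - int (restrict \<sigma> {..<r} a)) :: complex)"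
        by (simp only:)
    qed
    finally show ?thesis .
  qed
  then have "weyl_moment n k0 = (\<Sum>\<sigma> | \<sigma> permutes {..<n}. h (restrict \<sigma> {..<r}))"
    unfolding weyl_moment_def by (intro sum.cong refl) simp
  also have "\<dots> = fact (n - r) * (\<Sum>j\<in>inj_tuples r n. h j)" by (rule sum_permutes_inj_tuples[OF r])
  finally show ?thesis unfolding k0_def h_def .
qed

text \<open>Slots with exponent 0 do not affect the monomial, so each injective
  \<open>r\<close>-tuple is counted once for each of its \<open>(n - r)!\<close>
  completions.\<close>

lemma msym_padded:
  assumes r: "r \<le> n"
  shows "msym n n (\<lambda>a. if a < r then k a else 0) z = fact (n - r) * msym n r k z"
proof -
  have "monom_at n (\<lambda>a. if a < r then k a else 0) z \<phi> = monom_at r k z (restrict \<phi> {..<r})" for \<phi>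
  proof -
    have "monom_at n (\<lambda>a. if a < r then k a else 0) z \<phi> = (\<Prod>a<n. if a \<in> {..<r} then z (\<phi> a) powi k a else 1)"
      unfolding monom_at_def by (intro prod.cong) auto
    also have "\<dots> = (\<Prod>a\<in>{..<n} \<inter> {..<r}. z (\<phi> a) powi k a)"
      by (subst prod.inter_restrict) auto
    also have "{..<n} \<inter> {..<r} = {..<r}" using r by auto
    finally show ?thesis by (simp add: monom_at_def)
  qed
  then have "msym n n (\<lambda>a. if a < r then k a else 0) z = (\<Sum>\<phi>\<in>inj_tuples n n. monom_at r k z (restrict \<phi> {..<r}))"
    unfolding msym_def by (rule sum.cong[OF refl])
  also have "\<dots> = fact (n - r) * msym n r k z"
    unfolding msym_def by (rule sum_inj_tuples_full[OF r])
  finally show ?thesis .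
qed

text \<open>A determinant with two equal columns: if \<open>j a = j b\<close>, composition with the
  transposition changes the sign and nothing else.\<close>

lemma sum_permutes_non_injective:
  fixes j :: "nat \<Rightarrow> nat"
  assumes j: "\<not> inj_on j {..<r}"
  shows "(\<Sum>\<pi> | \<pi> permutes {..<r}. of_int (sign \<pi>) * (\<Prod>a<r. q (int (j (\<pi> a)) - int (j a)))) = (0 :: complex)"
proof -
  obtain a b where ab: "a < r" "b < r" "a \<noteq> b" "j a = j b" using j by (auto simp: inj_on_def)
  have perm: "transpose a b permutes {..<r}" using ab by (intro permutes_swap_id) auto
  have jt: "j (transpose a b x) = j x" for x using ab by (simp add: Transposition.transpose_def)
  let ?S = "\<Sum>\<pi> | \<pi> permutes {..<r}. of_int (sign \<pi>) * (\<Prod>a<r. q (int (j (\<pi> a)) - int (j a)))"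
  have "?S = (\<Sum>\<pi> | \<pi> permutes {..<r}. of_int (sign (\<pi> \<circ> transpose a b)) * (\<Prod>x<r. q (int (j ((\<pi> \<circ> transpose a b) x)) - int (j x))))"
    by (rule sum_permutations_compose_right[OF perm])
  also have "\<dots> = (\<Sum>\<pi> | \<pi> permutes {..<r}. - (of_int (sign \<pi>) * (\<Prod>x<r. q (int (j (\<pi> x)) - int (j x)))))"
  proof (rule sum.cong[OF refl])
    fix \<pi> assume "\<pi> \<in> {\<pi>. \<pi> permutes {..<r}}"
    then have p: "permutation \<pi>" by (intro permutes_imp_permutation[of "{..<r}"]) simp_all
    have 1: "sign (\<pi> \<circ> transpose a b) = - sign \<pi>"
      using sign_compose[OF p permutation_swap_id[of a b]] ab(3) by (simp add: sign_swap_id)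
    have 2: "(\<Prod>x<r. q (int (j ((\<pi> \<circ> transpose a b) x)) - int (j x))) = (\<Prod>x<r. q (int (j (\<pi> x)) - int (j x)))"
      unfolding prod.permute[OF perm, of "\<lambda>x. q (int (j (\<pi> x)) - int (j x))"] by (simp only: o_def jt)
    show "of_int (sign (\<pi> \<circ> transpose a b)) * (\<Prod>x<r. q (int (j ((\<pi> \<circ> transpose a b) x)) - int (j x)))
       = - (of_int (sign \<pi>) * (\<Prod>x<r. q (int (j (\<pi> x)) - int (j x))))"
      unfolding 1 2 by simp
  qed
  also have "\<dots> = - ?S" by (rule sum_negf)
  finally show ?thesis by simp
qed

text \<open>This is \<open>r!\<close> times the sum of the principal minors of order
  \<open>r\<close> of the \<open>n\<close> by \<open>n\<close> Toeplitz matrix of \<open>q\<close>,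
  as every index set arises from \<open>r!\<close> injective tuples. Summation runs over all tuples
  since the others contribute 0 and the full range factorises over the slots.\<close>

definition toeplitz_sum :: "nat \<Rightarrow> nat \<Rightarrow> (int \<Rightarrow> complex) \<Rightarrow> complex" where
  "toeplitz_sum r n q = (\<Sum>j\<in>{..<r} \<rightarrow>\<^sub>E {..<n}. \<Sum>\<pi> | \<pi> permutes {..<r}.
      of_int (sign \<pi>) * (\<Prod>a<r. q (int (j (\<pi> a)) - int (j a))))"

lemma toeplitz_sum_inj:
  "(\<Sum>j\<in>inj_tuples r n. \<Sum>\<pi> | \<pi> permutes {..<r}. of_int (sign \<pi>) * (\<Prod>a<r. q (int (j (\<pi> a)) - int (j a)))) = toeplitz_sum r n q"
  unfolding toeplitz_sum_def
  by (rule sum.mono_neutral_left) (auto simp: inj_tuples_def sum_permutes_non_injective intro: finite_PiE)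

context loop_equations
begin

text \<open>Padding the exponents with zeros reduces this to the moments in all \<open>n\<close>
  points; the factor \<open>fact (n - r)\<close> appears on both sides and cancels.\<close>

lemma integral_msym:
  assumes r: "r \<le> n" "n > 0"
  shows "(\<integral>\<omega>. msym n r k (Z \<omega>) \<partial>\<mu>) =
    (\<Sum>j\<in>inj_tuples r n. \<Sum>\<pi> | \<pi> permutes {..<r}. of_int (sign \<pi>) * of_bool (\<forall>a<r. k a = int (j (\<pi> a)) - int (j a)))"
proof -
  have "fact (n - r) * (\<integral>\<omega>. msym n r k (Z \<omega>) \<partial>\<mu>) = sym_moment (\<lambda>a. if a < r then k a else 0)"
    unfolding sym_moment_def msym_padded[OF r(1)] by simp
  also have "\<dots> = fact (n - r) * (\<Sum>j\<in>inj_tuples r n. \<Sum>\<pi> | \<pi> permutes {..<r}.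
      of_int (sign \<pi>) * of_bool (\<forall>a<r. k a = int (j (\<pi> a)) - int (j a)))"
    unfolding sym_moment_eq_weyl_moment[OF r(2)] by (rule weyl_moment_padded[OF r(1)])
  finally show ?thesis by simp
qed

text \<open>Both sides are multilinear in the Laurent polynomials put into the slots: expanding over
  the choice \<open>\<kappa>\<close> of a term for each slot reduces to monomials, and the same
  expansion read backwards reassembles the coefficients. The exponents \<open>e i\<close> may
  repeat, so the coefficient at \<open>m\<close> is itself a sum over \<open>L\<close>.\<close>

lemma laurent_observable_moment:
  fixes c :: "'i \<Rightarrow> complex" and e :: "'i \<Rightarrow> int"
  assumes L: "finite L" and r: "r \<le> n" "n > 0"
  defines "F \<equiv> (\<lambda>z :: nat \<Rightarrow> complex. \<Sum>\<phi>\<in>inj_tuples r n. \<Prod>a<r. \<Sum>i\<in>L. c i * z (\<phi> a) powi e i)"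
  shows "observable F"
    and "(\<integral>\<omega>. F (Z \<omega>) \<partial>\<mu>) = toeplitz_sum r n (\<lambda>m. \<Sum>i\<in>L. c i * of_bool (e i = m))"
proof -
  let ?K = "{..<r} \<rightarrow>\<^sub>E L"
  have expand: "F z = (\<Sum>\<kappa>\<in>?K. (\<Prod>a<r. c (\<kappa> a)) * msym n r (\<lambda>a. e (\<kappa> a)) z)" for z
  proof -
    have "F z = (\<Sum>\<phi>\<in>inj_tuples r n. \<Sum>\<kappa>\<in>?K. \<Prod>a<r. c (\<kappa> a) * z (\<phi> a) powi e (\<kappa> a))"
      unfolding F_def using L by (intro sum.cong refl prod_sum_PiE) auto
    also have "\<dots> = (\<Sum>\<kappa>\<in>?K. \<Sum>\<phi>\<in>inj_tuples r n. \<Prod>a<r. c (\<kappa> a) * z (\<phi> a) powi e (\<kappa> a))"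
      by (rule sum.swap)
    finally show ?thesis by (simp add: prod.distrib msym_def monom_at_def sum_distrib_left)
  qed
  show "observable F"
    unfolding expand[abs_def] by (intro observable_sum observable_mult observable_const observable_msym)
  have "(\<integral>\<omega>. F (Z \<omega>) \<partial>\<mu>) = (\<Sum>\<kappa>\<in>?K. (\<Prod>a<r. c (\<kappa> a)) * (\<integral>\<omega>. msym n r (\<lambda>a. e (\<kappa> a)) (Z \<omega>) \<partial>\<mu>))"
    unfolding expand
    by (subst Bochner_Integration.integral_sum, intro integrable_mult_right observable_integrable observable_msym) simp
  also have "\<dots> = (\<Sum>\<kappa>\<in>?K. \<Sum>j\<in>inj_tuples r n. \<Sum>\<pi> | \<pi> permutes {..<r}. of_int (sign \<pi>) *
       (\<Prod>a<r. c (\<kappa> a) * of_bool (e (\<kappa> a) = int (j (\<pi> a)) - int (j a))))"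
  proof -
    have "of_bool (\<forall>a<r. P a) = (\<Prod>a<r. of_bool (P a) :: complex)" for P
      by (induction r) (auto simp: less_Suc_eq)
    then show ?thesis
      unfolding integral_msym[OF r] by (simp add: prod.distrib sum_distrib_left mult.left_commute)
  qed
  also have "\<dots> = (\<Sum>j\<in>inj_tuples r n. \<Sum>\<kappa>\<in>?K. \<Sum>\<pi> | \<pi> permutes {..<r}. of_int (sign \<pi>) *
       (\<Prod>a<r. c (\<kappa> a) * of_bool (e (\<kappa> a) = int (j (\<pi> a)) - int (j a))))"
    by (rule sum.swap)
  also have "\<dots> = (\<Sum>j\<in>inj_tuples r n. \<Sum>\<pi> | \<pi> permutes {..<r}. \<Sum>\<kappa>\<in>?K. of_int (sign \<pi>) *
       (\<Prod>a<r. c (\<kappa> a) * of_bool (e (\<kappa> a) = int (j (\<pi> a)) - int (j a))))"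
    by (intro sum.cong refl sum.swap)
  also have "\<dots> = (\<Sum>j\<in>inj_tuples r n. \<Sum>\<pi> | \<pi> permutes {..<r}. of_int (sign \<pi>) *
       (\<Prod>a<r. \<Sum>i\<in>L. c i * of_bool (e i = int (j (\<pi> a)) - int (j a))))"
    unfolding sum_distrib_left[symmetric] using L by (intro sum.cong refl arg_cong2[of _ _ _ _ "(*)"] prod_sum_PiE[symmetric]) auto
  also have "\<dots> = toeplitz_sum r n (\<lambda>m. \<Sum>i\<in>L. c i * of_bool (e i = m))"
    by (rule toeplitz_sum_inj)
  finally show "(\<integral>\<omega>. F (Z \<omega>) \<partial>\<mu>) = toeplitz_sum r n (\<lambda>m. \<Sum>i\<in>L. c i * of_bool (e i = m))" .
qed

end

section \<open>Weak convergence from binomial moments\<close>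

lemma card_inj_tuples_choose:
  assumes "finite T"
  shows "card {f \<in> {..<r} \<rightarrow>\<^sub>E T. inj_on f {..<r}} = fact r * (card T choose r)"
proof -
  have "card {f \<in> {..<r} \<rightarrow>\<^sub>E T. inj_on f {..<r}} = prod ((-) (card T)) {0..<r}"
    using card_inj_on_subset_funcset[of "{..<r}" T "{..<r}"] assms by simp
  also have "\<dots> = fact r * (card T choose r)"
  proof (induction r)
    case (Suc r)
    have "(card T choose r) * (card T - r) = Suc r * (card T choose Suc r)"
      using binomial_absorb_comp[of "card T" r] binomial_absorption[of r "card T"] by (simp add: mult.commute)
    then show ?case using Suc by (simp add: algebra_simps)
  qed simp
  finally show ?thesis .
qed

text \<open>Rewriting a subset of a subset extracts \<open>m choose k\<close> and leaves an
  alternating sum of a row of binomial coefficients, which vanishes unless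
  \<open>m = k\<close>.\<close>

lemma binomial_inversion_term:
  "(\<Sum>r\<le>m. (- 1) ^ (r + k) * real (r choose k) * real (m choose r)) = of_bool (m = k)"
proof (cases "k \<le> m")
  case False
  then show ?thesis by (auto intro!: sum.neutral)
next
  case True
  have "(\<Sum>r\<le>m. (- 1) ^ (r + k) * real (r choose k) * real (m choose r)) =
     (\<Sum>r\<in>{k..m}. (- 1) ^ (r + k) * real (r choose k) * real (m choose r))"
    by (rule sum.mono_neutral_right) auto
  also have "\<dots> = (\<Sum>i\<le>m - k. (- 1) ^ (i + k + k) * real ((i + k) choose k) * real (m choose (i + k)))"
    using True by (intro sum.reindex_bij_witness[of _ "\<lambda>i. i + k" "\<lambda>r. r - k"]) auto
  also have "\<dots> = (\<Sum>i\<le>m - k. real (m choose k) * ((- 1) ^ i * real ((m - k) choose i)))"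
  proof (intro sum.cong refl)
    fix i assume "i \<in> {..m - k}"
    then have i: "i \<le> m - k" by simp
    have "((i + (m - k - i) + k) choose (i + k)) * ((i + k) choose k) = ((i + (m - k - i) + k) choose k) * ((i + (m - k - i)) choose i)"
      by (rule choose_mult_lemma)
    moreover have "i + (m - k - i) = m - k" "m - k + k = m" using i True by auto
    ultimately have "(m choose (i + k)) * ((i + k) choose k) = (m choose k) * ((m - k) choose i)" by simp
    then have "real ((i + k) choose k) * real (m choose (i + k)) = real (m choose k) * real ((m - k) choose i)"
      by (metis of_nat_mult mult.commute)
    then show "(- 1) ^ (i + k + k) * real ((i + k) choose k) * real (m choose (i + k)) = real (m choose k) * ((- 1) ^ i * real ((m - k) choose i))"
      by (simp add: power_add mult_ac flip: power_mult_distrib)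
  qed
  also have "\<dots> = real (m choose k) * (\<Sum>i\<le>m - k. (- 1) ^ i * real ((m - k) choose i))"
    by (rule sum_distrib_left[symmetric])
  also have "\<dots> = of_bool (m = k)"
  proof (cases "m = k")
    case False
    then have "m - k > 0" using True by simp
    then show ?thesis using choose_alternating_sum[of "m - k", where 'a = real] False by simp
  qed simp
  finally show ?thesis .
qed

text \<open>Pointwise the alternating sum is finite and equals the indicator of
  \<open>X = k\<close>. The moment bound together with \<open>r choose k \<le> 2 ^ r\<close> gives
  the exponential series of \<open>2 * C\<close> as majorant, which permits integration term by
  term.\<close>

lemma (in prob_space) prob_eq_binomial_moments:
  fixes X :: "'a \<Rightarrow> nat"
  assumes X: "X \<in> measurable M (count_space UNIV)"
    and int: "\<And>r. integrable M (\<lambda>\<omega>. real (X \<omega> choose r))"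
    and bound: "\<And>r. expectation (\<lambda>\<omega>. real (X \<omega> choose r)) \<le> C ^ r / fact r"
  shows "prob {\<omega> \<in> space M. X \<omega> = k} = (\<Sum>r. (- 1) ^ (r + k) * real (r choose k) * expectation (\<lambda>\<omega>. real (X \<omega> choose r)))"
proof -
  define f where "f = (\<lambda>r \<omega>. (- 1) ^ (r + k) * real (r choose k) * real (X \<omega> choose r))"
  have fin: "f r \<omega> = 0" if "r \<notin> {..X \<omega>}" for r \<omega> using that by (simp add: f_def)
  have "(\<Sum>r. f r \<omega>) = (\<Sum>r\<le>X \<omega>. f r \<omega>)" for \<omega> by (rule suminf_finite) (auto simp: fin)
  then have ind: "(\<Sum>r. f r \<omega>) = of_bool (X \<omega> = k)" for \<omega>
    unfolding f_def binomial_inversion_term by simp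
  have C: "C \<ge> 0"
  proof -
    have "0 \<le> expectation (\<lambda>\<omega>. real (X \<omega> choose 1))" by (rule Bochner_Integration.integral_nonneg) simp
    then have "0 \<le> C ^ 1 / fact 1" using bound[of 1] by (rule order_trans)
    then show ?thesis by simp
  qed
  have "(\<integral>\<omega>. (\<Sum>r. f r \<omega>) \<partial>M) = (\<Sum>r. \<integral>\<omega>. f r \<omega> \<partial>M)"
  proof (rule integral_suminf)
    show "integrable M (f r)" for r unfolding f_def using int by (rule integrable_mult_right)
    show "AE \<omega> in M. summable (\<lambda>r. norm (f r \<omega>))"
      using fin by (intro AE_I2 summable_finite[of "{..X _}"]) auto
    show "summable (\<lambda>r. \<integral>\<omega>. norm (f r \<omega>) \<partial>M)"
    proof (rule summable_comparison_test')
      show "summable (\<lambda>r. (2 * C) ^ r /\<^sub>R fact r)" by (rule summable_exp_generic)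
      fix r
      have "(\<integral>\<omega>. norm (f r \<omega>) \<partial>M) = real (r choose k) * expectation (\<lambda>\<omega>. real (X \<omega> choose r))"
        by (simp add: f_def abs_mult power_abs)
      also have "\<dots> \<le> 2 ^ r * (C ^ r / fact r)"
      proof (rule mult_mono[OF _ bound])
        show "real (r choose k) \<le> 2 ^ r" using binomial_le_pow2[of r k] by (metis of_nat_le_iff of_nat_numeral of_nat_power)
      qed (auto intro: Bochner_Integration.integral_nonneg)
      finally show "norm (\<integral>\<omega>. norm (f r \<omega>) \<partial>M) \<le> (2 * C) ^ r /\<^sub>R fact r"
        by (simp add: power_mult_distrib divide_inverse mult_ac)
    qed
  qed
  moreover have "(\<integral>\<omega>. (\<Sum>r. f r \<omega>) \<partial>M) = prob {\<omega> \<in> space M. X \<omega> = k}"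
  proof -
    have "(\<integral>\<omega>. (\<Sum>r. f r \<omega>) \<partial>M) = (\<integral>\<omega>. indicator {\<omega> \<in> space M. X \<omega> = k} \<omega> \<partial>M)"
      unfolding ind by (intro Bochner_Integration.integral_cong) (auto simp: indicator_def)
    also have "\<dots> = prob {\<omega> \<in> space M. X \<omega> = k}" by (subst Bochner_Integration.integral_indicator) (auto intro!: arg_cong[of _ _ prob])
    finally show ?thesis .
  qed
  ultimately show ?thesis by (simp add: f_def)
qed

text \<open>Dominated convergence for the counting measure, with the exponential series of
  \<open>2 * C\<close> as majorant. The bounds hold from \<open>n0\<close> on, so the sequence is
  shifted by \<open>n0\<close>.\<close>

lemma tendsto_binomial_inversion:
  fixes b :: "nat \<Rightarrow> nat \<Rightarrow> real"
  assumes lim: "\<And>r. (\<lambda>n. b n r) \<longlonglongrightarrow> \<beta> r"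
    and bound: "\<And>n r. n \<ge> n0 \<Longrightarrow> 0 \<le> b n r" "\<And>n r. n \<ge> n0 \<Longrightarrow> b n r \<le> C ^ r / fact r"
  shows "(\<lambda>n. \<Sum>r. (- 1) ^ (r + k) * real (r choose k) * b n r) \<longlonglongrightarrow> (\<Sum>r. (- 1) ^ (r + k) * real (r choose k) * \<beta> r)"
proof -
  define w where "w = (\<lambda>r. (2 * C) ^ r /\<^sub>R fact r)"
  define f where "f = (\<lambda>n r. (- 1) ^ (r + k) * real (r choose k) * b (n + n0) r)"
  define g where "g = (\<lambda>r. (- 1) ^ (r + k) * real (r choose k) * \<beta> r)"
  have sw: "summable w" unfolding w_def by (rule summable_exp_generic)
  have dom: "norm (f n r) \<le> w r" for n r
  proof -
    have "norm (f n r) = real (r choose k) * b (n + n0) r"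
      using bound(1)[of "n + n0" r] by (simp add: f_def abs_mult power_abs)
    also have "\<dots> \<le> 2 ^ r * (C ^ r / fact r)"
    proof (rule mult_mono[OF _ bound(2)])
      show "real (r choose k) \<le> 2 ^ r" using binomial_le_pow2[of r k] by (metis of_nat_le_iff of_nat_numeral of_nat_power)
    qed (use bound(1) in auto)
    finally show ?thesis by (simp add: w_def power_mult_distrib divide_inverse mult_ac)
  qed
  have w0: "norm (w r) = w r" for r using order_trans[OF norm_ge_zero dom[of 0 r]] by simp
  have iw: "integrable (count_space UNIV) w" unfolding integrable_count_space_nat_iff w0 by (rule sw)
  have "(\<lambda>n. f n r) \<longlonglongrightarrow> g r" for r
    unfolding f_def g_def by (intro tendsto_intros LIMSEQ_ignore_initial_segment lim)
  then have AE1: "AE r in count_space UNIV. (\<lambda>n. f n r) \<longlonglongrightarrow> g r" by simp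
  have AE2: "AE r in count_space UNIV. norm (f n r) \<le> w r" for n using dom by simp
  have "(\<lambda>n. \<integral>r. f n r \<partial>count_space UNIV) \<longlonglongrightarrow> (\<integral>r. g r \<partial>count_space UNIV)"
    "integrable (count_space UNIV) g" "\<And>n. integrable (count_space UNIV) (f n)"
    by (rule integral_dominated_convergence[OF _ _ iw AE1 AE2] integrable_dominated_convergence[OF _ _ iw AE1 AE2]
        integrable_dominated_convergence2[OF _ _ iw AE1 AE2]; simp)+
  then have "(\<lambda>n. \<Sum>r. f n r) \<longlonglongrightarrow> (\<Sum>r. g r)" by (simp add: integral_count_space_nat)
  then have "(\<lambda>n. \<Sum>r. (- 1) ^ (r + k) * real (r choose k) * b (n + n0) r) \<longlonglongrightarrow> (\<Sum>r. g r)" unfolding f_def .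
  from LIMSEQ_offset[OF this] show ?thesis unfolding g_def .
qed

lemma (in prob_space) cdf_nat_variable:
  fixes X :: "'a \<Rightarrow> nat"
  assumes X: "X \<in> measurable M (count_space UNIV)"
  shows "cdf (distr M borel (\<lambda>\<omega>. real (X \<omega>))) x = (\<Sum>k | real k \<le> x. prob {\<omega> \<in> space M. X \<omega> = k})"
proof -
  have fin: "finite {k. real k \<le> x}"
    by (rule finite_subset[of _ "{..nat \<lfloor>x\<rfloor>}"]) (auto simp: le_nat_floor)
  have sets: "{\<omega> \<in> space M. X \<omega> = k} \<in> sets M" for k
    using X by measurable
  have "cdf (distr M borel (\<lambda>\<omega>. real (X \<omega>))) x = prob ((\<lambda>\<omega>. real (X \<omega>)) -` {..x} \<inter> space M)"
    unfolding cdf_def using X by (subst measure_distr) (auto intro: measurable_compose)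
  also have "(\<lambda>\<omega>. real (X \<omega>)) -` {..x} \<inter> space M = (\<Union>k\<in>{k. real k \<le> x}. {\<omega> \<in> space M. X \<omega> = k})" by auto
  also have "prob \<dots> = (\<Sum>k | real k \<le> x. prob {\<omega> \<in> space M. X \<omega> = k})"
    using fin sets by (intro finite_measure_finite_Union) (auto simp: disjoint_family_on_def)
  finally show ?thesis .
qed

text \<open>The moment bounds pass to the limit, so both laws are recovered from their binomial
  moments by the same series. Point probabilities then converge, and the distribution function at
  \<open>x\<close> is a finite sum of them.\<close>

theorem weak_conv_binomial_moments:
  fixes M :: "nat \<Rightarrow> 'a measure" and Y :: "nat \<Rightarrow> 'a \<Rightarrow> nat" and N :: "'b measure" and X :: "'b \<Rightarrow> nat"
  assumes M: "\<And>n. n \<ge> n0 \<Longrightarrow> prob_space (M n)" "\<And>n. n \<ge> n0 \<Longrightarrow> Y n \<in> measurable (M n) (count_space UNIV)"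
      "\<And>n r. n \<ge> n0 \<Longrightarrow> integrable (M n) (\<lambda>\<omega>. real (Y n \<omega> choose r))"
      "\<And>n r. n \<ge> n0 \<Longrightarrow> (\<integral>\<omega>. real (Y n \<omega> choose r) \<partial>M n) \<le> C ^ r / fact r"
    and N: "prob_space N" "X \<in> measurable N (count_space UNIV)"
      "\<And>r. integrable N (\<lambda>\<omega>. real (X \<omega> choose r))"
    and lim: "\<And>r. (\<lambda>n. \<integral>\<omega>. real (Y n \<omega> choose r) \<partial>M n) \<longlonglongrightarrow> (\<integral>\<omega>. real (X \<omega> choose r) \<partial>N)"
  shows "weak_conv_m (\<lambda>n. distr (M n) borel (\<lambda>\<omega>. real (Y n \<omega>))) (distr N borel (\<lambda>\<omega>. real (X \<omega>)))"
  unfolding weak_conv_m_def weak_conv_def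
proof (intro allI impI)
  fix x
  interpret N: prob_space N by (rule N)
  have "(\<integral>\<omega>. real (X \<omega> choose r) \<partial>N) \<le> C ^ r / fact r" for r
    by (rule LIMSEQ_le_const2[OF lim]) (use M(4) in blast)
  then have limit: "N.prob {\<omega> \<in> space N. X \<omega> = k} = (\<Sum>r. (- 1) ^ (r + k) * real (r choose k) * (\<integral>\<omega>. real (X \<omega> choose r) \<partial>N))" for k
    using N by (intro N.prob_eq_binomial_moments)
  have "(\<lambda>n. measure (M n) {\<omega> \<in> space (M n). Y n \<omega> = k}) \<longlonglongrightarrow> N.prob {\<omega> \<in> space N. X \<omega> = k}" for k
  proof (rule Lim_transform_eventually)
    show "(\<lambda>n. \<Sum>r. (- 1) ^ (r + k) * real (r choose k) * (\<integral>\<omega>. real (Y n \<omega> choose r) \<partial>M n)) \<longlonglongrightarrow> N.prob {\<omega> \<in> space N. X \<omega> = k}"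
      unfolding limit
      by (rule tendsto_binomial_inversion[OF lim, where ?n0.0 = n0 and C = C]) (auto intro: M Bochner_Integration.integral_nonneg)
    show "\<forall>\<^sub>F n in sequentially. (\<Sum>r. (- 1) ^ (r + k) * real (r choose k) * (\<integral>\<omega>. real (Y n \<omega> choose r) \<partial>M n))
        = measure (M n) {\<omega> \<in> space (M n). Y n \<omega> = k}"
    proof (rule eventually_sequentiallyI[of n0])
      fix n assume n: "n \<ge> n0"
      then interpret Mn: prob_space "M n" by (rule M)
      show "(\<Sum>r. (- 1) ^ (r + k) * real (r choose k) * (\<integral>\<omega>. real (Y n \<omega> choose r) \<partial>M n)) = measure (M n) {\<omega> \<in> space (M n). Y n \<omega> = k}"
        using n M by (intro Mn.prob_eq_binomial_moments[symmetric])
    qed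
  qed
  then have "(\<lambda>n. \<Sum>k | real k \<le> x. measure (M n) {\<omega> \<in> space (M n). Y n \<omega> = k}) \<longlonglongrightarrow> cdf (distr N borel (\<lambda>\<omega>. real (X \<omega>))) x"
    unfolding N.cdf_nat_variable[OF N(2)] by (rule tendsto_sum)
  moreover have "\<forall>\<^sub>F n in sequentially. (\<Sum>k | real k \<le> x. measure (M n) {\<omega> \<in> space (M n). Y n \<omega> = k})
      = cdf (distr (M n) borel (\<lambda>\<omega>. real (Y n \<omega>))) x"
  proof (rule eventually_sequentiallyI[of n0])
    fix n assume n: "n \<ge> n0"
    then interpret Mn: prob_space "M n" by (rule M)
    show "(\<Sum>k | real k \<le> x. measure (M n) {\<omega> \<in> space (M n). Y n \<omega> = k}) = cdf (distr (M n) borel (\<lambda>\<omega>. real (Y n \<omega>))) x"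
      using M(2)[OF n] by (rule Mn.cdf_nat_variable[symmetric])
  qed
  ultimately show "(\<lambda>n. cdf (distr (M n) borel (\<lambda>\<omega>. real (Y n \<omega>))) x) \<longlonglongrightarrow> cdf (distr N borel (\<lambda>\<omega>. real (X \<omega>))) x"
    by (rule Lim_transform_eventually)
qed

section \<open>Fourier coefficients and approximation of indicators\<close>

definition fourier_coeff :: "(complex \<Rightarrow> complex) \<Rightarrow> int \<Rightarrow> complex" where
  "fourier_coeff g l = (\<integral>t. indicator {0..1} t *\<^sub>R (g (cis (2 * pi * t)) * cis (- (2 * pi * of_int l * t))) \<partial>lborel)"

lemma integral_cis_period:
  "(\<integral>t. indicator {0..1} t *\<^sub>R cis (2 * pi * of_int k * t) \<partial>lborel) = of_bool (k = 0)"
proof (cases "k = 0")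
  case True
  have "(\<integral>t. indicator {0..1 :: real} t *\<^sub>R (1 :: complex) \<partial>lborel) = 1"
    by (subst integral_scaleR_left) (auto simp: integrable_indicator_iff)
  then show ?thesis using True by simp
next
  case False
  define a where "a = 2 * of_real pi * \<i> * of_int k"
  have a: "a \<noteq> 0" using False by (simp add: a_def)
  have cis: "cis (2 * pi * of_int k * t) = exp (t *\<^sub>R a)" for t
    by (simp add: cis_conv_exp a_def scaleR_conv_of_real mult_ac)
  have "(\<integral>t. indicator {0..1} t *\<^sub>R exp (t *\<^sub>R a) \<partial>lborel) = exp (1 *\<^sub>R a) / a - exp (0 *\<^sub>R a) / a"
  proof (rule integral_FTC_atLeastAtMost)
    fix t :: real
    have "((\<lambda>t. exp (t *\<^sub>R a)) has_vector_derivative exp (t *\<^sub>R a) * a) (at t within {0..1})"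
      by (rule exp_scaleR_has_vector_derivative_right)
    then have "((\<lambda>t. exp (t *\<^sub>R a) / a) has_vector_derivative exp (t *\<^sub>R a) * a / a) (at t within {0..1})"
      by (rule has_vector_derivative_divide)
    then show "((\<lambda>t. exp (t *\<^sub>R a) / a) has_vector_derivative exp (t *\<^sub>R a)) (at t within {0..1})"
      using a by simp
  qed (auto intro!: continuous_intros)
  also have "exp (1 *\<^sub>R a) = 1"
    unfolding cis[of 1, symmetric] using cis_multiple_2pi[of "of_int k"] by simp
  finally show ?thesis using False unfolding cis by simp
qed

text \<open>Pairs of coefficient and exponent in which exponents may repeat, so that sums and
  products involve no collecting of terms.\<close>

definition laurent :: "(complex \<times> int) list \<Rightarrow> complex \<Rightarrow> complex" where
  "laurent xs w = (\<Sum>i<length xs. fst (xs ! i) * w powi snd (xs ! i))"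

lemma laurent_eq_sum_list: "laurent xs w = (\<Sum>p\<leftarrow>xs. fst p * w powi snd p)"
  by (simp add: laurent_def sum_list_sum_nth lessThan_atLeast0)

lemma integrable_indicator_cis:
  "integrable lborel (\<lambda>t. indicator {0..1 :: real} t *\<^sub>R (c * cis (b * t)))"
  by (rule borel_integrable_compact) (auto intro!: continuous_intros)

lemma fourier_coeff_laurent:
  "fourier_coeff (laurent xs) l = (\<Sum>i<length xs. fst (xs ! i) * of_bool (snd (xs ! i) = l))"
proof -
  have "fourier_coeff (laurent xs) l = (\<integral>t. (\<Sum>i<length xs. indicator {0..1} t *\<^sub>R (fst (xs ! i) * cis (2 * pi * of_int (snd (xs ! i) - l) * t))) \<partial>lborel)"
    unfolding fourier_coeff_def
  proof (rule Bochner_Integration.integral_cong[OF refl])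
    fix t :: real
    have "laurent xs (cis (2 * pi * t)) * cis (- (2 * pi * of_int l * t)) =
       (\<Sum>i<length xs. fst (xs ! i) * cis (2 * pi * of_int (snd (xs ! i) - l) * t))"
      unfolding laurent_def sum_distrib_right cis_power_int
      by (intro sum.cong refl) (simp add: mult.assoc cis_mult algebra_simps)
    then show "indicator {0..1} t *\<^sub>R (laurent xs (cis (2 * pi * t)) * cis (- (2 * pi * of_int l * t))) =
       (\<Sum>i<length xs. indicator {0..1} t *\<^sub>R (fst (xs ! i) * cis (2 * pi * of_int (snd (xs ! i) - l) * t)))"
      by (simp only: scaleR_sum_right)
  qed
  also have "\<dots> = (\<Sum>i<length xs. \<integral>t. indicator {0..1} t *\<^sub>R (fst (xs ! i) * cis (2 * pi * of_int (snd (xs ! i) - l) * t)) \<partial>lborel)"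
    by (rule Bochner_Integration.integral_sum) (rule integrable_indicator_cis)
  also have "\<dots> = (\<Sum>i<length xs. fst (xs ! i) * of_bool (snd (xs ! i) = l))"
  proof (intro sum.cong refl)
    fix i
    have "(\<integral>t. indicator {0..1} t *\<^sub>R (fst (xs ! i) * cis (2 * pi * of_int (snd (xs ! i) - l) * t)) \<partial>lborel) =
       (\<integral>t. fst (xs ! i) * (indicator {0..1} t *\<^sub>R cis (2 * pi * of_int (snd (xs ! i) - l) * t)) \<partial>lborel)"
      by simp
    also have "\<dots> = fst (xs ! i) * of_bool (snd (xs ! i) - l = 0)"
      unfolding integral_mult_right_zero integral_cis_period ..
    finally show "(\<integral>t. indicator {0..1} t *\<^sub>R (fst (xs ! i) * cis (2 * pi * of_int (snd (xs ! i) - l) * t)) \<partial>lborel)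
       = fst (xs ! i) * of_bool (snd (xs ! i) = l)" by simp
  qed
  finally show ?thesis .
qed

lemma laurent_append: "laurent (xs @ ys) w = laurent xs w + laurent ys w"
  by (simp add: laurent_eq_sum_list)

lemma laurent_mult:
  "\<exists>zs. \<forall>w. w \<noteq> 0 \<longrightarrow> laurent xs w * laurent ys w = laurent zs w"
proof (induction xs)
  case Nil
  have "laurent [] w = 0" for w by (simp add: laurent_def)
  then show ?case by (intro exI[of _ "[]"]) simp
next
  case (Cons p xs)
  then obtain zs where zs: "\<forall>w. w \<noteq> 0 \<longrightarrow> laurent xs w * laurent ys w = laurent zs w" by blast
  have "laurent (map (\<lambda>q. (fst p * fst q, snd p + snd q)) ys @ zs) w = laurent (p # xs) w * laurent ys w" if "w \<noteq> 0" for w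
  proof -
    have "laurent (map (\<lambda>q. (fst p * fst q, snd p + snd q)) ys) w = fst p * w powi snd p * laurent ys w"
      using that by (simp add: laurent_eq_sum_list o_def sum_list_const_mult[symmetric] power_int_add mult_ac)
    moreover have "laurent (p # xs) w = fst p * w powi snd p + laurent xs w" by (simp add: laurent_eq_sum_list)
    ultimately show ?thesis using zs that by (simp add: laurent_append distrib_right)
  qed
  then show ?case by metis
qed

text \<open>On the unit circle \<open>cnj w\<close> is the inverse of \<open>w\<close>, so a
  real-linear function of \<open>w\<close> is a combination of \<open>w\<close> and its inverse;
  sums and products preserve the form.\<close>

lemma real_polynomial_function_laurent:
  fixes p :: "complex \<Rightarrow> real"
  assumes "real_polynomial_function p"
  shows "\<exists>xs. \<forall>w. norm w = 1 \<longrightarrow> of_real (p w) = laurent xs w"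
  using assms
proof (induction rule: real_polynomial_function.induct)
  case (linear f)
  interpret bounded_linear f by (rule linear)
  show ?case
  proof (intro exI allI impI)
    fix w :: complex assume "norm w = 1"
    then have c: "cnj w = w powi (- 1)" using cnj_powi_unit[of w 1] by simp
    have "f w = f (Re w *\<^sub>R 1 + Im w *\<^sub>R \<i>)" by (intro arg_cong[of _ _ f] complex_eqI) auto
    also have "\<dots> = Re w * f 1 + Im w * f \<i>" by (simp add: add scale)
    finally have "complex_of_real (f w) = of_real (Re w) * of_real (f 1) + of_real (Im w) * of_real (f \<i>)" by simp
    also have "complex_of_real (Re w) = (w + cnj w) / 2" by (simp add: complex_add_cnj)
    also have "complex_of_real (Im w) = - (\<i> / 2) * (w - cnj w)"
      by (simp add: complex_eq_iff)
    finally show "complex_of_real (f w) = laurent [((of_real (f 1) - \<i> * of_real (f \<i>)) / 2, 1), ((of_real (f 1) + \<i> * of_real (f \<i>)) / 2, - 1)] w"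
      unfolding c by (simp add: laurent_eq_sum_list algebra_simps add_divide_distrib diff_divide_distrib)
  qed
next
  case (const c)
  show ?case by (intro exI[of _ "[(of_real c, 0)]"]) (simp add: laurent_def)
next
  case (add f g)
  then show ?case by (metis laurent_append of_real_add)
next
  case (mult f g)
  then obtain xs ys where 1: "\<forall>w. norm w = 1 \<longrightarrow> of_real (f w) = laurent xs w" "\<forall>w. norm w = 1 \<longrightarrow> of_real (g w) = laurent ys w" by blast
  obtain zs where "\<forall>w. w \<noteq> 0 \<longrightarrow> laurent xs w * laurent ys w = laurent zs w" using laurent_mult[of xs ys] by blast
  then have "complex_of_real (f w * g w) = laurent zs w" if "norm w = 1" for w
    using 1 that by (metis of_real_mult norm_zero zero_neq_one)
  then show ?case by blast
qed

text \<open>The functions \<open>max 0 (1 - real m * infdist w S)\<close> are continuous and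
  converge pointwise to the indicator because \<open>S\<close> is closed; Stone-Weierstrass replaces
  each of them on the circle up to \<open>1 / Suc m\<close>. The bound 2 is 1 for the function and
  at most 1 for the error.\<close>

lemma laurent_approx_indicator:
  assumes S: "closed S" "S \<noteq> {}"
  obtains xs :: "nat \<Rightarrow> (complex \<times> int) list" where
    "\<And>w. norm w = 1 \<Longrightarrow> (\<lambda>m. laurent (xs m) w) \<longlonglongrightarrow> of_bool (w \<in> S)"
    "\<And>m w. norm w = 1 \<Longrightarrow> norm (laurent (xs m) w) \<le> 2"
proof -
  define h where "h = (\<lambda>m w. max 0 (1 - real m * infdist w S))"
  have "\<exists>xs. \<forall>w. norm w = 1 \<longrightarrow> norm (of_real (h m w) - laurent xs w) \<le> 1 / real (Suc m)" for m
  proof -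
    have "continuous_on (sphere 0 1) (h m)"
      unfolding h_def by (intro continuous_intros)
    then obtain p where p: "real_polynomial_function p" "\<And>w. w \<in> sphere 0 1 \<Longrightarrow> \<bar>h m w - p w\<bar> < 1 / real (Suc m)"
      using Stone_Weierstrass_real_polynomial_function[of "sphere (0 :: complex) 1" "h m" "1 / real (Suc m)"] by auto
    obtain xs where xs: "\<forall>w. norm w = 1 \<longrightarrow> of_real (p w) = laurent xs w"
      using real_polynomial_function_laurent[OF p(1)] by blast
    have "norm (of_real (h m w) - laurent xs w) \<le> 1 / real (Suc m)" if "norm w = 1" for w
    proof -
      have "norm (of_real (h m w) - laurent xs w) = \<bar>h m w - p w\<bar>"
        using xs that by (metis of_real_diff norm_of_real)
      then show ?thesis using p(2)[of w] that by simp
    qed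
    then show ?thesis by blast
  qed
  then obtain xs where xs: "\<And>m w. norm w = 1 \<Longrightarrow> norm (of_real (h m w) - laurent (xs m) w) \<le> 1 / real (Suc m)"
    by metis
  show ?thesis
  proof (rule that[of xs])
    fix w :: complex assume w: "norm w = 1"
    have "(\<lambda>m. h m w) \<longlonglongrightarrow> of_bool (w \<in> S)"
    proof (cases "w \<in> S")
      case True
      then show ?thesis by (simp add: h_def)
    next
      case False
      then have pos: "infdist w S > 0" using S by (simp add: infdist_pos_not_in_closed)
      obtain M :: nat where M: "1 / infdist w S < real M" using reals_Archimedean2 by blast
      have "h m w = 0" if "m \<ge> M" for m
      proof -
        have "1 \<le> real M * infdist w S" using M pos by (simp add: field_simps)
        also have "\<dots> \<le> real m * infdist w S" using that pos by (intro mult_right_mono) auto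
        finally show ?thesis by (simp add: h_def)
      qed
      then have "\<forall>\<^sub>F m in sequentially. h m w = 0" by (auto simp: eventually_sequentially)
      then show ?thesis using False by (simp add: tendsto_eventually)
    qed
    then have hl: "(\<lambda>m. complex_of_real (h m w)) \<longlonglongrightarrow> of_real (of_bool (w \<in> S))" by (rule tendsto_of_real)
    have "(\<lambda>m. of_real (h m w) - laurent (xs m) w) \<longlonglongrightarrow> 0"
    proof (rule Lim_null_comparison)
      show "\<forall>\<^sub>F m in sequentially. norm (of_real (h m w) - laurent (xs m) w) \<le> 1 / real (Suc m)"
        using xs[OF w] by simp
      show "(\<lambda>m. 1 / real (Suc m)) \<longlonglongrightarrow> 0" using LIMSEQ_Suc[OF lim_1_over_n] by simp
    qed
    from tendsto_diff[OF hl this] show "(\<lambda>m. laurent (xs m) w) \<longlonglongrightarrow> of_bool (w \<in> S)"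
      by (cases "w \<in> S") simp_all
  next
    fix m and w :: complex assume w: "norm w = 1"
    have "0 \<le> h m w" "h m w \<le> 1" using infdist_nonneg[of w S] by (auto simp: h_def)
    then have "norm (complex_of_real (h m w)) \<le> 1" by simp
    moreover have "1 / real (Suc m) \<le> 1" by simp
    moreover have "norm (laurent (xs m) w) \<le> norm (complex_of_real (h m w)) + norm (of_real (h m w) - laurent (xs m) w)"
      by (metis norm_minus_commute norm_triangle_sub)
    ultimately show "norm (laurent (xs m) w) \<le> 2" using xs[OF w, of m] by linarith
  qed
qed

lemma borel_measurable_indicator_circle:
  assumes "closed S" shows "(\<lambda>t. of_bool (cis (2 * pi * t) \<in> S) :: complex) \<in> borel_measurable borel"
proof -
  have "(\<lambda>t. cis (2 * pi * t)) \<in> borel_measurable borel"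
    by (intro borel_measurable_continuous_onI continuous_intros)
  then have "(\<lambda>t. indicator S (cis (2 * pi * t)) :: complex) \<in> borel_measurable borel"
    using assms by (intro measurable_compose[OF _ borel_measurable_indicator]) auto
  then show ?thesis by (simp add: indicator_def of_bool_def)
qed

lemma fourier_coeff_tendsto:
  assumes S: "closed S"
    and lim: "\<And>w. norm w = 1 \<Longrightarrow> (\<lambda>m. laurent (xs m) w) \<longlonglongrightarrow> of_bool (w \<in> S)"
    and bound: "\<And>m w. norm w = 1 \<Longrightarrow> norm (laurent (xs m) w) \<le> 2"
  shows "(\<lambda>m. fourier_coeff (laurent (xs m)) l) \<longlonglongrightarrow> fourier_coeff (\<lambda>w. of_bool (w \<in> S)) l"
  unfolding fourier_coeff_def
proof (rule integral_dominated_convergence[where w = "\<lambda>t. indicator {0..1} t *\<^sub>R 2"])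
  have mc: "(\<lambda>t. cis (b * t)) \<in> borel_measurable borel" for b
    by (intro borel_measurable_continuous_onI continuous_intros)
  show "(\<lambda>t. indicator {0..1} t *\<^sub>R (of_bool (cis (2 * pi * t) \<in> S) * cis (- (2 * pi * of_int l * t)))) \<in> borel_measurable lborel"
    using borel_measurable_indicator_circle[OF S] mc[of "- (2 * pi * of_int l)"] by (auto simp: mult.assoc)
  have "laurent (xs m) (cis (2 * pi * t)) = (\<Sum>i<length (xs m). fst (xs m ! i) * cis ((of_int (snd (xs m ! i)) * (2 * pi)) * t))" for m t
    by (simp add: laurent_def cis_power_int mult.assoc)
  then have "(\<lambda>t. laurent (xs m) (cis (2 * pi * t))) \<in> borel_measurable borel" for m
    using mc by (auto intro!: borel_measurable_sum borel_measurable_times)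
  then show "(\<lambda>t. indicator {0..1} t *\<^sub>R (laurent (xs m) (cis (2 * pi * t)) * cis (- (2 * pi * of_int l * t)))) \<in> borel_measurable lborel" for m
    using mc[of "- (2 * pi * of_int l)"] by (auto simp: mult.assoc)
  show "integrable lborel (\<lambda>t. indicator {0..1 :: real} t *\<^sub>R (2 :: real))"
    by (rule borel_integrable_compact) auto
  show "AE t in lborel. (\<lambda>m. indicator {0..1} t *\<^sub>R (laurent (xs m) (cis (2 * pi * t)) * cis (- (2 * pi * of_int l * t)))) \<longlonglongrightarrow>
      indicator {0..1} t *\<^sub>R (of_bool (cis (2 * pi * t) \<in> S) * cis (- (2 * pi * of_int l * t)))"
    by (intro AE_I2 tendsto_intros lim) simp
  show "AE t in lborel. norm (indicator {0..1} t *\<^sub>R (laurent (xs m) (cis (2 * pi * t)) * cis (- (2 * pi * of_int l * t)))) \<le> indicator {0..1} t *\<^sub>R 2" for m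
    using bound by (intro AE_I2) (auto simp: norm_mult indicator_def)
qed

context loop_equations
begin

text \<open>Along the Laurent approximations the integrals converge by dominated convergence and the
  Toeplitz sums converge with their coefficients. The limit also provides measurability, which the
  enumeration \<open>Z\<close> does not give.\<close>

theorem indicator_moment:
  assumes S: "closed S" "S \<noteq> {}" and r: "r \<le> n" "n > 0"
  defines "F \<equiv> (\<lambda>\<omega>. \<Sum>\<phi>\<in>inj_tuples r n. \<Prod>a<r. of_bool (Z \<omega> (\<phi> a) \<in> S) :: complex)"
  shows "F \<in> borel_measurable \<mu>"
    and "(\<integral>\<omega>. F \<omega> \<partial>\<mu>) = toeplitz_sum r n (fourier_coeff (\<lambda>w. of_bool (w \<in> S)))"
proof -
  obtain xs where xs: "\<And>w. norm w = 1 \<Longrightarrow> (\<lambda>m. laurent (xs m) w) \<longlonglongrightarrow> of_bool (w \<in> S)"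
    "\<And>m w. norm w = 1 \<Longrightarrow> norm (laurent (xs m) w) \<le> 2"
    using laurent_approx_indicator[OF S] by blast
  define G where "G = (\<lambda>m \<omega>. \<Sum>\<phi>\<in>inj_tuples r n. \<Prod>a<r. laurent (xs m) (Z \<omega> (\<phi> a)))"
  have "observable (\<lambda>z. \<Sum>\<phi>\<in>inj_tuples r n. \<Prod>a<r. laurent (xs m) (z (\<phi> a)))" for m
    unfolding laurent_def by (rule laurent_observable_moment[OF _ r]) simp
  then have meas: "G m \<in> borel_measurable \<mu>" for m
    unfolding observable_def G_def by blast
  have int: "(\<integral>\<omega>. G m \<omega> \<partial>\<mu>) = toeplitz_sum r n (fourier_coeff (laurent (xs m)))" for m
    unfolding G_def fourier_coeff_laurent[abs_def] unfolding laurent_def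
    by (rule laurent_observable_moment[OF _ r]) simp
  have conv: "(\<lambda>m. G m \<omega>) \<longlonglongrightarrow> F \<omega>" if "\<omega> \<in> space \<mu>" for \<omega>
    unfolding G_def F_def using that unit inj_tuples_less by (intro tendsto_sum tendsto_prod xs) auto
  show F: "F \<in> borel_measurable \<mu>"
    using meas conv by (rule borel_measurable_LIMSEQ_metric)
  have "(\<lambda>m. \<integral>\<omega>. G m \<omega> \<partial>\<mu>) \<longlonglongrightarrow> (\<integral>\<omega>. F \<omega> \<partial>\<mu>)"
  proof (rule integral_dominated_convergence[where w = "\<lambda>_. real (card (inj_tuples r n)) * 2 ^ r"])
    show "AE \<omega> in \<mu>. norm (G m \<omega>) \<le> real (card (inj_tuples r n)) * 2 ^ r" for m
    proof (rule AE_I2)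
      fix \<omega> assume \<omega>: "\<omega> \<in> space \<mu>"
      show "norm (G m \<omega>) \<le> real (card (inj_tuples r n)) * 2 ^ r"
        unfolding G_def
      proof (rule sum_norm_bound)
        fix \<phi> assume "\<phi> \<in> inj_tuples r n"
        then have "(\<Prod>a<r. norm (laurent (xs m) (Z \<omega> (\<phi> a)))) \<le> (\<Prod>a<r. 2)"
          using \<omega> unit inj_tuples_less by (intro prod_mono conjI norm_ge_zero xs) auto
        then show "norm (\<Prod>a<r. laurent (xs m) (Z \<omega> (\<phi> a))) \<le> 2 ^ r" by (simp add: prod_norm)
      qed
    qed
  qed (use meas F conv in \<open>auto intro: AE_I2\<close>)
  moreover have "(\<lambda>m. \<integral>\<omega>. G m \<omega> \<partial>\<mu>) \<longlonglongrightarrow> toeplitz_sum r n (fourier_coeff (\<lambda>w. of_bool (w \<in> S)))"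
    unfolding int toeplitz_sum_def
    by (intro tendsto_sum tendsto_mult tendsto_prod tendsto_const fourier_coeff_tendsto[OF S(1) xs])
  ultimately show "(\<integral>\<omega>. F \<omega> \<partial>\<mu>) = toeplitz_sum r n (fourier_coeff (\<lambda>w. of_bool (w \<in> S)))"
    by (rule LIMSEQ_unique)
qed

end

section \<open>The determinant of a correlation matrix\<close>

lemma mult_mat_vec_index_sum:
  assumes "A \<in> carrier_mat n m" "v \<in> carrier_vec m" "i < n"
  shows "(A *\<^sub>v v) $ i = (\<Sum>s<m. A $$ (i, s) * v $ s)"
  using assms by (auto simp: scalar_prod_def lessThan_atLeast0)

lemma det_eq_prod_eigs:
  assumes A: "A \<in> carrier_mat n n"
  shows "Determinant.det A = prod_list (eigs A)"
proof -
  obtain B P Q where schur: "schur_decomposition A (eigs A) = (B, P, Q)" by (cases "schur_decomposition A (eigs A)")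
  from schur_decomposition[OF A eigs(1)[OF A] schur]
  have sim: "similar_mat_wit A B P Q" and ut: "upper_triangular B" and diag: "diag_mat B = eigs A" by auto
  from similar_mat_witD2[OF A sim] have B: "B \<in> carrier_mat n n" by auto
  have "similar_mat A B" using sim unfolding similar_mat_def by blast
  then have "Determinant.det A = Determinant.det B" by (rule det_similar)
  also have "\<dots> = prod_list (diag_mat B)" by (rule det_upper_triangular[OF ut B])
  finally show ?thesis by (simp add: diag)
qed

text \<open>The eigenvalues \<open>a\<close> are nonnegative with mean 1, and \<open>a \<le> exp (a - 1)\<close>.\<close>

lemma norm_det_correlation_matrix_le_1:
  assumes A: "A \<in> carrier_mat r r" and diag: "\<And>a. a < r \<Longrightarrow> A $$ (a, a) = 1"
    and psd: "\<And>v. v \<in> carrier_vec r \<Longrightarrow> \<exists>t\<ge>0. (\<Sum>a<r. \<Sum>b<r. cnj (v $ a) * A $$ (a, b) * v $ b) = of_real t"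
  shows "norm (Determinant.det A) \<le> 1"
proof -
  have ev: "\<exists>t\<ge>0. e = complex_of_real t" if e: "e \<in> set (eigs A)" for e
  proof -
    have "eigenvalue A e" using e eigenvalue_iff_eigs[OF A] by simp
    then obtain v where v: "v \<in> carrier_vec r" "v \<noteq> 0\<^sub>v r" "A *\<^sub>v v = e \<cdot>\<^sub>v v"
      unfolding eigenvalue_def eigenvector_def using A by auto
    obtain t where t: "t \<ge> 0" "(\<Sum>a<r. \<Sum>b<r. cnj (v $ a) * A $$ (a, b) * v $ b) = of_real t"
      using psd[OF v(1)] by blast
    define s where "s = (\<Sum>a<r. (norm (v $ a))\<^sup>2)"
    have "(\<Sum>a<r. \<Sum>b<r. cnj (v $ a) * A $$ (a, b) * v $ b) = (\<Sum>a<r. cnj (v $ a) * (A *\<^sub>v v) $ a)"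
      using A v(1) by (intro sum.cong refl) (simp add: mult_mat_vec_index_sum sum_distrib_left mult.assoc del: index_mult_mat_vec)
    also have "\<dots> = (\<Sum>a<r. e * (v $ a * cnj (v $ a)))"
      using v by (intro sum.cong refl) (simp add: mult_ac)
    also have "\<dots> = e * of_real s"
      unfolding s_def of_real_sum complex_norm_square sum_distrib_left ..
    finally have es: "e * of_real s = of_real t" using t by simp
    have "s \<noteq> 0"
    proof
      assume "s = 0"
      then have "\<forall>a<r. v $ a = 0" unfolding s_def by (subst (asm) sum_nonneg_eq_0_iff) auto
      then have "v = 0\<^sub>v r" using v(1) by (intro eq_vecI) auto
      then show False using v(2) by simp
    qed
    moreover have "s \<ge> 0" unfolding s_def by (intro sum_nonneg) auto
    ultimately have "e = of_real (t / s)" "t / s \<ge> 0" using es t(1) by (auto simp: field_simps)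
    then show ?thesis by blast
  qed
  have "mtrace r (A ^\<^sub>m 1) = (\<Sum>i<r. (eigs A ! i) ^ 1)" by (rule mtrace_pow[OF A eigs[OF A]])
  moreover have "mtrace r (A ^\<^sub>m 1) = of_nat r" using A diag by (simp add: mtrace_def)
  ultimately have "of_nat r = (\<Sum>i<r. eigs A ! i)" by simp
  then have "Re (of_nat r) = Re (\<Sum>i<r. eigs A ! i)" by (rule arg_cong)
  \<comment> \<open>Unit diagonal entries give trace \<open>r\<close>, so the numbers
    \<open>a - 1\<close> over all eigenvalues \<open>a\<close> sum to 0 and the product of
    exponentials is 1.\<close>
  then have tr: "(\<Sum>i<r. Re (eigs A ! i) - 1) = 0" by (simp add: sum_subtractf)
  have "norm (Determinant.det A) = (\<Prod>i<r. norm (eigs A ! i))"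
    unfolding det_eq_prod_eigs[OF A] using eigs(2)[OF A]
    by (simp add: prod.list_conv_set_nth prod_norm lessThan_atLeast0)
  also have "\<dots> \<le> (\<Prod>i<r. exp (Re (eigs A ! i) - 1))"
  proof (intro prod_mono conjI norm_ge_zero)
    fix i assume "i \<in> {..<r}"
    then obtain t where "t \<ge> 0" "eigs A ! i = complex_of_real t" using ev[of "eigs A ! i"] eigs(2)[OF A] by auto
    then show "norm (eigs A ! i) \<le> exp (Re (eigs A ! i) - 1)"
      using exp_ge_add_one_self[of "t - 1"] by simp
  qed
  also have "\<dots> = exp (\<Sum>i<r. Re (eigs A ! i) - 1)" by (simp add: exp_sum)
  finally show ?thesis by (simp add: tr)
qed

section \<open>The Dirichlet kernel\<close>

text \<open>The one-sided frequencies \<open>0, ..., n - 1\<close> are those of the columns of the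
  Vandermonde matrix. Both scalings by \<open>n\<close> correspond to unit mean spacing; for
  \<open>n > 0\<close> the value at 0 is 1.\<close>

definition dirichlet :: "nat \<Rightarrow> real \<Rightarrow> complex" where
  "dirichlet n u = (\<Sum>j<n. cis (2 * pi * real j * u / real n)) / of_nat n"

text \<open>A geometric sum with ratio \<open>exp (a / n)\<close>, where
  \<open>a = 2 pi i u\<close>; the denominator \<open>n * (exp (a / n) - 1)\<close> tends to
  \<open>a\<close> as a difference quotient. The limit \<open>(exp a - 1) / a\<close> is the sine
  kernel times a phase that stems from the one-sided frequencies.\<close>

lemma dirichlet_tendsto:
  "(\<lambda>n. dirichlet n (x - y)) \<longlonglongrightarrow> cis (pi * (x - y)) * of_real (sine_kernel x y)"
proof (cases "x = y")
  case True
  have "dirichlet n 0 = 1" if "n > 0" for n using that by (simp add: dirichlet_def)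
  then have "\<forall>\<^sub>F n in sequentially. dirichlet n (x - y) = 1"
    unfolding eventually_sequentially using True by (intro exI[of _ 1]) auto
  then show ?thesis using True by (simp add: sine_kernel_def tendsto_eventually)
next
  case False
  define u where "u = x - y"
  have u: "u \<noteq> 0" using False by (simp add: u_def)
  define a where "a = 2 * of_real pi * \<i> * of_real u"
  have a: "a \<noteq> 0" using u by (simp add: a_def)
  have "((\<lambda>h. exp (h * a)) has_field_derivative a) (at 0)"
    by (auto intro!: derivative_eq_intros)
  then have "((\<lambda>h. (exp (h * a) - 1) / h) \<longlongrightarrow> a) (at 0)"
    by (simp add: DERIV_def)
  moreover have "filterlim (\<lambda>n. 1 / of_nat n :: complex) (at 0) sequentially"
    by (intro filterlim_atI lim_1_over_n) (auto simp: eventually_sequentially intro!: exI[of _ 1])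
  ultimately have "(\<lambda>n. (exp (1 / of_nat n * a) - 1) / (1 / of_nat n)) \<longlonglongrightarrow> a"
    by (rule filterlim_compose)
  then have lim: "(\<lambda>n. of_nat n * (exp (a / of_nat n) - 1)) \<longlonglongrightarrow> a"
    by (simp add: mult.commute)
  have "(\<lambda>n. (exp a - 1) / (of_nat n * (exp (a / of_nat n) - 1))) \<longlonglongrightarrow> (exp a - 1) / a"
    by (intro tendsto_divide tendsto_const lim a)
  moreover have "\<forall>\<^sub>F n in sequentially. (exp a - 1) / (of_nat n * (exp (a / of_nat n) - 1)) = dirichlet n u"
  proof -
    have "\<forall>\<^sub>F n in sequentially. of_nat n * (exp (a / of_nat n) - 1) \<noteq> 0"
      by (rule tendsto_imp_eventually_ne[OF lim a])
    then show ?thesis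
    proof eventually_elim
      case (elim n)
      then have n: "n \<noteq> 0" and w: "exp (a / of_nat n) \<noteq> 1" by auto
      have "cis (2 * pi * real j * u / real n) = exp (a / of_nat n) ^ j" for j
        by (simp add: cis_conv_exp a_def mult_ac flip: exp_of_nat_mult)
      then have "(\<Sum>j<n. cis (2 * pi * real j * u / real n)) = (exp (a / of_nat n) ^ n - 1) / (exp (a / of_nat n) - 1)"
        using geometric_sum[OF w, of n] by simp
      also have "exp (a / of_nat n) ^ n = exp a" using n by (simp flip: exp_of_nat_mult)
      finally show ?case by (simp add: dirichlet_def mult.commute)
    qed
  qed
  ultimately have "(\<lambda>n. dirichlet n u) \<longlonglongrightarrow> (exp a - 1) / a" by (rule Lim_transform_eventually)
  also have "(exp a - 1) / a = cis (pi * u) * of_real (sin (pi * u) / (pi * u))"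
  proof -
    have ea: "exp a = cis (pi * u) * cis (pi * u)" unfolding cis_mult by (simp add: cis_conv_exp a_def algebra_simps)
    have "cis (pi * u) * cis (- (pi * u)) = 1" by (simp add: cis_mult)
    then have "exp a - 1 = cis (pi * u) * (cis (pi * u) - cis (- (pi * u)))" unfolding ea by (simp add: right_diff_distrib)
    also have "cis (pi * u) - cis (- (pi * u)) = 2 * \<i> * of_real (sin (pi * u))"
      by (simp add: complex_eq_iff)
    finally show ?thesis using u by (simp add: a_def field_simps)
  qed
  finally show ?thesis using False by (simp add: u_def sine_kernel_def)
qed

text \<open>The determinant of a kernel matrix in the form that suits limits and integrals term by
  term.\<close>

definition leibniz_sum :: "nat \<Rightarrow> (nat \<Rightarrow> nat \<Rightarrow> complex) \<Rightarrow> complex" where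
  "leibniz_sum r K = (\<Sum>\<pi> | \<pi> permutes {..<r}. of_int (sign \<pi>) * (\<Prod>a<r. K a (\<pi> a)))"

lemma det_mat_eq_sum_permutes:
  fixes K :: "nat \<Rightarrow> nat \<Rightarrow> 'a :: comm_ring_1"
  shows "Determinant.det (Matrix.mat r r (\<lambda>(a, b). K a b)) = (\<Sum>\<pi> | \<pi> permutes {..<r}. of_int (sign \<pi>) * (\<Prod>a<r. K a (\<pi> a)))"
proof -
  have "(\<Prod>i = 0..<r. Matrix.mat r r (\<lambda>(a, b). K a b) $$ (i, p i)) = (\<Prod>i = 0..<r. K i (p i))"
    if "p permutes {0..<r}" for p
    using permutes_in_image[OF that] by (intro prod.cong) auto
  then show ?thesis
    by (simp add: det_def'[of _ r] lessThan_atLeast0)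
qed

lemma leibniz_sum_eq_det: "leibniz_sum r K = Determinant.det (Matrix.mat r r (\<lambda>(a, b). K a b))"
  unfolding det_mat_eq_sum_permutes leibniz_sum_def ..

lemma of_real_det_eq_leibniz_sum:
  "complex_of_real (Determinant.det (Matrix.mat r r (\<lambda>(a, b). K a b))) = leibniz_sum r (\<lambda>a b. of_real (K a b))"
  unfolding det_mat_eq_sum_permutes leibniz_sum_def by simp

text \<open>Conjugation by a diagonal matrix of phases: along a permutation the factors multiply to
  1.\<close>

lemma leibniz_sum_phase:
  "leibniz_sum r (\<lambda>a b. cis (f a - f b) * K a b) = leibniz_sum r K"
  unfolding leibniz_sum_def
proof (intro sum.cong refl arg_cong2[of _ _ _ _ "(*)"])
  fix \<pi> assume "\<pi> \<in> {\<pi>. \<pi> permutes {..<r}}"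
  then have \<pi>: "\<pi> permutes {..<r}" by simp
  have "(\<Prod>a<r. cis (f a - f (\<pi> a))) = (\<Prod>a<r. cis (f a)) / (\<Prod>a<r. cis (f (\<pi> a)))"
    by (simp add: cis_divide prod_dividef[symmetric])
  also have "(\<Prod>a<r. cis (f (\<pi> a))) = (\<Prod>a<r. cis (f a))"
    using prod.permute[OF \<pi>, of "\<lambda>a. cis (f a)"] by (simp add: o_def)
  finally have "(\<Prod>a<r. cis (f a - f (\<pi> a))) = 1" by simp
  then show "(\<Prod>a<r. cis (f a - f (\<pi> a)) * K a (\<pi> a)) = (\<Prod>a<r. K a (\<pi> a))"
    by (simp add: prod.distrib)
qed

text \<open>Such phases on Fourier coefficients come from rotating the circle, and they cancel along
  every permutation. Hence the position of an arc does not influence its moments.\<close>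

lemma toeplitz_sum_phase: "toeplitz_sum r n (\<lambda>l. cis (\<theta> * of_int l) * q l) = toeplitz_sum r n q"
  unfolding toeplitz_sum_def
proof (intro sum.cong refl arg_cong2[of _ _ _ _ "(*)"])
  fix j :: "nat \<Rightarrow> nat" and \<pi> assume "\<pi> \<in> {\<pi>. \<pi> permutes {..<r}}"
  then have \<pi>: "\<pi> permutes {..<r}" by simp
  have "(\<Prod>a<r. cis (\<theta> * of_int (int (j (\<pi> a)) - int (j a)))) = (\<Prod>a<r. cis (\<theta> * real (j (\<pi> a)))) / (\<Prod>a<r. cis (\<theta> * real (j a)))"
    by (simp add: cis_divide prod_dividef[symmetric] right_diff_distrib)
  also have "(\<Prod>a<r. cis (\<theta> * real (j (\<pi> a)))) = (\<Prod>a<r. cis (\<theta> * real (j a)))"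
    using prod.permute[OF \<pi>, of "\<lambda>a. cis (\<theta> * real (j a))"] by (simp add: o_def)
  finally have "(\<Prod>a<r. cis (\<theta> * of_int (int (j (\<pi> a)) - int (j a)))) = 1" by simp
  then show "(\<Prod>a<r. cis (\<theta> * of_int (int (j (\<pi> a)) - int (j a))) * q (int (j (\<pi> a)) - int (j a))) = (\<Prod>a<r. q (int (j (\<pi> a)) - int (j a)))"
    by (simp only: prod.distrib mult_1_left)
qed

text \<open>The product over slots becomes an integral over \<open>r\<close> variables in
  \<open>I\<close>. Regrouping the exponentials by the index \<open>j a\<close> pairs
  \<open>x a\<close> with the variable at the preimage of \<open>a\<close> under
  \<open>\<pi>\<close>; the sum over all \<open>j\<close> then factorises into Dirichlet kernels.
  Passing to inverse permutations, which have the same sign, gives the determinant.\<close>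

lemma toeplitz_sum_integral:
  fixes I :: "real set"
  assumes I: "I \<in> sets borel" "emeasure lborel I < \<infinity>"
  shows "toeplitz_sum r n (\<lambda>l. (\<integral>x. indicator I x *\<^sub>R (cis (- (2 * pi * of_int l * x / real n)) / of_nat n) \<partial>lborel)) =
    (\<integral>x. (\<Prod>a<r. indicator I (x a)) * leibniz_sum r (\<lambda>a b. dirichlet n (x a - x b)) \<partial>PiM {..<r} (\<lambda>_. lborel))"
proof -
  interpret product_sigma_finite "\<lambda>_ :: nat. lborel :: real measure" ..
  define f where "f = (\<lambda>l x. indicator I x *\<^sub>R (cis (- (2 * pi * of_int l * x / real n)) / of_nat n) :: complex)"
  have int_f: "integrable lborel (f l)" for l
  proof -
    have "(\<lambda>x. cis (- (2 * pi * of_int l * x / real n)) / of_nat n) \<in> borel_measurable borel"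
      unfolding divide_inverse by (intro borel_measurable_continuous_onI continuous_intros)
    then have m: "f l \<in> borel_measurable lborel" unfolding f_def using I by auto
    show ?thesis
    proof (rule Bochner_Integration.integrable_bound[OF _ m])
      show "integrable lborel (indicator I :: real \<Rightarrow> real)" using I by (simp add: integrable_indicator_iff)
      show "AE x in lborel. norm (f l x) \<le> norm (indicator I x :: real)"
        by (intro AE_I2) (auto simp: f_def norm_divide indicator_def divide_le_eq_1)
    qed
  qed
  let ?P = "PiM {..<r} (\<lambda>_. lborel :: real measure)"
  let ?J = "{..<r} \<rightarrow>\<^sub>E {..<n}"
  define G where "G = (\<lambda>j \<pi> x. of_int (sign \<pi>) * (\<Prod>a<r. f (int (j (\<pi> a)) - int (j a)) (x a)))"
  have int_G: "integrable ?P (G j \<pi>)" for j \<pi>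
    unfolding G_def by (intro integrable_mult_right product_integrable_prod int_f) simp
  have fin: "finite {\<pi>. \<pi> permutes {..<r}}" by (rule finite_permutations) simp
  have "(\<integral>x. (\<Prod>a<r. f (int (j (\<pi> a)) - int (j a)) (x a)) \<partial>?P) = (\<Prod>a<r. \<integral>x. f (int (j (\<pi> a)) - int (j a)) x \<partial>lborel)" for j \<pi>
    by (rule product_integral_prod[OF finite_lessThan int_f])
  then have "(\<integral>x. G j \<pi> x \<partial>?P) = of_int (sign \<pi>) * (\<Prod>a<r. \<integral>x. f (int (j (\<pi> a)) - int (j a)) x \<partial>lborel)" for j \<pi>
    unfolding G_def integral_mult_right_zero by simp
  then have "toeplitz_sum r n (\<lambda>l. \<integral>x. f l x \<partial>lborel) = (\<Sum>j\<in>?J. \<Sum>\<pi> | \<pi> permutes {..<r}. \<integral>x. G j \<pi> x \<partial>?P)"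
    unfolding toeplitz_sum_def by simp
  also have "\<dots> = (\<Sum>j\<in>?J. \<integral>x. (\<Sum>\<pi> | \<pi> permutes {..<r}. G j \<pi> x) \<partial>?P)"
    by (intro sum.cong refl Bochner_Integration.integral_sum[symmetric] int_G)
  also have "\<dots> = (\<integral>x. (\<Sum>j\<in>?J. \<Sum>\<pi> | \<pi> permutes {..<r}. G j \<pi> x) \<partial>?P)"
    by (intro Bochner_Integration.integral_sum[symmetric] Bochner_Integration.integrable_sum int_G)
  also have "\<dots> = (\<integral>x. (\<Prod>a<r. indicator I (x a)) * leibniz_sum r (\<lambda>a b. dirichlet n (x a - x b)) \<partial>?P)"
  proof (rule Bochner_Integration.integral_cong[OF refl])
    fix x :: "nat \<Rightarrow> real"
    define c where "c = (\<lambda>m y. cis (2 * pi * real m * y / real n))"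
    have one: "(\<Sum>j\<in>?J. \<Prod>a<r. f (int (j (\<pi> a)) - int (j a)) (x a)) = (\<Prod>a<r. indicator I (x a)) * (\<Prod>a<r. dirichlet n (x a - x (Hilbert_Choice.inv \<pi> a)))"
      if \<pi>: "\<pi> permutes {..<r}" for \<pi>
    proof -
      have prod: "(\<Prod>a<r. f (int (j (\<pi> a)) - int (j a)) (x a)) = (\<Prod>a<r. indicator I (x a)) * (\<Prod>a<r. c (j a) (x a - x (Hilbert_Choice.inv \<pi> a)) / of_nat n)" for j
      proof -
        have "f (int (j (\<pi> a)) - int (j a)) (x a) = indicator I (x a) * (c (j a) (x a) / c (j (\<pi> a)) (x a) / of_nat n)" for a
        proof -
          have arg: "- (2 * pi * of_int (int (j (\<pi> a)) - int (j a)) * x a / real n) = 2 * pi * real (j a) * x a / real n - 2 * pi * real (j (\<pi> a)) * x a / real n"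
            by (cases "n = 0") (simp_all add: field_simps)
          show ?thesis unfolding f_def arg c_def cis_divide[symmetric] by (simp add: indicator_def)
        qed
        then have "(\<Prod>a<r. f (int (j (\<pi> a)) - int (j a)) (x a)) = (\<Prod>a<r. indicator I (x a)) *
            ((\<Prod>a<r. c (j a) (x a)) / (\<Prod>a<r. c (j (\<pi> a)) (x a)) / (\<Prod>a<r. of_nat n))"
          by (simp only: prod.distrib prod_dividef)
        also have "(\<Prod>a<r. c (j (\<pi> a)) (x a)) = (\<Prod>a<r. c (j a) (x (Hilbert_Choice.inv \<pi> a)))"
          using prod.permute[OF \<pi>, of "\<lambda>a. c (j a) (x (Hilbert_Choice.inv \<pi> a))"] by (simp add: o_def permutes_inverses[OF \<pi>])
        also have "(\<Prod>a<r. c (j a) (x a)) / (\<Prod>a<r. c (j a) (x (Hilbert_Choice.inv \<pi> a))) = (\<Prod>a<r. c (j a) (x a - x (Hilbert_Choice.inv \<pi> a)))"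
          unfolding prod_dividef[symmetric] by (intro prod.cong refl) (simp add: c_def cis_divide diff_divide_distrib[symmetric] right_diff_distrib)
        finally show ?thesis by (simp only: prod_dividef)
      qed
      have "(\<Sum>j\<in>?J. \<Prod>a<r. f (int (j (\<pi> a)) - int (j a)) (x a)) =
         (\<Prod>a<r. indicator I (x a)) * (\<Sum>j\<in>?J. \<Prod>a<r. c (j a) (x a - x (Hilbert_Choice.inv \<pi> a)) / of_nat n)"
        unfolding prod sum_distrib_left ..
      also have "(\<Sum>j\<in>?J. \<Prod>a<r. c (j a) (x a - x (Hilbert_Choice.inv \<pi> a)) / of_nat n) = (\<Prod>a<r. \<Sum>m<n. c m (x a - x (Hilbert_Choice.inv \<pi> a)) / of_nat n)"
        by (rule prod_sum_PiE[symmetric]) auto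
      finally show ?thesis by (simp add: dirichlet_def c_def sum_divide_distrib)
    qed
    have "(\<Sum>j\<in>?J. \<Sum>\<pi> | \<pi> permutes {..<r}. G j \<pi> x) = (\<Sum>\<pi> | \<pi> permutes {..<r}. \<Sum>j\<in>?J. G j \<pi> x)"
      by (rule sum.swap)
    also have "\<dots> = (\<Sum>\<pi> | \<pi> permutes {..<r}. (\<Prod>a<r. indicator I (x a)) * (of_int (sign \<pi>) * (\<Prod>a<r. dirichlet n (x a - x (Hilbert_Choice.inv \<pi> a)))))"
    proof (intro sum.cong refl)
      fix \<pi> assume "\<pi> \<in> {\<pi>. \<pi> permutes {..<r}}"
      then show "(\<Sum>j\<in>?J. G j \<pi> x) = (\<Prod>a<r. indicator I (x a)) * (of_int (sign \<pi>) * (\<Prod>a<r. dirichlet n (x a - x (Hilbert_Choice.inv \<pi> a))))"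
        unfolding G_def sum_distrib_left[symmetric] by (simp only: one mem_Collect_eq mult.left_commute)
    qed
    also have "\<dots> = (\<Sum>\<pi> | \<pi> permutes {..<r}. (\<Prod>a<r. indicator I (x a)) * (of_int (sign (Hilbert_Choice.inv \<pi>)) * (\<Prod>a<r. dirichlet n (x a - x (Hilbert_Choice.inv (Hilbert_Choice.inv \<pi>) a)))))"
      by (rule sum_permutations_inverse)
    also have "\<dots> = (\<Sum>\<pi> | \<pi> permutes {..<r}. (\<Prod>a<r. indicator I (x a)) * (of_int (sign \<pi>) * (\<Prod>a<r. dirichlet n (x a - x (\<pi> a)))))"
    proof (intro sum.cong refl)
      fix \<pi> assume "\<pi> \<in> {\<pi>. \<pi> permutes {..<r}}"
      then have \<pi>: "\<pi> permutes {..<r}" by simp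
      have "permutation \<pi>" using \<pi> by (intro permutation_permutes[THEN iffD2]) blast
      then show "(\<Prod>a<r. indicator I (x a)) * (of_int (sign (Hilbert_Choice.inv \<pi>)) * (\<Prod>a<r. dirichlet n (x a - x (Hilbert_Choice.inv (Hilbert_Choice.inv \<pi>) a))))
        = (\<Prod>a<r. indicator I (x a)) * (of_int (sign \<pi>) * (\<Prod>a<r. dirichlet n (x a - x (\<pi> a))))"
        by (simp only: sign_inverse permutes_inv_inv[OF \<pi>])
    qed
    finally show "(\<Sum>j\<in>?J. \<Sum>\<pi> | \<pi> permutes {..<r}. G j \<pi> x) =
       (\<Prod>a<r. indicator I (x a)) * leibniz_sum r (\<lambda>a b. dirichlet n (x a - x b))"
      by (simp only: leibniz_sum_def sum_distrib_left)
  qed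
  finally show ?thesis unfolding f_def .
qed

section \<open>The number of eigenvalues in an arc\<close>

lemma cis_2pi_eq_iff: "cis (2 * pi * s) = cis (2 * pi * t) \<longleftrightarrow> (\<exists>k :: int. s - t = of_int k)"
proof
  assume "cis (2 * pi * s) = cis (2 * pi * t)"
  then have "cis (2 * pi * s) / cis (2 * pi * t) = 1" by simp
  then have "cis (2 * pi * s - 2 * pi * t) = 1" by (simp add: cis_divide)
  then have "cos (2 * pi * s - 2 * pi * t) = 1" by (simp add: complex_eq_iff)
  then obtain k :: int where "2 * pi * s - 2 * pi * t = of_int k * (2 * pi)"
    unfolding cos_one_2pi_int by (auto simp: mult_ac)
  then have "(2 * pi) * (s - t) = (2 * pi) * of_int k" by (simp add: algebra_simps)
  then show "\<exists>k :: int. s - t = of_int k" by auto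
next
  assume "\<exists>k :: int. s - t = of_int k"
  then obtain k :: int where "s = t + of_int k" by (auto simp: algebra_simps)
  then have "cis (2 * pi * s) = cis (2 * pi * t) * cis (2 * pi * of_int k)"
    by (simp add: cis_mult algebra_simps)
  then show "cis (2 * pi * s) = cis (2 * pi * t)" by (simp add: cis_multiple_2pi)
qed

lemma circle_arc_eq: "circle_arc n z = (\<lambda>t. cis (2 * pi * (t / real n))) ` {min 0 z..max 0 z}"
proof -
  have "exp (2 * \<i> * of_real pi * of_real t / of_nat n) = cis (2 * pi * (t / real n))" for t
    by (simp add: cis_conv_exp mult_ac)
  moreover have "closed_segment 0 z = {min 0 z..max 0 z}"
    by (auto simp: closed_segment_eq_real_ivl)
  ultimately show ?thesis unfolding circle_arc_def by simp
qed

lemma closed_circle_arc: "closed (circle_arc n z)" and circle_arc_nonempty: "circle_arc n z \<noteq> {}"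
proof -
  have "compact (circle_arc n z)"
    unfolding circle_arc_eq divide_inverse by (intro compact_continuous_image continuous_intros) auto
  then show "closed (circle_arc n z)" by (rule compact_imp_closed)
  show "circle_arc n z \<noteq> {}" by (auto simp: circle_arc_eq)
qed

text \<open>The circle is cut at 1. For negative \<open>z\<close> the arc abuts on parameter 1
  instead of 0, which is the reason for the offset. Since \<open>\<bar>z\<bar> < n\<close> excludes
  a full turn, the integer ambiguity of the parameter is determined.\<close>

lemma cis_in_circle_arc_iff:
  assumes n: "\<bar>z\<bar> < real n" and t: "0 < t" "t < 1"
  shows "cis (2 * pi * t) \<in> circle_arc n z \<longleftrightarrow> real n * (t - (if z \<ge> 0 then 0 else 1)) \<in> {min 0 z..max 0 z}"
    (is "_ \<longleftrightarrow> real n * (t - ?t0) \<in> _")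
proof
  have n0: "real n > 0" using n by linarith
  assume "cis (2 * pi * t) \<in> circle_arc n z"
  then obtain s where s: "s \<in> {min 0 z..max 0 z}" "cis (2 * pi * t) = cis (2 * pi * (s / real n))"
    unfolding circle_arc_eq by auto
  then obtain k :: int where k: "t - s / real n = of_int k" unfolding cis_2pi_eq_iff by blast
  have "of_int k = (?t0 :: real)"
  proof (cases "z \<ge> 0")
    case True
    then have "0 \<le> s / real n" "s / real n < 1" using s(1) n n0 by auto
    then have "- 1 < (of_int k :: real)" "(of_int k :: real) < 1" using k t by linarith+
    then have "k = 0" by linarith
    then show ?thesis using True by simp
  next
    case False
    then have "s / real n \<le> 0" "- 1 < s / real n" using s(1) n n0 by (auto simp: field_simps)
    then have "0 < (of_int k :: real)" "(of_int k :: real) < 2" using k t by linarith+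
    then have "k = 1" by linarith
    then show ?thesis using False by simp
  qed
  then have "s = real n * (t - ?t0)" using k n0 by (simp add: field_simps)
  then show "real n * (t - ?t0) \<in> {min 0 z..max 0 z}" using s(1) by simp
next
  have n0: "real n > 0" using n by linarith
  assume *: "real n * (t - ?t0) \<in> {min 0 z..max 0 z}"
  have "cis (2 * pi * t) = cis (2 * pi * (real n * (t - ?t0) / real n))"
    unfolding cis_2pi_eq_iff using n0 by (intro exI[of _ "if z \<ge> 0 then 0 else 1"]) auto
  then show "cis (2 * pi * t) \<in> circle_arc n z" unfolding circle_arc_eq using * by blast
qed

text \<open>The substitution is \<open>x = n * (t - t0)\<close>. The cut points 0 and 1 form a null
  set, and the integer offset \<open>t0\<close> changes the exponential by full periods.\<close>

lemma fourier_coeff_circle_arc: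
  assumes n: "\<bar>z\<bar> < real n"
  shows "fourier_coeff (\<lambda>w. of_bool (w \<in> circle_arc n z)) l =
    (\<integral>x. indicator {min 0 z..max 0 z} x *\<^sub>R (cis (- (2 * pi * of_int l * x / real n)) / of_nat n) \<partial>lborel)"
proof -
  have n0: "real n > 0" using n by linarith
  define t0 where "t0 = (if z \<ge> 0 then 0 else 1 :: real)"
  define J where "J = {min 0 z..max 0 z}"
  define f where "f = (\<lambda>t. indicator J (real n * (t - t0)) *\<^sub>R cis (- (2 * pi * of_int l * t)))"
  have "fourier_coeff (\<lambda>w. of_bool (w \<in> circle_arc n z)) l = (\<integral>t. f t \<partial>lborel)"
    unfolding fourier_coeff_def
  proof (rule integral_cong_AE)
    have mc: "(\<lambda>t. cis (- (2 * pi * of_int l * t))) \<in> borel_measurable borel"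
      by (intro borel_measurable_continuous_onI continuous_intros)
    then show "(\<lambda>t. indicator {0..1} t *\<^sub>R (of_bool (cis (2 * pi * t) \<in> circle_arc n z) * cis (- (2 * pi * of_int l * t)))) \<in> borel_measurable lborel"
      using borel_measurable_indicator_circle[OF closed_circle_arc, of n z] by auto
    have "(\<lambda>t. indicator J (real n * (t - t0)) :: real) \<in> borel_measurable borel"
      unfolding J_def by measurable
    then show "f \<in> borel_measurable lborel" unfolding f_def using mc by auto
    have "AE t in lborel. t \<noteq> 0 \<and> t \<noteq> (1 :: real)"
      using AE_lborel_singleton[of 0] AE_lborel_singleton[of "1 :: real"] by auto
    then show "AE t in lborel. indicator {0..1} t *\<^sub>R (of_bool (cis (2 * pi * t) \<in> circle_arc n z) * cis (- (2 * pi * of_int l * t))) = f t"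
    proof eventually_elim
      case (elim t)
      show ?case
      proof (cases "0 < t \<and> t < 1")
        case True
        then show ?thesis using cis_in_circle_arc_iff[OF n, of t] by (simp add: f_def J_def t0_def indicator_def)
      next
        case False
        then have t: "t < 0 \<or> t > 1" using elim by linarith
        have "real n * (t - t0) \<notin> J"
        proof (cases "z \<ge> 0")
          case True
          then have J: "J = {0..z}" "t0 = 0" by (simp_all add: J_def t0_def)
          have "t < 0 \<Longrightarrow> real n * t < 0" using mult_pos_neg[OF n0] by simp
          moreover have "t > 1 \<Longrightarrow> real n < real n * t" using mult_strict_left_mono[OF _ n0, of 1 t] by simp
          ultimately have "real n * t < 0 \<or> z < real n * t" using t n by linarith
          then show ?thesis unfolding J by auto
        next
          case False
          then have J: "J = {z..0}" "t0 = 1" by (simp_all add: J_def t0_def)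
          have "t < 0 \<Longrightarrow> real n * (t - 1) < real n * (- 1)" by (intro mult_strict_left_mono n0) simp
          moreover have "t > 1 \<Longrightarrow> 0 < real n * (t - 1)" using n0 by simp
          ultimately have "real n * (t - 1) < z \<or> 0 < real n * (t - 1)" using t n by linarith
          then show ?thesis unfolding J by auto
        qed
        then show ?thesis using t by (auto simp: f_def indicator_def)
      qed
    qed
  qed
  also have "\<dots> = \<bar>1 / real n\<bar> *\<^sub>R (\<integral>x. f (t0 + (1 / real n) * x) \<partial>lborel)"
    using n0 by (intro lborel_integral_real_affine) simp
  also have "(\<lambda>x. f (t0 + (1 / real n) * x)) = (\<lambda>x. indicator J x *\<^sub>R cis (- (2 * pi * of_int l * x / real n)))"
  proof
    fix x
    have "cis (- (2 * pi * of_int l * (t0 + (1 / real n) * x))) = cis (2 * pi * of_int (- l * (if z \<ge> 0 then 0 else 1))) * cis (- (2 * pi * of_int l * x / real n))"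
      by (simp add: cis_mult t0_def algebra_simps)
    also have "cis (2 * pi * of_int (- l * (if z \<ge> 0 then 0 else 1))) = 1"
      by (rule cis_multiple_2pi) (rule Ints_of_int)
    finally show "f (t0 + (1 / real n) * x) = indicator J x *\<^sub>R cis (- (2 * pi * of_int l * x / real n))"
      using n0 by (simp add: f_def)
  qed
  also have "\<bar>1 / real n\<bar> *\<^sub>R (\<integral>x. indicator J x *\<^sub>R cis (- (2 * pi * of_int l * x / real n)) \<partial>lborel) =
      (\<integral>x. \<bar>1 / real n\<bar> *\<^sub>R (indicator J x *\<^sub>R cis (- (2 * pi * of_int l * x / real n))) \<partial>lborel)"
    by (rule integral_scaleR_right[symmetric])
  finally show ?thesis using n0 by (simp add: J_def scaleR_conv_of_real divide_inverse mult_ac)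
qed

text \<open>Endpoints are null sets, so an interval of length \<open>c\<close> agrees with a closed
  one almost everywhere; length 0 includes the empty set. An unbounded interval contains segments of
  every length, which contradicts its finite measure.\<close>

lemma finite_interval_AE:
  fixes I :: "real set"
  assumes I: "is_interval I" "emeasure lborel I = ennreal c" and c: "c \<ge> 0"
  obtains a where "bounded I" "I \<in> sets borel" "AE x in lborel. x \<in> I \<longleftrightarrow> x \<in> {a..a + c}"
proof -
  note obtained = that
  have inf: False if seg: "\<And>m :: nat. \<exists>a. {a..a + real m} \<subseteq> I" and Ib: "I \<in> sets borel"
  proof -
    obtain m :: nat where m: "c < real m" using reals_Archimedean2 by blast
    obtain a where "{a..a + real m} \<subseteq> I" using seg by blast
    then have "emeasure lborel {a..a + real m} \<le> emeasure lborel I" using Ib by (intro emeasure_mono) auto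
    then show False using m c unfolding I(2) by (simp add: ennreal_le_iff)
  qed
  have ivl: thesis if "a \<le> b" "{a<..<b} \<subseteq> I" "I \<subseteq> {a..b}" "I \<in> sets borel" for a b
  proof -
    have ne: "AE x in lborel. x \<noteq> a \<and> x \<noteq> b"
      using AE_lborel_singleton[of a] AE_lborel_singleton[of b] by auto
    then have eq: "AE x in lborel. x \<in> I \<longleftrightarrow> x \<in> {a..b}"
    proof eventually_elim
      case (elim x)
      then show ?case using that by (auto simp: subset_iff)
    qed
    then have "emeasure lborel I = emeasure lborel {a..b}"
      using that(4) by (intro emeasure_eq_AE) auto
    then have "b - a = c" using that(1) c I(2) by simp
    then have "b = a + c" by simp
    moreover have "bounded I" using that(3) bounded_closed_interval bounded_subset by blast
    ultimately show ?thesis using eq that(4) by (intro obtained[of a]) auto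
  qed
  from is_real_interval[OF I(1)] obtain a b where cases:
    "I = {} \<or> I = UNIV \<or> I = {..<b} \<or> I = {..b} \<or> I = {a<..} \<or> I = {a..} \<or> I = {a<..<b} \<or> I = {a<..b} \<or> I = {a..<b} \<or> I = {a..b}"
    by auto
  show thesis
  proof (cases "I = {} \<or> I = {a<..<b} \<or> I = {a<..b} \<or> I = {a..<b} \<or> I = {a..b}")
    case True
    show ?thesis
    proof (cases "I = {}")
      case True
      then show ?thesis by (intro ivl[of 0 0]) auto
    next
      case False
      with True have "a \<le> b \<and> {a<..<b} \<subseteq> I \<and> I \<subseteq> {a..b} \<and> I \<in> sets borel"
        by (elim disjE) auto
      then show ?thesis by (intro ivl[of a b]) auto
    qed
  next
    case False
    then have "I = UNIV \<or> I = {..<b} \<or> I = {..b} \<or> I = {a<..} \<or> I = {a..}" using cases by simp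
    then have "({a + 1..} \<subseteq> I \<or> {..b - 1} \<subseteq> I) \<and> I \<in> sets borel"
      by (elim disjE) auto
    moreover have "{a + 1..a + 1 + real m} \<subseteq> {a + 1..}" "{b - 1 - real m..b - 1 - real m + real m} \<subseteq> {..b - 1}" for m
      by auto
    ultimately show ?thesis using inf by (meson order_trans)
  qed
qed

text \<open>A translation takes the interval between 0 and \<open>z\<close> to the closed interval
  that represents \<open>I\<close>; it multiplies the Fourier coefficients by phases, which drop out
  of the sum.\<close>

lemma toeplitz_sum_circle_arc:
  assumes n: "\<bar>z\<bar> < real n"
    and I: "I \<in> sets borel" "emeasure lborel I < \<infinity>" "AE x in lborel. x \<in> I \<longleftrightarrow> x \<in> {a..a + \<bar>z\<bar>}"
  shows "toeplitz_sum r n (fourier_coeff (\<lambda>w. of_bool (w \<in> circle_arc n z))) =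
    (\<integral>x. (\<Prod>a<r. indicator I (x a)) * leibniz_sum r (\<lambda>a b. dirichlet n (x a - x b)) \<partial>PiM {..<r} (\<lambda>_. lborel))"
proof -
  have n0: "real n > 0" using n by linarith
  define \<theta> where "\<theta> = - (2 * pi * (min 0 z - a) / real n)"
  define f where "f = (\<lambda>l x. cis (- (2 * pi * of_int l * x / real n)) / (of_nat n :: complex))"
  have "fourier_coeff (\<lambda>w. of_bool (w \<in> circle_arc n z)) l = cis (\<theta> * of_int l) * (\<integral>x. indicator I x *\<^sub>R f l x \<partial>lborel)" for l
  proof -
    have mf: "f l \<in> borel_measurable borel"
      unfolding f_def using n0 by (intro borel_measurable_continuous_onI continuous_intros) auto
    have "fourier_coeff (\<lambda>w. of_bool (w \<in> circle_arc n z)) l = (\<integral>x. indicator {min 0 z..max 0 z} x *\<^sub>R f l x \<partial>lborel)"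
      unfolding f_def by (rule fourier_coeff_circle_arc[OF n])
    also have "\<dots> = \<bar>1\<bar> *\<^sub>R (\<integral>x. indicator {min 0 z..max 0 z} ((min 0 z - a) + 1 * x) *\<^sub>R f l ((min 0 z - a) + 1 * x) \<partial>lborel)"
      by (rule lborel_integral_real_affine) simp
    also have "\<dots> = (\<integral>x. cis (\<theta> * of_int l) * (indicator {a..a + \<bar>z\<bar>} x *\<^sub>R f l x) \<partial>lborel)"
      unfolding abs_one scaleR_one
    proof (rule Bochner_Integration.integral_cong[OF refl])
      fix x
      have "f l ((min 0 z - a) + 1 * x) = cis (\<theta> * of_int l) * f l x"
        by (simp add: f_def \<theta>_def cis_mult algebra_simps add_divide_distrib diff_divide_distrib)
      moreover have "indicator {min 0 z..max 0 z} ((min 0 z - a) + 1 * x) = (indicator {a..a + \<bar>z\<bar>} x :: real)"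
        by (auto simp: indicator_def)
      ultimately show "indicator {min 0 z..max 0 z} ((min 0 z - a) + 1 * x) *\<^sub>R f l ((min 0 z - a) + 1 * x) =
         cis (\<theta> * of_int l) * (indicator {a..a + \<bar>z\<bar>} x *\<^sub>R f l x)" by (simp only: mult_scaleR_right)
    qed
    also have "\<dots> = cis (\<theta> * of_int l) * (\<integral>x. indicator {a..a + \<bar>z\<bar>} x *\<^sub>R f l x \<partial>lborel)" by (rule integral_mult_right_zero)
    also have "(\<integral>x. indicator {a..a + \<bar>z\<bar>} x *\<^sub>R f l x \<partial>lborel) = (\<integral>x. indicator I x *\<^sub>R f l x \<partial>lborel)"
    proof (rule integral_cong_AE)
      show "AE x in lborel. indicator {a..a + \<bar>z\<bar>} x *\<^sub>R f l x = indicator I x *\<^sub>R f l x"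
        using I(3) by eventually_elim (auto simp: indicator_def)
    qed (use mf I(1) in auto)
    finally show ?thesis .
  qed
  then have "toeplitz_sum r n (fourier_coeff (\<lambda>w. of_bool (w \<in> circle_arc n z))) =
      toeplitz_sum r n (\<lambda>l. cis (\<theta> * of_int l) * (\<integral>x. indicator I x *\<^sub>R f l x \<partial>lborel))"
    by (intro arg_cong[of _ _ "toeplitz_sum r n"] ext)
  also have "\<dots> = toeplitz_sum r n (\<lambda>l. \<integral>x. indicator I x *\<^sub>R f l x \<partial>lborel)" by (rule toeplitz_sum_phase)
  also have "\<dots> = (\<integral>x. (\<Prod>a<r. indicator I (x a)) * leibniz_sum r (\<lambda>a b. dirichlet n (x a - x b)) \<partial>PiM {..<r} (\<lambda>_. lborel))"
    unfolding f_def by (rule toeplitz_sum_integral[OF I(1,2)])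
  finally show ?thesis .
qed

text \<open>Only the injective tuples into the set where \<open>P\<close> holds contribute, each
  with value 1; this turns sums over distinct eigenvalues into binomial moments of the
  count.\<close>

lemma sum_inj_tuples_choose:
  "(\<Sum>\<phi>\<in>inj_tuples r n. \<Prod>a<r. of_bool (P (\<phi> a)) :: complex) = of_nat (fact r * ((\<Sum>i<n. of_bool (P i)) choose r))"
proof -
  define T where "T = {i. i < n \<and> P i}"
  have T: "finite T" by (simp add: T_def)
  have card: "card T = (\<Sum>i<n. of_bool (P i))"
  proof -
    have "(\<Sum>i<n. of_bool (P i)) = card ({..<n} \<inter> {i. P i})" by (simp add: sum_of_bool_eq)
    also have "{..<n} \<inter> {i. P i} = T" by (auto simp: T_def)
    finally show ?thesis by simp
  qed
  have "(\<Prod>a<r. of_bool (P (\<phi> a)) :: complex) = of_bool (\<forall>a<r. P (\<phi> a))" for \<phi>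
    by (induction r) (auto simp: less_Suc_eq)
  then have "(\<Sum>\<phi>\<in>inj_tuples r n. \<Prod>a<r. of_bool (P (\<phi> a)) :: complex) = of_nat (card (inj_tuples r n \<inter> {\<phi>. \<forall>a<r. P (\<phi> a)}))"
    by (simp add: sum_of_bool_eq)
  also have "inj_tuples r n \<inter> {\<phi>. \<forall>a<r. P (\<phi> a)} = {f \<in> {..<r} \<rightarrow>\<^sub>E T. inj_on f {..<r}}"
    by (auto simp: inj_tuples_def T_def PiE_iff)
  finally show ?thesis using card_inj_tuples_choose[OF T, of r] card by simp
qed

lemma haar_eigenvalue_count:
  assumes h: "haar_unitary n \<mu>" and S: "closed S" "S \<noteq> {}" and n: "n > 0"
  shows "(\<lambda>U. eigenvalue_count U S) \<in> measurable \<mu> (count_space UNIV)"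
    and "U \<in> space \<mu> \<Longrightarrow> eigenvalue_count U S \<le> n"
    and "r \<le> n \<Longrightarrow> complex_of_real (fact r * (\<integral>U. real (eigenvalue_count U S choose r) \<partial>\<mu>)) =
           toeplitz_sum r n (fourier_coeff (\<lambda>w. of_bool (w \<in> S)))"
proof -
  have sets: "sets \<mu> = sets (unitary_borel n)" using h by (simp add: haar_unitary_def)
  have space: "space \<mu> = unitary_group n" using sets_eq_imp_space_eq[OF sets] by simp
  interpret loop_equations \<mu> n "\<lambda>U i. eigs U ! i" by (rule haar_loop_equations[OF h])
  have count: "eigenvalue_count U S = (\<Sum>i<n. of_bool (eigs U ! i \<in> S))" if "U \<in> space \<mu>" for U
    using that space by (intro eigenvalue_count_eq unitary_groupD) simp
  have F: "(\<Sum>\<phi>\<in>inj_tuples r n. \<Prod>a<r. of_bool (eigs U ! (\<phi> a) \<in> S)) = complex_of_real (fact r * real (eigenvalue_count U S choose r))"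
    if "U \<in> space \<mu>" for U r
    unfolding count[OF that] sum_inj_tuples_choose[of "\<lambda>i. eigs U ! i \<in> S"] by simp
  \<comment> \<open>The case \<open>r = 1\<close> is the count itself. Its measurability is read off
    here, since the single entries of \<open>eigs\<close> are not known to be measurable.\<close>
  have "(\<lambda>U. \<Sum>\<phi>\<in>inj_tuples 1 n. \<Prod>a<1. of_bool (eigs U ! (\<phi> a) \<in> S) :: complex) \<in> borel_measurable \<mu>"
    using n by (intro indicator_moment(1)[OF S]) auto
  then have "(\<lambda>U. complex_of_real (fact 1 * real (eigenvalue_count U S choose 1))) \<in> borel_measurable \<mu>"
    by (subst (asm) measurable_cong[OF F])
  then have "(\<lambda>U. Re (complex_of_real (fact 1 * real (eigenvalue_count U S choose 1)))) \<in> borel_measurable \<mu>"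
    by (simp only: borel_measurable_complex_iff)
  then have "(\<lambda>U. real (eigenvalue_count U S)) \<in> borel_measurable \<mu>" by simp
  then have "(\<lambda>U. nat \<lfloor>real (eigenvalue_count U S)\<rfloor>) \<in> measurable \<mu> (count_space UNIV)"
    by measurable
  then show "(\<lambda>U. eigenvalue_count U S) \<in> measurable \<mu> (count_space UNIV)" by simp
  show "U \<in> space \<mu> \<Longrightarrow> eigenvalue_count U S \<le> n"
    using sum_bounded_above[of "{..<n}" "\<lambda>i. of_bool (eigs U ! i \<in> S)" "1 :: nat"] by (simp add: count)
  assume r: "r \<le> n"
  have "complex_of_real (fact r * (\<integral>U. real (eigenvalue_count U S choose r) \<partial>\<mu>)) = (\<integral>U. complex_of_real (fact r * real (eigenvalue_count U S choose r)) \<partial>\<mu>)"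
    by (simp only: integral_mult_right_zero integral_complex_of_real)
  also have "\<dots> = (\<integral>U. (\<Sum>\<phi>\<in>inj_tuples r n. \<Prod>a<r. of_bool (eigs U ! (\<phi> a) \<in> S)) \<partial>\<mu>)"
    by (intro Bochner_Integration.integral_cong refl F[symmetric])
  also have "\<dots> = toeplitz_sum r n (fourier_coeff (\<lambda>w. of_bool (w \<in> S)))"
    by (rule indicator_moment(2)[OF S r n])
  finally show "complex_of_real (fact r * (\<integral>U. real (eigenvalue_count U S choose r) \<partial>\<mu>)) =
           toeplitz_sum r n (fourier_coeff (\<lambda>w. of_bool (w \<in> S)))" .
qed

section \<open>Convergence of the binomial moments\<close>

text \<open>The Dirichlet matrix is a Gram matrix: its quadratic form is the mean over the
  frequencies \<open>j < n\<close> of squared moduli of linear forms. Its diagonal entries are 1, so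
  the bound for correlation matrices applies.\<close>

lemma norm_leibniz_sum_dirichlet_le_1:
  assumes n: "n > 0"
  shows "norm (leibniz_sum r (\<lambda>a b. dirichlet n (x a - x b))) \<le> 1"
  unfolding leibniz_sum_eq_det
proof (rule norm_det_correlation_matrix_le_1)
  fix v :: "complex Matrix.vec" assume "v \<in> carrier_vec r"
  define t where "t = (\<lambda>j a. cis (- (2 * pi * real j * x a / real n)) * v $ a)"
  have kernel: "cnj (v $ a) * dirichlet n (x a - x b) * v $ b = (\<Sum>j<n. cnj (t j a) * t j b) / of_nat n" for a b
  proof -
    have "cis (2 * pi * real j * (x a - x b) / real n) = cis (2 * pi * real j * x a / real n) * cis (- (2 * pi * real j * x b / real n))" for j
      by (simp add: cis_mult right_diff_distrib diff_divide_distrib)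
    then have "cnj (t j a) * t j b = cnj (v $ a) * cis (2 * pi * real j * (x a - x b) / real n) * v $ b" for j
      by (simp only: t_def complex_cnj_mult cis_cnj minus_minus mult_ac)
    then show ?thesis
      by (simp only: dirichlet_def sum_distrib_left[symmetric] sum_distrib_right[symmetric] times_divide_eq_right times_divide_eq_left)
  qed
  have "(\<Sum>a<r. \<Sum>b<r. cnj (v $ a) * Matrix.mat r r (\<lambda>(a, b). dirichlet n (x a - x b)) $$ (a, b) * v $ b)
      = (\<Sum>a<r. \<Sum>b<r. (\<Sum>j<n. cnj (t j a) * t j b) / of_nat n)"
    unfolding kernel[symmetric] by (intro sum.cong refl) simp
  also have "\<dots> = (\<Sum>a<r. \<Sum>b<r. \<Sum>j<n. cnj (t j a) * t j b) / of_nat n"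
    by (simp only: sum_divide_distrib)
  also have "(\<Sum>a<r. \<Sum>b<r. \<Sum>j<n. cnj (t j a) * t j b) = (\<Sum>j<n. \<Sum>a<r. \<Sum>b<r. cnj (t j a) * t j b)"
    by (simp only: sum.swap[of _ "{..<n}" "{..<r}"])
  also have "\<dots> = (\<Sum>j<n. cnj (\<Sum>a<r. t j a) * (\<Sum>a<r. t j a))"
    by (simp only: sum_product cnj_sum)
  also have "\<dots> = of_real (\<Sum>j<n. (norm (\<Sum>a<r. t j a))\<^sup>2)"
    by (simp only: of_real_sum complex_norm_square mult.commute)
  finally have "(\<Sum>a<r. \<Sum>b<r. cnj (v $ a) * Matrix.mat r r (\<lambda>(a, b). dirichlet n (x a - x b)) $$ (a, b) * v $ b)
      = of_real ((\<Sum>j<n. (norm (\<Sum>a<r. t j a))\<^sup>2) / real n)"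
    by (simp only: of_real_divide of_real_of_nat_eq)
  moreover have "(\<Sum>j<n. (norm (\<Sum>a<r. t j a))\<^sup>2) / real n \<ge> 0" by (intro divide_nonneg_nonneg sum_nonneg) auto
  ultimately show "\<exists>t\<ge>0. (\<Sum>a<r. \<Sum>b<r. cnj (v $ a) * Matrix.mat r r (\<lambda>(a, b). dirichlet n (x a - x b)) $$ (a, b) * v $ b) = of_real t"
    by blast
qed (use n in \<open>simp_all add: dirichlet_def\<close>)

section \<open>Integrals of the determinants over powers of the interval\<close>

lemma indicator_prod_integral:
  fixes I :: "real set"
  assumes I: "I \<in> sets borel" "emeasure lborel I = ennreal c" "c \<ge> 0"
  shows "integrable (PiM {..<r} (\<lambda>_. lborel)) (\<lambda>x. \<Prod>a<r. indicator I (x a) :: real)"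
    and "(\<integral>x. (\<Prod>a<r. indicator I (x a) :: real) \<partial>PiM {..<r} (\<lambda>_. lborel)) = c ^ r"
proof -
  interpret product_sigma_finite "\<lambda>_ :: nat. lborel :: real measure" ..
  have int: "integrable lborel (indicator I :: real \<Rightarrow> real)" using I by (simp add: integrable_indicator_iff)
  show "integrable (PiM {..<r} (\<lambda>_. lborel)) (\<lambda>x. \<Prod>a<r. indicator I (x a) :: real)"
    by (rule product_integrable_prod[OF finite_lessThan int])
  have "(\<integral>x. (\<Prod>a<r. indicator I (x a) :: real) \<partial>PiM {..<r} (\<lambda>_. lborel)) = (\<Prod>a<r. \<integral>x. indicator I x \<partial>lborel)"
    by (rule product_integral_prod[OF finite_lessThan int])
  also have "(\<integral>x. (indicator I x :: real) \<partial>lborel) = c" using I by (simp add: measure_def)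
  finally show "(\<integral>x. (\<Prod>a<r. indicator I (x a) :: real) \<partial>PiM {..<r} (\<lambda>_. lborel)) = c ^ r" by simp
qed

lemma norm_indicator_prod_mult_le:
  fixes c :: complex
  assumes "norm c \<le> 1"
  shows "norm ((\<Prod>a<r. indicator I (x a)) * c) \<le> (\<Prod>a<r. indicator I (x a) :: real)"
proof -
  have "norm (\<Prod>a<r. indicator I (x a) :: complex) = (\<Prod>a<r. indicator I (x a))"
    unfolding prod_norm[symmetric] by (intro prod.cong refl) (simp add: indicator_def)
  moreover have "(\<Prod>a<r. indicator I (x a) :: real) \<ge> 0" by (intro prod_nonneg) (simp add: indicator_def)
  ultimately show ?thesis using assms by (simp add: norm_mult mult_left_le)
qed

lemma measurable_indicator_prod_leibniz_dirichlet:
  assumes I: "I \<in> sets borel"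
  shows "(\<lambda>x. (\<Prod>a<r. indicator I (x a)) * leibniz_sum r (\<lambda>a b. dirichlet n (x a - x b))) \<in> borel_measurable (PiM {..<r} (\<lambda>_. lborel))"
proof -
  have dir: "dirichlet n \<in> borel_measurable borel"
    unfolding dirichlet_def divide_inverse by (intro borel_measurable_continuous_onI continuous_intros)
  have comp: "(\<lambda>x. x a :: real) \<in> borel_measurable (PiM {..<r} (\<lambda>_. lborel))" if "a < r" for a
    using measurable_component_singleton[of a "{..<r}" "\<lambda>_. lborel :: real measure"] that by simp
  have "(\<lambda>x. dirichlet n (x a - x b)) \<in> borel_measurable (PiM {..<r} (\<lambda>_. lborel))" if "a < r" "b < r" for a b
    using that by (intro measurable_compose[OF _ dir] borel_measurable_diff comp)
  moreover have "(\<lambda>x. indicator I (x a) :: complex) \<in> borel_measurable (PiM {..<r} (\<lambda>_. lborel))" if "a < r" for a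
    using that I by (intro measurable_compose[OF comp] borel_measurable_indicator)
  moreover have "\<pi> a < r" if "\<pi> permutes {..<r}" "a < r" for \<pi> a using permutes_in_image[OF that(1)] that(2) by auto
  ultimately show ?thesis
    unfolding leibniz_sum_def
    by (intro borel_measurable_times borel_measurable_prod borel_measurable_sum borel_measurable_const) auto
qed

lemma norm_leibniz_dirichlet_integral_le:
  assumes I: "I \<in> sets borel" "emeasure lborel I = ennreal c" "c \<ge> 0" and n: "n > 0"
  shows "norm (\<integral>x. (\<Prod>a<r. indicator I (x a)) * leibniz_sum r (\<lambda>a b. dirichlet n (x a - x b)) \<partial>PiM {..<r} (\<lambda>_. lborel)) \<le> c ^ r"
proof -
  let ?f = "\<lambda>x. (\<Prod>a<r. indicator I (x a)) * leibniz_sum r (\<lambda>a b. dirichlet n (x a - x b))"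
  let ?P = "PiM {..<r} (\<lambda>_. lborel :: real measure)"
  have bound: "norm (?f x) \<le> (\<Prod>a<r. indicator I (x a))" for x
    by (intro norm_indicator_prod_mult_le norm_leibniz_sum_dirichlet_le_1 n)
  have "integrable ?P ?f"
  proof (rule Bochner_Integration.integrable_bound[OF indicator_prod_integral(1)[OF I]])
    show "?f \<in> borel_measurable ?P" by (rule measurable_indicator_prod_leibniz_dirichlet[OF I(1)])
    show "AE x in ?P. norm (?f x) \<le> norm (\<Prod>a<r. indicator I (x a) :: real)"
      by (intro AE_I2 order_trans[OF bound]) simp
  qed
  then have "norm (\<integral>x. ?f x \<partial>?P) \<le> (\<integral>x. norm (?f x) \<partial>?P)" "integrable ?P (\<lambda>x. norm (?f x))"
    by auto
  moreover have "(\<integral>x. norm (?f x) \<partial>?P) \<le> (\<integral>x. (\<Prod>a<r. indicator I (x a)) \<partial>?P)"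
    by (intro integral_mono indicator_prod_integral(1)[OF I] bound calculation(2))
  ultimately show ?thesis unfolding indicator_prod_integral(2)[OF I] by linarith
qed

definition sine_det :: "nat \<Rightarrow> (nat \<Rightarrow> real) \<Rightarrow> real" where
  "sine_det r x = Determinant.det (Matrix.mat r r (\<lambda>(j, k). sine_kernel (x j) (x k)))"

text \<open>The determinant bound makes the product of indicators, of integral \<open>c ^ r\<close>,
  a common majorant. In the pointwise limit the phases cancel in the determinant and the real sine
  determinant is left.\<close>

lemma leibniz_dirichlet_integral_tendsto:
  assumes I: "I \<in> sets borel" "emeasure lborel I = ennreal c" "c \<ge> 0"
    and det: "sine_det r \<in> borel_measurable (PiM {..<r} (\<lambda>_. lborel))"
  shows "integrable (PiM {..<r} (\<lambda>_. lborel)) (\<lambda>x. (\<Prod>a<r. indicator I (x a)) * sine_det r x)"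
    and "(\<lambda>n. \<integral>x. (\<Prod>a<r. indicator I (x a)) * leibniz_sum r (\<lambda>a b. dirichlet n (x a - x b)) \<partial>PiM {..<r} (\<lambda>_. lborel))
      \<longlonglongrightarrow> of_real (\<integral>x. (\<Prod>a<r. indicator I (x a)) * sine_det r x \<partial>PiM {..<r} (\<lambda>_. lborel))"
proof -
  let ?P = "PiM {..<r} (\<lambda>_. lborel :: real measure)"
  define g where "g = (\<lambda>x. (\<Prod>a<r. indicator I (x a)) * sine_det r x)"
  define f where "f = (\<lambda>n x. (\<Prod>a<r. indicator I (x a)) * leibniz_sum r (\<lambda>a b. dirichlet n (x a - x b)))"
  have comp: "(\<lambda>x. x a :: real) \<in> borel_measurable ?P" if "a < r" for a
    using measurable_component_singleton[of a "{..<r}" "\<lambda>_. lborel :: real measure"] that by simp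
  have ind: "(\<lambda>x. indicator I (x a) :: real) \<in> borel_measurable ?P" if "a < r" for a
    using that I by (intro measurable_compose[OF comp] borel_measurable_indicator)
  have "g \<in> borel_measurable ?P"
    unfolding g_def by (intro borel_measurable_times borel_measurable_prod det) (use ind in auto)
  then have mg: "(\<lambda>x. complex_of_real (g x)) \<in> borel_measurable ?P" by simp
  \<comment> \<open>The determinant bound is stated for positive \<open>n\<close>, hence the shift
    by one.\<close>
  have mf: "f (Suc n) \<in> borel_measurable ?P" for n
    unfolding f_def by (rule measurable_indicator_prod_leibniz_dirichlet[OF I(1)])
  have bound: "AE x in ?P. norm (f (Suc n) x) \<le> (\<Prod>a<r. indicator I (x a))" for n
    unfolding f_def by (intro AE_I2 norm_indicator_prod_mult_le norm_leibniz_sum_dirichlet_le_1) simp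
  have lim: "AE x in ?P. (\<lambda>n. f (Suc n) x) \<longlonglongrightarrow> complex_of_real (g x)"
  proof (rule AE_I2)
    fix x :: "nat \<Rightarrow> real"
    have "(\<lambda>n. leibniz_sum r (\<lambda>a b. dirichlet n (x a - x b))) \<longlonglongrightarrow>
        leibniz_sum r (\<lambda>a b. cis (pi * (x a - x b)) * of_real (sine_kernel (x a) (x b)))"
      unfolding leibniz_sum_def by (intro tendsto_sum tendsto_mult tendsto_const tendsto_prod dirichlet_tendsto)
    also have "leibniz_sum r (\<lambda>a b. cis (pi * (x a - x b)) * of_real (sine_kernel (x a) (x b))) = of_real (sine_det r x)"
      unfolding sine_det_def of_real_det_eq_leibniz_sum right_diff_distrib by (rule leibniz_sum_phase)
    finally have "(\<lambda>n. f n x) \<longlonglongrightarrow> (\<Prod>a<r. indicator I (x a)) * of_real (sine_det r x)"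
      unfolding f_def by (intro tendsto_mult tendsto_const)
    also have "(\<Prod>a<r. indicator I (x a)) * of_real (sine_det r x) = complex_of_real (g x)"
    proof -
      have "(\<Prod>a<r. indicator I (x a) :: complex) = of_real (\<Prod>a<r. indicator I (x a))"
        unfolding of_real_prod by (intro prod.cong refl) (simp add: indicator_def)
      then show ?thesis by (simp add: g_def)
    qed
    finally show "(\<lambda>n. f (Suc n) x) \<longlonglongrightarrow> complex_of_real (g x)" by (rule LIMSEQ_Suc)
  qed
  have "integrable ?P (\<lambda>x. complex_of_real (g x))"
    by (rule integrable_dominated_convergence[OF mg mf indicator_prod_integral(1)[OF I] lim bound])
  from integrable_Re[OF this] show "integrable ?P (\<lambda>x. (\<Prod>a<r. indicator I (x a)) * sine_det r x)"
    by (simp only: g_def Re_complex_of_real)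
  have "(\<lambda>n. \<integral>x. f (Suc n) x \<partial>?P) \<longlonglongrightarrow> (\<integral>x. complex_of_real (g x) \<partial>?P)"
    by (rule integral_dominated_convergence[OF mg mf indicator_prod_integral(1)[OF I] lim bound])
  then have "(\<lambda>n. \<integral>x. f n x \<partial>?P) \<longlonglongrightarrow> (\<integral>x. complex_of_real (g x) \<partial>?P)"
    by (rule LIMSEQ_imp_Suc)
  then show "(\<lambda>n. \<integral>x. (\<Prod>a<r. indicator I (x a)) * leibniz_sum r (\<lambda>a b. dirichlet n (x a - x b)) \<partial>?P)
      \<longlonglongrightarrow> of_real (\<integral>x. (\<Prod>a<r. indicator I (x a)) * sine_det r x \<partial>?P)"
    unfolding f_def g_def integral_complex_of_real .
qed

section \<open>Binomial moments of a point process\<close>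

text \<open>The test function is a product of indicators of \<open>I\<close>: a tuple of distinct
  labelled points counts exactly if all of them lie in \<open>I\<close>, so the inner sum is
  \<open>fact r\<close> times a binomial coefficient of the count. The labels make a multiple point
  count with its multiplicity, and local finiteness makes the set of tuples finite.\<close>

lemma point_count_binomial_moment:
  assumes X: "point_process N X" and \<rho>: "correlation_function N X r \<rho>"
    and I: "I \<in> sets borel" "bounded I"
    and int: "integrable (PiM {..<r} (\<lambda>_. lborel)) (\<lambda>x. (\<Prod>a<r. indicator I (x a)) * \<rho> x)"
  shows "integrable N (\<lambda>\<omega>. real (point_count (X \<omega>) I choose r))"
    and "fact r * (\<integral>\<omega>. real (point_count (X \<omega>) I choose r) \<partial>N) =
      (\<integral>x. (\<Prod>a<r. indicator I (x a)) * \<rho> x \<partial>PiM {..<r} (\<lambda>_. lborel))"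
proof -
  let ?P = "PiM {..<r} (\<lambda>_. lborel :: real measure)"
  define F :: "(nat \<Rightarrow> real) \<Rightarrow> ennreal" where "F = (\<lambda>x. \<Prod>a<r. indicator I (x a))"
  define g where "g = (\<lambda>\<omega>. fact r * real (point_count (X \<omega>) I choose r))"
  have comp: "(\<lambda>x. x a :: real) \<in> borel_measurable ?P" if "a < r" for a
    using measurable_component_singleton[of a "{..<r}" "\<lambda>_. lborel :: real measure"] that by simp
  have F: "F \<in> borel_measurable ?P"
    unfolding F_def using I by (intro borel_measurable_prod_ennreal measurable_compose[OF comp] borel_measurable_indicator) auto
  have count: "(\<integral>\<^sup>+ p. F (\<lambda>i \<in> {..<r}. fst (p i)) \<partial>count_space {p \<in> {..<r} \<rightarrow>\<^sub>E config_points (X \<omega>). inj_on p {..<r}}) = ennreal (g \<omega>)"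
    if \<omega>: "\<omega> \<in> space N" for \<omega>
  proof -
    define Q where "Q = {p \<in> config_points (X \<omega>). fst p \<in> I}"
    define B where "B = {p \<in> {..<r} \<rightarrow>\<^sub>E Q. inj_on p {..<r}}"
    let ?A = "{p \<in> {..<r} \<rightarrow>\<^sub>E config_points (X \<omega>). inj_on p {..<r}}"
    have Q: "finite Q" using X \<omega> I(2) by (auto simp: point_process_def locally_finite_config_def Q_def)
    have finB: "finite B" unfolding B_def by (rule finite_subset[OF _ finite_PiE[of "{..<r}" "\<lambda>_. Q"]]) (auto simp: Q)
    have "F (\<lambda>i \<in> {..<r}. fst (p i)) = indicator B p" if "p \<in> ?A" for p
    proof -
      have "F (\<lambda>i \<in> {..<r}. fst (p i)) = (\<Prod>a<r. indicator I (fst (p a)))"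
        unfolding F_def by (intro prod.cong refl) simp
      also have "\<dots> = of_bool (\<forall>a<r. fst (p a) \<in> I)"
        by (induction r) (auto simp: less_Suc_eq indicator_def)
      also have "\<dots> = indicator B p"
        using that by (auto simp: B_def Q_def indicator_def PiE_iff)
      finally show ?thesis .
    qed
    then have "(\<integral>\<^sup>+ p. F (\<lambda>i \<in> {..<r}. fst (p i)) \<partial>count_space ?A) = (\<integral>\<^sup>+ p. indicator B p \<partial>count_space ?A)"
      by (intro nn_integral_cong) simp
    also have "\<dots> = emeasure (count_space ?A) B"
      by (rule nn_integral_indicator) (auto simp: B_def Q_def PiE_iff)
    also have "\<dots> = of_nat (card B)"
      using finB by (intro emeasure_count_space_finite) (auto simp: B_def Q_def PiE_iff)
    also have "card B = fact r * (point_count (X \<omega>) I choose r)"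
      unfolding B_def card_inj_tuples_choose[OF Q] by (simp add: point_count_def Q_def)
    finally show ?thesis by (simp only: g_def ennreal_of_nat_eq_real_of_nat of_nat_mult of_nat_fact)
  qed
  have \<rho>0: "\<rho> x \<ge> 0" for x using \<rho> by (simp add: correlation_function_def)
  have nonneg: "(\<Prod>a<r. indicator I (x a)) * \<rho> x \<ge> 0" for x
    by (intro mult_nonneg_nonneg prod_nonneg \<rho>0) (simp add: indicator_def)
  have "(\<integral>\<^sup>+ \<omega>. ennreal (g \<omega>) \<partial>N) = (\<integral>\<^sup>+ \<omega>. (\<integral>\<^sup>+ p. F (\<lambda>i \<in> {..<r}. fst (p i))
      \<partial>count_space {p \<in> {..<r} \<rightarrow>\<^sub>E config_points (X \<omega>). inj_on p {..<r}}) \<partial>N)"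
    by (intro nn_integral_cong count[symmetric])
  also have "\<dots> = (\<integral>\<^sup>+ x. F x * ennreal (\<rho> x) \<partial>?P)"
    using \<rho> F unfolding correlation_function_def by blast
  also have "\<dots> = (\<integral>\<^sup>+ x. ennreal ((\<Prod>a<r. indicator I (x a)) * \<rho> x) \<partial>?P)"
  proof (intro nn_integral_cong)
    fix x :: "nat \<Rightarrow> real"
    have "F x = ennreal (\<Prod>a<r. indicator I (x a))"
      unfolding F_def by (subst prod_ennreal[symmetric]) (auto simp: indicator_def intro!: prod.cong)
    then show "F x * ennreal (\<rho> x) = ennreal ((\<Prod>a<r. indicator I (x a)) * \<rho> x)"
      by (simp add: ennreal_mult'' \<rho>0)
  qed
  also have "\<dots> = ennreal (\<integral>x. (\<Prod>a<r. indicator I (x a)) * \<rho> x \<partial>?P)"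
    by (intro nn_integral_eq_integral int AE_I2 nonneg)
  finally have eq: "(\<integral>\<^sup>+ \<omega>. ennreal (g \<omega>) \<partial>N) = ennreal (\<integral>x. (\<Prod>a<r. indicator I (x a)) * \<rho> x \<partial>?P)" .
  have g0: "g \<omega> \<ge> 0" for \<omega> by (simp add: g_def)
  have "(\<lambda>\<omega>. point_count (X \<omega>) I) \<in> measurable N (count_space UNIV)"
    using X I by (simp add: point_process_def)
  then have "g \<in> borel_measurable N" unfolding g_def by measurable
  then have int_g: "integrable N g"
    using eq g0 by (intro integrableI_nonneg) auto
  then have "integrable N (\<lambda>\<omega>. g \<omega> / fact r)" by (rule integrable_divide)
  then show "integrable N (\<lambda>\<omega>. real (point_count (X \<omega>) I choose r))" by (simp add: g_def)
  have "ennreal (\<integral>\<omega>. g \<omega> \<partial>N) = ennreal (\<integral>x. (\<Prod>a<r. indicator I (x a)) * \<rho> x \<partial>?P)"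
    using nn_integral_eq_integral[OF int_g] g0 eq by simp
  moreover have "(\<integral>\<omega>. g \<omega> \<partial>N) \<ge> 0" "(\<integral>x. (\<Prod>a<r. indicator I (x a)) * \<rho> x \<partial>?P) \<ge> 0"
    by (intro Bochner_Integration.integral_nonneg g0 nonneg)+
  ultimately have "(\<integral>\<omega>. g \<omega> \<partial>N) = (\<integral>x. (\<Prod>a<r. indicator I (x a)) * \<rho> x \<partial>?P)" by (simp only: ennreal_inj)
  then show "fact r * (\<integral>\<omega>. real (point_count (X \<omega>) I choose r) \<partial>N) = (\<integral>x. (\<Prod>a<r. indicator I (x a)) * \<rho> x \<partial>?P)"
    unfolding g_def by (simp only: integral_mult_right_zero)
qed

section \<open>Convergence in law of the eigenvalue counts\<close>

theorem corollary1p9: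
  fixes M :: "nat \<Rightarrow> 'a measure" and U :: "nat \<Rightarrow> 'a \<Rightarrow> complex mat"
    and N :: "'b measure" and X :: "'b \<Rightarrow> real \<Rightarrow> nat"
    and z :: real and I :: "real set"
  assumes U_prob: "\<And>n. n \<ge> 1 \<Longrightarrow> prob_space (M n)"
    and U_measurable: "\<And>n. n \<ge> 1 \<Longrightarrow> U n \<in> measurable (M n) (unitary_borel n)"
    and U_haar: "\<And>n. n \<ge> 1 \<Longrightarrow> haar_unitary n (distr (M n) (unitary_borel n) (U n))"
    and X_sine: "sine_kernel_process N X"
    and I_interval: "is_interval I" and I_length: "emeasure lborel I = ennreal \<bar>z\<bar>"
  shows "weak_conv_m
    (\<lambda>n. distr (M n) borel (\<lambda>\<omega>. real (eigenvalue_count (U n \<omega>) (circle_arc n z))))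
    (distr N borel (\<lambda>\<omega>. real (point_count (X \<omega>) I)))"
proof -
  obtain a where I: "bounded I" "I \<in> sets borel" "AE x in lborel. x \<in> I \<longleftrightarrow> x \<in> {a..a + \<bar>z\<bar>}"
    using finite_interval_AE[OF I_interval I_length] by auto
  note I' = I(2) I_length abs_ge_zero
  have pp: "point_process N X" using X_sine by (simp add: sine_kernel_process_def)
  then interpret N: prob_space N by (simp add: point_process_def)
  have corr: "correlation_function N X r (sine_det r)" if "r \<ge> 1" for r
    using X_sine that by (simp add: sine_kernel_process_def sine_det_def[abs_def])
  then have "sine_det r \<in> borel_measurable (PiM {..<r} (\<lambda>_. lborel))" if "r \<ge> 1" for r
    using that by (simp add: correlation_function_def)
  note limit = leibniz_dirichlet_integral_tendsto[OF I' this]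
  note moment_N = point_count_binomial_moment[OF pp corr I(2,1) limit(1)]

  define \<mu> where "\<mu> = (\<lambda>n. distr (M n) (unitary_borel n) (U n))"
  define Y where "Y = (\<lambda>n \<omega>. eigenvalue_count (U n \<omega>) (circle_arc n z))"
  define K where "K = (\<lambda>r n. \<integral>x. (\<Prod>a<r. indicator I (x a)) * leibniz_sum r (\<lambda>a b. dirichlet n (x a - x b)) \<partial>PiM {..<r} (\<lambda>_. lborel))"
  \<comment> \<open>From \<open>n0\<close> on \<open>\<bar>z\<bar> < n\<close>, so the arc is less
    than a full turn.\<close>
  define n0 where "n0 = nat \<lceil>\<bar>z\<bar>\<rceil> + 1"
  have n: "n \<ge> 1" "\<bar>z\<bar> < real n" if "n \<ge> n0" for n
    using that unfolding n0_def by linarith+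
  have haar: "haar_unitary n (\<mu> n)" if "n \<ge> n0" for n
    unfolding \<mu>_def by (rule U_haar[OF n(1)[OF that]])
  note count = haar_eigenvalue_count[OF haar closed_circle_arc circle_arc_nonempty]
  have Y_meas: "Y n \<in> measurable (M n) (count_space UNIV)" if "n \<ge> n0" for n
  proof -
    have "(\<lambda>A. eigenvalue_count A (circle_arc n z)) \<in> measurable (unitary_borel n) (count_space UNIV)"
      using count(1)[OF that] n(1)[OF that] by (simp add: \<mu>_def)
    from measurable_compose[OF U_measurable[OF n(1)[OF that]] this] show ?thesis by (simp add: Y_def)
  qed
  have Y_le: "Y n \<omega> \<le> n" if "n \<ge> n0" "\<omega> \<in> space (M n)" for n \<omega>
    using count(2)[OF that(1)] measurable_space[OF U_measurable[OF n(1)[OF that(1)]] that(2)] n(1)[OF that(1)]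
    by (simp add: \<mu>_def Y_def)
  have int: "integrable (M n) (\<lambda>\<omega>. real (Y n \<omega> choose r))" if "n \<ge> n0" for n r
  proof -
    interpret Mn: prob_space "M n" by (rule U_prob[OF n(1)[OF that]])
    note [measurable] = Y_meas[OF that]
    show ?thesis
    proof (rule Mn.integrable_const_bound)
      show "AE \<omega> in M n. norm (real (Y n \<omega> choose r)) \<le> real (n choose r)"
        using Y_le[OF that] by (intro AE_I2) (simp add: binomial_right_mono)
    qed measurable
  qed
  have moment: "complex_of_real (fact r * (\<integral>\<omega>. real (Y n \<omega> choose r) \<partial>M n)) = K r n" if "n \<ge> n0" "r \<le> n" for n r
  proof -
    have "(\<integral>\<omega>. real (Y n \<omega> choose r) \<partial>M n) = (\<integral>A. real (eigenvalue_count A (circle_arc n z) choose r) \<partial>\<mu> n)"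
      unfolding Y_def \<mu>_def
    proof (rule integral_distr[symmetric, OF U_measurable[OF n(1)[OF that(1)]]])
      have [measurable]: "(\<lambda>A. eigenvalue_count A (circle_arc n z)) \<in> measurable (unitary_borel n) (count_space UNIV)"
        using count(1)[OF that(1)] n(1)[OF that(1)] by (simp add: \<mu>_def)
      show "(\<lambda>A. real (eigenvalue_count A (circle_arc n z) choose r)) \<in> borel_measurable (unitary_borel n)" by measurable
    qed
    also have "complex_of_real (fact r * \<dots>) = K r n"
      using count(3)[OF that(1) _ that(2)] n[OF that(1)] toeplitz_sum_circle_arc[OF n(2)[OF that(1)] I(2) _ I(3), of r] I_length
      by (simp add: K_def)
    finally show ?thesis .
  qed
  have bound: "(\<integral>\<omega>. real (Y n \<omega> choose r) \<partial>M n) \<le> \<bar>z\<bar> ^ r / fact r" if "n \<ge> n0" for n r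
  proof (cases "r \<le> n")
    case True
    have "fact r * (\<integral>\<omega>. real (Y n \<omega> choose r) \<partial>M n) \<le> norm (complex_of_real (fact r * (\<integral>\<omega>. real (Y n \<omega> choose r) \<partial>M n)))"
      unfolding norm_of_real by (rule abs_ge_self)
    also have "\<dots> \<le> \<bar>z\<bar> ^ r"
      unfolding moment[OF that True] K_def using n(1)[OF that] by (intro norm_leibniz_dirichlet_integral_le I') simp
    finally show ?thesis by (simp add: field_simps)
  next
    \<comment> \<open>For \<open>r > n\<close> there are too few eigenvalues and the binomial
      coefficient is 0.\<close>
    case False
    have "(\<integral>\<omega>. real (Y n \<omega> choose r) \<partial>M n) = (\<integral>\<omega>. 0 \<partial>M n)"
    proof (intro Bochner_Integration.integral_cong refl)
      fix \<omega> assume "\<omega> \<in> space (M n)"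
      then show "real (Y n \<omega> choose r) = 0" using Y_le[OF that, of \<omega>] False by (simp add: binomial_eq_0_iff)
    qed
    then show ?thesis by simp
  qed
  have lim: "(\<lambda>n. \<integral>\<omega>. real (Y n \<omega> choose r) \<partial>M n) \<longlonglongrightarrow> (\<integral>\<omega>. real (point_count (X \<omega>) I choose r) \<partial>N)" for r
  proof (cases "r = 0")
    \<comment> \<open>The correlation functions start at \<open>r = 1\<close>; the moment of order 0
      is the total mass on both sides.\<close>
    case True
    have "(\<integral>\<omega>. real (Y n \<omega> choose r) \<partial>M n) = 1" if "n \<ge> n0" for n
      using prob_space.prob_space[OF U_prob[OF n(1)[OF that]]] True by simp
    then show ?thesis
      using True N.prob_space by (intro tendsto_eventually eventually_sequentiallyI[of n0]) simp
  next
    case False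
    then have r: "r \<ge> 1" by simp
    have "(\<lambda>n. Re (K r n) / fact r) \<longlonglongrightarrow> (\<integral>\<omega>. real (point_count (X \<omega>) I choose r) \<partial>N)"
      using tendsto_divide[OF tendsto_Re[OF limit(2)[OF r]] tendsto_const[of "fact r :: real"]]
      unfolding K_def by (simp flip: moment_N(2)[OF r r])
    \<comment> \<open>The exact moment formula holds once \<open>r \<le> n\<close>, hence the
      maximum with \<open>n0\<close>.\<close>
    moreover have "Re (K r n) / fact r = (\<integral>\<omega>. real (Y n \<omega> choose r) \<partial>M n)" if "n \<ge> max n0 r" for n
      using moment[of n r] that by (simp flip: moment)
    ultimately show ?thesis
      by (rule Lim_transform_eventually[OF _ eventually_sequentiallyI])
  qed
  have int_N: "integrable N (\<lambda>\<omega>. real (point_count (X \<omega>) I choose r))" for r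
  proof (cases "r = 0")
    case False
    then have "r \<ge> 1" by simp
    then show ?thesis by (intro moment_N(1))
  qed simp
  have "(\<lambda>\<omega>. point_count (X \<omega>) I) \<in> measurable N (count_space UNIV)"
    using pp I by (simp add: point_process_def)
  then show ?thesis
    using weak_conv_binomial_moments[where ?n0.0 = n0 and C = "\<bar>z\<bar>" and M = M and Y = Y and N = N and X = "\<lambda>\<omega>. point_count (X \<omega>) I",
      OF U_prob Y_meas int bound N.prob_space_axioms _ int_N lim] n(1)
    unfolding Y_def by blast
qed

end
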